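(* Let $\nu>0$, $\beta\in(0,1)$, $\alpha\in(0,2)$ and $d<(2\wedge\beta^{-1})\alpha$. Let $\sigma:\mathbb{R}\to\mathbb{R}$ be a locally Lipschitz function for which there is $\gamma>0$ with $\sigma(x)\ge|x|^{1+\gamma}$ for all $x\in\mathbb{R}$. For a nonnegative bounded deterministic function $u_0$ on $\mathbb{R}^d$ with $K_{u_0}:=\int_{B(0,1)}u_0(x)\,dx>0$, let $u_t(x)$ be the solution of $$\partial_t^\beta u_t(x)=-\nu(-\Delta)^{\alpha/2}u_t(x)+I^{1-\beta}[\sigma(u)\dot W(t,x)],\qquad t>0,\ x\in\mathbb{R}^d,$$ with initial condition $u_0$, where $\dot W$ is space-time white noise. Then there exist $t_0\ge0$ and a positive constant $K$ such that for all $t\ge t_0$ and $x\in\mathbb{R}^d$, $$\mathbb{E}|u_t(x)|^2=\infty\quad\text{whenever } K_{u_0}\ge K.$$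
   Context: $\partial_t^\beta$ is the Caputo derivative, $\partial_t^\beta u_t(x)=\frac{1}{\Gamma(1-\beta)}\int_0^t\frac{\partial u_r(x)}{\partial r}\frac{dr}{(t-r)^\beta}$, and $I^{\gamma'}h(t)=\frac{1}{\Gamma(\gamma')}\int_0^t(t-\tau)^{\gamma'-1}h(\tau)\,d\tau$ for $\gamma'>0$. The operator $-\nu(-\Delta)^{\alpha/2}$ is the generator of the isotropic $\alpha$-stable Lévy process $X$ with transition density $p(t,x)$ determined by $\int_{\mathbb{R}^d}e^{i\xi\cdot x}p(t,x)\,dx=e^{-t\nu|\xi|^\alpha}$. Let $D$ be a $\beta$-stable subordinator independent of $X$ ($\mathbb{E}e^{-\lambda D_r}=e^{-r\lambda^\beta}$), $E_t=\inf\{r: D_r>t\}$ its first passage time with density $f_{E_t}$, and let $G_t(x)=\int_0^\infty p(s,x)f_{E_t}(s)\,ds$ be the density of $X_{E_t}$. $B(0,1)$ is the unit ball centered at $0$. Space-time white noise $\dot W$ is the centered Gaussian noise with $\mathbb{E}[\dot W(s,x)\dot W(t,y)]=\delta_0(t-s)\delta_0(x-y)$. The solution is understood as the mild solution in the sense of Walsh: $u$ is adapted to the filtration generated by the noise and satisfies $$u_t(x)=\int_{\mathbb{R}^d}G_t(x-y)u_0(y)\,dy+\int_{\mathbb{R}^d}\int_0^tG_{t-s}(x-y)\sigma(u_s(y))\,W(ds\,dy).$$ The constants $t_0$ and $K$ do not depend on $u_0$. *)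

theory Defs
  imports "HOL-Probability.Probability"
begin

text \<open>
  Euclidean space of dimension d is a type of class \<open>euclidean_space\<close> with d = \<open>DIM('a)\<close>.
  Space-time is \<open>real \<times> 'a\<close>; only times in \<open>{0..}\<close> matter.
\<close>

section \<open>The kernel G\<close>

text \<open>
  The Fourier transform determines the density only up to null sets; continuity in x selects
  the usual version, so that \<open>p t\<close> is unique for every \<open>t > 0\<close>.
\<close>

definition stable_transition_density ::
    "real \<Rightarrow> real \<Rightarrow> (real \<Rightarrow> 'a::euclidean_space \<Rightarrow> real) \<Rightarrow> bool" where
  "stable_transition_density \<nu> \<alpha> p \<longleftrightarrow>
     (\<forall>t>0. continuous_on UNIV (p t) \<and> (\<forall>x. 0 \<le> p t x) \<and> integrable lborel (p t) \<and>
        (\<forall>\<xi>. (LINT x|lborel. iexp (\<xi> \<bullet> x) * complex_of_real (p t x))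
              = complex_of_real (exp (- t * \<nu> * norm \<xi> powr \<alpha>))))"

definition stable_subordinator :: "'v measure \<Rightarrow> real \<Rightarrow> (real \<Rightarrow> 'v \<Rightarrow> real) \<Rightarrow> bool" where
  "stable_subordinator N \<beta> D \<longleftrightarrow>
     prob_space N \<and>
     (\<forall>r\<ge>0. D r \<in> borel_measurable N) \<and>
     (AE \<omega> in N. D 0 \<omega> = 0 \<and> mono_on {0..} (\<lambda>r. D r \<omega>) \<and>
        (\<forall>r\<ge>0. continuous (at_right r) (\<lambda>r. D r \<omega>))) \<and>
     (\<forall>(n::nat) r. 0 \<le> r 0 \<and> mono r \<longrightarrow>
        prob_space.indep_vars N (\<lambda>_. borel) (\<lambda>i \<omega>. D (r (Suc i)) \<omega> - D (r i) \<omega>) {..<n}) \<and>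
     (\<forall>r\<ge>0. \<forall>h\<ge>0. distr N borel (\<lambda>\<omega>. D (r + h) \<omega> - D r \<omega>) = distr N borel (D h)) \<and>
     (\<forall>r\<ge>0. \<forall>l\<ge>0. (LINT \<omega>|N. exp (- l * D r \<omega>)) = exp (- r * l powr \<beta>))"

definition first_passage :: "(real \<Rightarrow> 'v \<Rightarrow> real) \<Rightarrow> real \<Rightarrow> 'v \<Rightarrow> real" where
  "first_passage D t \<omega> = Inf {r. 0 \<le> r \<and> t < D r \<omega>}"

definition first_passage_density ::
    "'v measure \<Rightarrow> (real \<Rightarrow> 'v \<Rightarrow> real) \<Rightarrow> (real \<Rightarrow> real \<Rightarrow> real) \<Rightarrow> bool" where
  "first_passage_density N D f \<longleftrightarrow>
     (\<forall>t>0. (\<forall>s. 0 \<le> f t s) \<and>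
        distributed N lborel (first_passage D t) (\<lambda>s. ennreal (f t s)))"

text \<open>
  For d \<open>\<ge>\<close> \<open>\<alpha>\<close> the integral diverges at x = 0, where the Bochner integral returns 0. This concerns
  a single point x, so no integral of G in the space variable is affected.
\<close>

definition kernel_G ::
    "(real \<Rightarrow> 'a::euclidean_space \<Rightarrow> real) \<Rightarrow> (real \<Rightarrow> real \<Rightarrow> real) \<Rightarrow> real \<Rightarrow> 'a \<Rightarrow> real" where
  "kernel_G p f t x = (LINT s:{0<..}|lborel. p s x * f t s)"

section \<open>Space-time white noise\<close>

text \<open>Point masses count as (degenerate) Gaussian laws.\<close>

definition gaussian_rv :: "'w measure \<Rightarrow> ('w \<Rightarrow> real) \<Rightarrow> bool" where
  "gaussian_rv M Z \<longleftrightarrow> Z \<in> borel_measurable M \<and>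
     ((\<exists>m. AE \<omega> in M. Z \<omega> = m) \<or>
      (\<exists>m s. 0 < s \<and> distributed M lborel Z (\<lambda>z. ennreal (normal_density m s z))))"

definition noise_sets :: "(real \<times> 'a::euclidean_space) set set" where
  "noise_sets = {A \<in> sets borel. A \<subseteq> {0..} \<times> UNIV \<and> emeasure lborel A < \<infinity>}"

text \<open>
  \<open>W A\<close> is the noise tested against the indicator of A; the delta covariance then reads
  E[W(A) W(B)] = Lebesgue measure of the intersection of A and B.
\<close>

definition space_time_white_noise ::
    "'w measure \<Rightarrow> ((real \<times> 'a::euclidean_space) set \<Rightarrow> 'w \<Rightarrow> real) \<Rightarrow> bool" where
  "space_time_white_noise M W \<longleftrightarrow>
     prob_space M \<and>
     (\<forall>J c. finite J \<and> J \<subseteq> noise_sets \<longrightarrow> gaussian_rv M (\<lambda>\<omega>. \<Sum>A\<in>J. c A * W A \<omega>)) \<and>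
     (\<forall>A\<in>noise_sets. (LINT \<omega>|M. W A \<omega>) = 0) \<and>
     (\<forall>A\<in>noise_sets. \<forall>B\<in>noise_sets.
        (LINT \<omega>|M. W A \<omega> * W B \<omega>) = measure lborel (A \<inter> B))"

text \<open>The filtration generated by the noise, augmented by the null sets.\<close>

definition noise_filtration ::
    "'w measure \<Rightarrow> ((real \<times> 'a::euclidean_space) set \<Rightarrow> 'w \<Rightarrow> real) \<Rightarrow> real \<Rightarrow> 'w measure" where
  "noise_filtration M W t = sigma (space M)
     ({W A -` B \<inter> space M | A B. A \<in> noise_sets \<and> A \<subseteq> {0..t} \<times> UNIV \<and> B \<in> sets borel}
      \<union> null_sets M)"

section \<open>The Walsh integral\<close>

text \<open>
  A list of quadruples \<open>(X, a, b, A)\<close> represents the simple process that is the sum of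
  the elementary processes X(\<open>\<omega>\<close>) 1(a < s \<open>\<le>\<close> b) 1(y in A).
\<close>

type_synonym ('w, 'a) simple_process = "(('w \<Rightarrow> real) \<times> real \<times> real \<times> 'a set) list"

definition simple_process ::
    "'w measure \<Rightarrow> ((real \<times> 'a::euclidean_space) set \<Rightarrow> 'w \<Rightarrow> real)
      \<Rightarrow> ('w, 'a) simple_process \<Rightarrow> bool" where
  "simple_process M W S \<longleftrightarrow>
     (\<forall>(X, a, b, A) \<in> set S. 0 \<le> a \<and> a \<le> b \<and>
        X \<in> borel_measurable (noise_filtration M W a) \<and> (\<exists>C. \<forall>\<omega>\<in>space M. \<bar>X \<omega>\<bar> \<le> C) \<and>
        A \<in> sets borel \<and> emeasure lborel A < \<infinity>)"

definition simple_value ::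
    "('w, 'a::euclidean_space) simple_process \<Rightarrow> 'w \<times> real \<times> 'a \<Rightarrow> real" where
  "simple_value S = (\<lambda>(\<omega>, s, y).
     \<Sum>(X, a, b, A)\<leftarrow>S. X \<omega> * indicator {a<..b} s * indicator A y)"

definition simple_integral ::
    "((real \<times> 'a::euclidean_space) set \<Rightarrow> 'w \<Rightarrow> real) \<Rightarrow> ('w, 'a) simple_process \<Rightarrow> 'w \<Rightarrow> real" where
  "simple_integral W S \<omega> = (\<Sum>(X, a, b, A)\<leftarrow>S. X \<omega> * W ({a<..b} \<times> A) \<omega>)"

text \<open>
  The extension by the Ito-Walsh isometry: \<open>\<Phi>\<close> is in the closure of the simple processes for the
  square norm E \<open>\<integral>\<integral>\<close> |\<open>\<Phi>\<close>|^2 ds dy, and Z is the limit in mean square of the integrals.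
\<close>

definition has_walsh_integral ::
    "'w measure \<Rightarrow> ((real \<times> 'a::euclidean_space) set \<Rightarrow> 'w \<Rightarrow> real)
      \<Rightarrow> ('w \<times> real \<times> 'a \<Rightarrow> real) \<Rightarrow> ('w \<Rightarrow> real) \<Rightarrow> bool" where
  "has_walsh_integral M W \<Phi> Z \<longleftrightarrow>
     \<Phi> \<in> borel_measurable (M \<Otimes>\<^sub>M lborel) \<and> Z \<in> borel_measurable M \<and>
     (\<exists>S. (\<forall>n::nat. simple_process M W (S n)) \<and>
        (\<lambda>n. \<integral>\<^sup>+ z. ennreal ((simple_value (S n) z - \<Phi> z)\<^sup>2) \<partial>(M \<Otimes>\<^sub>M lborel)) \<longlonglongrightarrow> 0 \<and>
        (\<lambda>n. \<integral>\<^sup>+ \<omega>. ennreal ((simple_integral W (S n) \<omega> - Z \<omega>)\<^sup>2) \<partial>M) \<longlonglongrightarrow> 0)"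

section \<open>Mild solutions\<close>

definition second_moment :: "'w measure \<Rightarrow> ('w \<Rightarrow> real) \<Rightarrow> ennreal" where
  "second_moment M Z = (\<integral>\<^sup>+ \<omega>. ennreal (\<bar>Z \<omega>\<bar>\<^sup>2) \<partial>M)"

definition mild_integrand ::
    "(real \<Rightarrow> 'a::euclidean_space \<Rightarrow> real) \<Rightarrow> (real \<Rightarrow> real) \<Rightarrow> (real \<Rightarrow> 'a \<Rightarrow> 'w \<Rightarrow> real)
      \<Rightarrow> real \<Rightarrow> 'a \<Rightarrow> 'w \<times> real \<times> 'a \<Rightarrow> real" where
  "mild_integrand G \<sigma> u t x = (\<lambda>(\<omega>, s, y).
     indicator {0<..<t} s * (G (t - s) (x - y) * \<sigma> (u s y \<omega>)))"

text \<open>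
  The Walsh integral only exists for square integrable integrands, and then it has a finite second
  moment, so an equation imposed at all (t, x) would exclude any u with an infinite second
  moment. As usual for solutions that may blow up in mean square, the equation is therefore
  imposed at every (t, x) where the Walsh integral exists, and it is required to exist wherever
  the second moment of u is finite. (With the isometry read in [0, \<open>\<infinity>\<close>], an integrand that is not
  square integrable corresponds to an infinite second moment.) In particular, a u that satisfies
  the equation at all (t, x) is covered.
\<close>

definition mild_solution ::
    "'w measure \<Rightarrow> ((real \<times> 'a::euclidean_space) set \<Rightarrow> 'w \<Rightarrow> real) \<Rightarrow> (real \<Rightarrow> 'a \<Rightarrow> real)
      \<Rightarrow> (real \<Rightarrow> real) \<Rightarrow> ('a \<Rightarrow> real) \<Rightarrow> (real \<Rightarrow> 'a \<Rightarrow> 'w \<Rightarrow> real) \<Rightarrow> bool" where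
  "mild_solution M W G \<sigma> u0 u \<longleftrightarrow>
     (\<lambda>(\<omega>, t, x). u t x \<omega>) \<in> borel_measurable (M \<Otimes>\<^sub>M (restrict_space borel {0..} \<Otimes>\<^sub>M borel)) \<and>
     (\<forall>t\<ge>0. \<forall>x. u t x \<in> borel_measurable (noise_filtration M W t)) \<and>
     (\<forall>x. AE \<omega> in M. u 0 x \<omega> = u0 x) \<and>
     (\<forall>t>0. \<forall>x.
        (second_moment M (u t x) < \<infinity> \<longrightarrow>
           (\<exists>Z. has_walsh_integral M W (mild_integrand G \<sigma> u t x) Z)) \<and>
        (\<forall>Z. has_walsh_integral M W (mild_integrand G \<sigma> u t x) Z \<longrightarrow>
           (AE \<omega> in M. u t x \<omega> = (LINT y|lborel. G t (x - y) * u0 y) + Z \<omega>)))"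

definition locally_lipschitz :: "(real \<Rightarrow> real) \<Rightarrow> bool" where
  "locally_lipschitz \<sigma> \<longleftrightarrow> (\<forall>x. \<exists>e>0. \<exists>L. L-lipschitz_on (cball x e) \<sigma>)"

end

theory Submission
  imports Defs "HOL-Real_Asymp.Real_Asymp"
begin

text \<open>
  Let F(t, x) = E |u(t, x)|^2. Where F is finite, the Walsh integral exists and its isometry gives
  F(t, x) \<ge> (G_t * u0 (x))^2 and, with Jensen's inequality,
  4 F(t, x) \<ge> \<integral>\<integral> G_{t-s}(x - y)^2 F(s, y)^(1 + \<gamma>) dy ds. Since G is bounded below on [1, 2] \<times> B(0, 2),
  the first bound makes F large on [1, 2] \<times> B(0, 1) when the mass of u0 in the unit ball is large.
  The second one is then iterated on shrinking cylinders: in a short time step G_r keeps half of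
  its mass in a small ball, so the square of G_r has a mass bounded below there, and the power
  1 + \<gamma> makes the lower bounds grow to infinity on [3/2, 2] \<times> B(0, 1/2). As G is positive almost
  everywhere, one more application of the second bound spreads the value \<infinity> to all later times and
  all points.
\<close>

section \<open>Fourier inversion\<close>

text \<open>The inputs are known only through transforms: \<open>p\<close> through its Fourier
  transform, \<open>D\<close> through its Laplace transform. All kernel estimates are drawn from
  these. Gaussian averages of the Fourier transform bound the tail of \<open>p\<close>; inversion
  gives its joint measurability and, at large times, a lower bound; exponential Markov bounds
  localise the first passage time.

  The scaling shapes the iteration. \<open>G\<close> at time t spreads over a distance of order
  t^(\<beta>/\<alpha>), so halving the margin in space multiplies the admissible time step by a
  fixed \<theta> < 1. A lower bound A on a cylinder yields const * A^(1 + \<gamma>) * (time step) on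
  the next one, and growth by \<Lambda> = \<theta>^(-1/\<gamma>) per step exactly pays for the
  shrinking time steps. These are summable, so infinity is reached in finite time. The starting size
  depends only on the kernel and \<gamma>, which makes K independent of u0.\<close>

lemma
  fixes g :: "'a::euclidean_space \<Rightarrow> 'b::{banach, second_countable_topology}"
  assumes c: "0 < c" and [measurable]: "g \<in> borel_measurable borel"
  shows lborel_integral_affine:
      "(LINT x|lborel. g x) = c ^ DIM('a) *\<^sub>R (LINT x|lborel. g (t + c *\<^sub>R x))"
    and lborel_integrable_affine:
      "integrable lborel g \<Longrightarrow> integrable lborel (\<lambda>x. g (t + c *\<^sub>R x))"
proof -
  have eq: "lborel = density (distr lborel borel (\<lambda>x. t + c *\<^sub>R x)) (\<lambda>_. ennreal (c ^ DIM('a)))"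
    using lborel_affine[of c t] c by simp
  show "(LINT x|lborel. g x) = c ^ DIM('a) *\<^sub>R (LINT x|lborel. g (t + c *\<^sub>R x))"
    apply (subst eq)
    using c by (subst integral_density) (auto simp: integral_distr)
  assume "integrable lborel g"
  then have "integrable (density (distr lborel borel (\<lambda>x. t + c *\<^sub>R x)) (\<lambda>_. ennreal (c ^ DIM('a)))) g"
    using eq by simp
  then show "integrable lborel (\<lambda>x. g (t + c *\<^sub>R x))"
    using c integrable_scaleR_right[of "1 / c ^ DIM('a)" lborel "\<lambda>x. c ^ DIM('a) *\<^sub>R g (t + c *\<^sub>R x)"]
    by (subst (asm) integrable_density) (auto simp: integrable_distr_eq)
qed

text \<open>The characteristic function of the standard normal law, freed from its normalising
  factor: the one-dimensional case from which everything Gaussian below is built.\<close>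

lemma
  fixes c :: real
  shows gaussian_fourier_real_integrable: "integrable lborel (\<lambda>x. iexp (c * x) * complex_of_real (exp (- x\<^sup>2 / 2)))"
    and gaussian_fourier_real: "(LINT x|lborel. iexp (c * x) * complex_of_real (exp (- x\<^sup>2 / 2))) =
      complex_of_real (sqrt (2 * pi) * exp (- c\<^sup>2 / 2))"
proof -
  have nn: "(\<lambda>x. iexp (c * x) * complex_of_real (exp (- x\<^sup>2 / 2))) =
      (\<lambda>x. complex_of_real (sqrt (2 * pi)) * (std_normal_density x *\<^sub>R iexp (c * x)))"
    by (simp add: std_normal_density_def scaleR_conv_of_real field_simps)
  have "integrable std_normal_distribution (\<lambda>x. iexp (c * x))"
    by (rule prob_space.integrable_iexp) (auto simp: prob_space_normal_density)
  then have i: "integrable lborel (\<lambda>x. std_normal_density x *\<^sub>R iexp (c * x))"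
    by (subst (asm) integrable_density) (auto simp: std_normal_density_def)
  show "integrable lborel (\<lambda>x. iexp (c * x) * complex_of_real (exp (- x\<^sup>2 / 2)))"
    unfolding nn by (rule integrable_mult_right[OF i])
  have "char std_normal_distribution c = (LINT x|lborel. std_normal_density x *\<^sub>R iexp (c * x))"
    unfolding char_def by (subst integral_density) (auto simp: std_normal_density_def)
  then show "(LINT x|lborel. iexp (c * x) * complex_of_real (exp (- x\<^sup>2 / 2))) =
      complex_of_real (sqrt (2 * pi) * exp (- c\<^sup>2 / 2))"
    unfolding nn integral_mult_right_zero by (simp only: char_std_normal_distribution of_real_mult)
qed

text \<open>Both the character and the Gaussian factor over the coordinates, so after writing
  \<open>lborel\<close> as an image of a product measure the integral is a product of
  one-dimensional ones.\<close>

lemma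
  fixes w :: "'a::euclidean_space"
  shows gaussian_fourier_integrable:
      "integrable lborel (\<lambda>x. iexp (x \<bullet> w) * complex_of_real (exp (- (norm x)\<^sup>2 / 2)))"
    and gaussian_fourier:
      "(LINT x|lborel. iexp (x \<bullet> w) * complex_of_real (exp (- (norm x)\<^sup>2 / 2))) =
        complex_of_real (sqrt (2 * pi) ^ DIM('a) * exp (- (norm w)\<^sup>2 / 2))"
proof -
  interpret product_sigma_finite "\<lambda>_::'a. lborel :: real measure" ..
  let ?g = "\<lambda>x::'a. iexp (x \<bullet> w) * complex_of_real (exp (- (norm x)\<^sup>2 / 2))"
  let ?T = "\<lambda>f. \<Sum>b\<in>Basis. f b *\<^sub>R (b::'a)"
  have norm2: "(norm x)\<^sup>2 = (\<Sum>b\<in>Basis. (x \<bullet> b)\<^sup>2)" for x :: 'a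
    by (subst power2_norm_eq_inner, subst euclidean_inner) (simp add: power2_eq_square)
  have eq: "?g (?T f) = (\<Prod>b\<in>Basis. iexp ((w \<bullet> b) * f b) * complex_of_real (exp (- (f b)\<^sup>2 / 2)))"
    (is "_ = (\<Prod>b\<in>Basis. ?k b (f b))" is "_ = ?h f") for f
  proof -
    have "?T f \<bullet> w = (\<Sum>b\<in>Basis. (w \<bullet> b) * f b)"
      unfolding inner_sum_left by (simp add: inner_commute mult.commute)
    moreover have "- (norm (?T f))\<^sup>2 / 2 = (\<Sum>b\<in>Basis. - (f b)\<^sup>2 / 2)"
      by (simp add: norm2 sum_negf sum_divide_distrib)
    ultimately show ?thesis
      by (simp add: exp_sum prod.distrib sum_distrib_left del: of_real_exp flip: of_real_prod)
  qed
  have i: "integrable (Pi\<^sub>M Basis (\<lambda>_. lborel)) ?h"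
    by (rule product_integrable_prod[OF finite_Basis gaussian_fourier_real_integrable])
  have [measurable]: "?T \<in> measurable (Pi\<^sub>M Basis (\<lambda>_. lborel)) borel"
    by measurable
  show "integrable lborel ?g"
    unfolding lborel_eq[where 'a='a] using i by (subst integrable_distr_eq) (simp_all only: eq, measurable)
  have "(LINT x|lborel. ?g x) = (LINT f|Pi\<^sub>M Basis (\<lambda>_. lborel). ?g (?T f))"
    unfolding lborel_eq[where 'a='a] by (subst integral_distr) auto
  also have "\<dots> = (\<Prod>b\<in>Basis. LINT x|lborel. ?k b x)"
    unfolding eq by (rule product_integral_prod[OF finite_Basis gaussian_fourier_real_integrable])
  also have "\<dots> = complex_of_real (\<Prod>b\<in>Basis. sqrt (2 * pi) * exp (- (w \<bullet> b)\<^sup>2 / 2))"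
    by (simp only: gaussian_fourier_real of_real_prod)
  also have "(\<Prod>b\<in>Basis. sqrt (2 * pi) * exp (- (w \<bullet> b)\<^sup>2 / 2)) = sqrt (2 * pi) ^ DIM('a) * exp (- (norm w)\<^sup>2 / 2)"
    by (simp add: prod.distrib norm2 sum_negf sum_divide_distrib flip: exp_sum)
  finally show "(LINT x|lborel. ?g x) = complex_of_real (sqrt (2 * pi) ^ DIM('a) * exp (- (norm w)\<^sup>2 / 2))" .
qed

lemma gaussian_integrable: "integrable lborel (\<lambda>x::'a::euclidean_space. exp (- (norm x)\<^sup>2 / 2))"
  using integrable_norm[OF gaussian_fourier_integrable[where 'a='a and w=0]]
  by (simp add: norm_mult)

lemma gaussian_integral:
  "(LINT x::'a::euclidean_space|lborel. exp (- (norm x)\<^sup>2 / 2)) = sqrt (2 * pi) ^ DIM('a)"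
  using arg_cong[OF gaussian_fourier[where 'a='a and w=0], of Re]
  by (simp add: integral_complex_of_real del: of_real_exp)

text \<open>Presents the Gaussian of width e in the variable w as a Fourier integral of a Gaussian
  of width 1/e; this is what \<open>gaussian_smoothing\<close> substitutes.\<close>

lemma gaussian_fourier_scaled:
  fixes w :: "'a::euclidean_space"
  assumes "0 < e"
  shows "integrable lborel (\<lambda>\<eta>. iexp (\<eta> \<bullet> w) * complex_of_real (exp (- (norm (e *\<^sub>R \<eta>))\<^sup>2 / 2)))" (is ?I)
    and "complex_of_real (sqrt (2 * pi) ^ DIM('a) * exp (- (norm (w /\<^sub>R e))\<^sup>2 / 2)) =
      complex_of_real (e ^ DIM('a)) * (LINT \<eta>|lborel. iexp (\<eta> \<bullet> w) * complex_of_real (exp (- (norm (e *\<^sub>R \<eta>))\<^sup>2 / 2)))" (is ?E)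
proof -
  have eq: "iexp ((0 + e *\<^sub>R \<eta>) \<bullet> (w /\<^sub>R e)) = iexp (\<eta> \<bullet> w)" for \<eta>
    using assms by (simp del: of_real_inverse of_real_mult add: mult.assoc[symmetric])
  show ?I
    using lborel_integrable_affine[OF assms _ gaussian_fourier_integrable[of "w /\<^sub>R e"], of 0] unfolding eq by simp
  show ?E
    unfolding gaussian_fourier[symmetric]
    by (subst lborel_integral_affine[OF assms, of _ 0], simp, unfold eq) (simp add: scaleR_conv_of_real)
qed

text \<open>Instead of polar coordinates, space is cut by the integer part n of the norm. On the
  n-th layer the function is at most exp (- c * n^a), the layer lies in a cube of side 2 (n + 1),
  and the resulting series converges because the exponential beats every power of n.\<close>

lemma radial_exp_integrable:
  assumes "0 < c" and "0 < a"
  shows "integrable lborel (\<lambda>x::'a::euclidean_space. exp (- c * norm x powr a))"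
proof (rule integrableI_bounded)
  let ?b = "\<lambda>n::nat. exp (- c * real n powr a)"
  have *: "ennreal (norm (exp (- c * norm x powr a))) \<le>
      (\<Sum>n. ennreal (?b n) * indicator (ball (0::'a) (real n + 1)) x)" for x :: 'a
  proof -
    let ?n = "nat \<lfloor>norm x\<rfloor>"
    have "real ?n \<le> norm x" "norm x < real ?n + 1"
      using norm_ge_zero[of x] by linarith+
    then have "exp (- c * norm x powr a) \<le> ?b ?n" "x \<in> ball 0 (real ?n + 1)"
      using assms by (auto intro!: powr_mono2)
    then have "ennreal (norm (exp (- c * norm x powr a))) \<le> ennreal (?b ?n) * indicator (ball 0 (real ?n + 1)) x"
      by (simp add: ennreal_leI)
    also have "\<dots> \<le> (\<Sum>n. ennreal (?b n) * indicator (ball (0::'a) (real n + 1)) x)"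
      using sum_le_suminf[of "\<lambda>n. ennreal (?b n) * indicator (ball (0::'a) (real n + 1)) x" "{?n}"] by simp
    finally show ?thesis .
  qed
  have ball_le: "emeasure lborel (ball (0::'a) r) \<le> ennreal ((2 * r) ^ DIM('a))" if "0 \<le> r" for r
  proof -
    have "ball (0::'a) r \<subseteq> cbox (\<Sum>b\<in>Basis. (- r) *\<^sub>R b) (\<Sum>b\<in>Basis. r *\<^sub>R b)"
    proof
      fix x :: 'a assume "x \<in> ball 0 r"
      then have "\<bar>x \<bullet> b\<bar> \<le> r" if "b \<in> Basis" for b
        using Basis_le_norm[OF that, of x] by simp
      then show "x \<in> cbox (\<Sum>b\<in>Basis. (- r) *\<^sub>R b) (\<Sum>b\<in>Basis. r *\<^sub>R b)"
        by (auto simp: mem_box abs_le_iff minus_le_iff sum_negf)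
    qed
    then have "emeasure lborel (ball (0::'a) r) \<le> emeasure lborel (cbox (\<Sum>b\<in>Basis. (- r) *\<^sub>R b) (\<Sum>b\<in>(Basis::'a set). r *\<^sub>R b))"
      by (rule emeasure_mono) simp
    also have "\<dots> = ennreal ((2 * r) ^ DIM('a))"
    proof -
      have "(\<Sum>b'\<in>Basis. (- r) *\<^sub>R b') \<bullet> b = - r" if "b \<in> Basis" for b :: 'a
        using that by (simp add: sum_negf)
      then show ?thesis
        using that by (subst emeasure_lborel_cbox) (auto simp: inner_diff_left simp del: scaleR_minus_left)
    qed
    finally show ?thesis .
  qed
  have layer: "(\<integral>\<^sup>+ x. ennreal (b n) * indicator (ball (0::'a) (real n + 1)) x \<partial>lborel) =
      ennreal (b n) * emeasure lborel (ball (0::'a) (real n + 1))" for b and n :: nat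
    by (rule nn_integral_cmult_indicator) simp
  have layers: "(\<integral>\<^sup>+ x. (\<Sum>n. ennreal (b n) * indicator (ball (0::'a) (real n + 1)) x) \<partial>lborel) =
      (\<Sum>n. ennreal (b n) * emeasure lborel (ball (0::'a) (real n + 1)))" for b
    unfolding layer[symmetric]
    by (rule nn_integral_suminf) (intro borel_measurable_times_ennreal borel_measurable_indicator, auto)
  have "(\<integral>\<^sup>+ x. ennreal (norm (exp (- c * norm (x::'a) powr a))) \<partial>lborel) \<le>
      (\<integral>\<^sup>+ x. (\<Sum>n. ennreal (?b n) * indicator (ball (0::'a) (real n + 1)) x) \<partial>lborel)"
    by (rule nn_integral_mono) (rule *)
  also have "\<dots> = (\<Sum>n. ennreal (?b n) * emeasure lborel (ball (0::'a) (real n + 1)))"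
    by (rule layers)
  also have "\<dots> \<le> (\<Sum>n. ennreal (?b n * (2 * (real n + 1)) ^ DIM('a)))"
  proof (intro suminf_le summableI)
    show "ennreal (?b n) * emeasure lborel (ball (0::'a) (real n + 1)) \<le> ennreal (?b n * (2 * (real n + 1)) ^ DIM('a))" for n
      using mult_left_mono[OF ball_le[of "real n + 1"], of "ennreal (?b n)"] by (simp add: ennreal_mult)
  qed
  also have "\<dots> < \<infinity>"
  proof -
    have "(\<lambda>n. exp (- c * real n powr a) * (2 * (real n + 1)) ^ DIM('a)) \<in> O(\<lambda>n. 1 / real n ^ 2)"
      using assms by real_asymp
    then have "summable (\<lambda>n. ?b n * (2 * (real n + 1)) ^ DIM('a))"
      by (rule summable_comparison_test_bigo[rotated]) (auto intro!: inverse_power_summable simp: divide_inverse)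
    then show ?thesis
      by (subst suminf_ennreal2) auto
  qed
  finally show "(\<integral>\<^sup>+ x. ennreal (norm (exp (- c * norm (x::'a) powr a))) \<partial>lborel) < \<infinity>" .
qed simp

text \<open>Letting \<open>e\<close> tend to 0 on both sides gives the inversion formula.\<close>

lemma gaussian_smoothing:
  fixes q :: "'a::euclidean_space \<Rightarrow> real" and \<phi> :: "'a \<Rightarrow> real"
  assumes q: "integrable lborel q"
    and ft: "\<And>\<xi>. (LINT x|lborel. iexp (\<xi> \<bullet> x) * complex_of_real (q x)) = complex_of_real (\<phi> \<xi>)"
    and e: "0 < e"
  shows "complex_of_real (sqrt (2 * pi) ^ DIM('a) * (LINT y|lborel. q (z + e *\<^sub>R y) * exp (- (norm y)\<^sup>2 / 2))) =
    (LINT \<eta>|lborel. iexp (- (\<eta> \<bullet> z)) * complex_of_real (exp (- (norm (e *\<^sub>R \<eta>))\<^sup>2 / 2) * \<phi> \<eta>))"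
proof -
  let ?C = "sqrt (2 * pi) ^ DIM('a)"
  have [measurable]: "q \<in> borel_measurable borel"
    using borel_measurable_integrable[OF q] by simp
  define h where "h \<eta> = exp (- (norm (e *\<^sub>R \<eta>))\<^sup>2 / 2)" for \<eta> :: 'a
  have [measurable]: "h \<in> borel_measurable borel"
    unfolding h_def by measurable
  have hi: "integrable lborel h"
    using lborel_integrable_affine[OF e _ gaussian_integrable, of 0] by (simp add: h_def[abs_def])
  have split: "iexp (\<eta> \<bullet> (x - z)) = iexp (- (\<eta> \<bullet> z)) * iexp (\<eta> \<bullet> x)" for \<eta> x
    by (simp add: inner_diff_right right_diff_distrib exp_diff exp_minus divide_inverse mult.commute)
  let ?F = "\<lambda>x \<eta>. iexp (\<eta> \<bullet> (x - z)) * complex_of_real (h \<eta>) * complex_of_real (q x)"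
  have Fi: "integrable (lborel \<Otimes>\<^sub>M lborel) (case_prod ?F)"
  proof (rule lborel_pair.Fubini_integrable)
    show "AE x in lborel. integrable lborel (\<lambda>\<eta>. case_prod ?F (x, \<eta>))"
    proof (intro AE_I2)
      fix x
      have "integrable lborel (\<lambda>\<eta>. h \<eta> * \<bar>q x\<bar>)" using hi by simp
      then show "integrable lborel (\<lambda>\<eta>. case_prod ?F (x, \<eta>))"
        by (rule Bochner_Integration.integrable_bound) (auto simp: norm_mult)
    qed
    have "integrable lborel (\<lambda>x. (LINT \<eta>|lborel. \<bar>h \<eta>\<bar>) * \<bar>q x\<bar>)"
      using q by simp
    then show "integrable lborel (\<lambda>x. LINT \<eta>|lborel. norm (case_prod ?F (x, \<eta>)))"
      by (simp add: norm_mult)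
  qed (simp add: split_beta')
  have "complex_of_real (?C * (LINT y|lborel. q (z + e *\<^sub>R y) * exp (- (norm y)\<^sup>2 / 2)))
     = complex_of_real (?C * (LINT y|lborel. (\<lambda>x. q x * exp (- (norm ((x - z) /\<^sub>R e))\<^sup>2 / 2)) (z + e *\<^sub>R y)))"
    using e by simp
  also have "(LINT y|lborel. (\<lambda>x. q x * exp (- (norm ((x - z) /\<^sub>R e))\<^sup>2 / 2)) (z + e *\<^sub>R y)) =
      (1 / e ^ DIM('a)) * (LINT x|lborel. q x * exp (- (norm ((x - z) /\<^sub>R e))\<^sup>2 / 2))"
    using e by (subst (2) lborel_integral_affine[OF e, of _ z]) auto
  also have "complex_of_real (?C * (1 / e ^ DIM('a) * (LINT x|lborel. q x * exp (- (norm ((x - z) /\<^sub>R e))\<^sup>2 / 2)))) =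
      complex_of_real (1 / e ^ DIM('a)) * (LINT x|lborel. complex_of_real (?C * exp (- (norm ((x - z) /\<^sub>R e))\<^sup>2 / 2)) * complex_of_real (q x))"
    unfolding of_real_mult[symmetric] integral_complex_of_real integral_mult_right_zero[symmetric]
    by (simp add: mult_ac)
  \<comment> \<open>The Gaussian in x becomes its own Fourier integral over \<eta>. The factor e^d
    so produced cancels the Jacobian of the rescaling, and exchanging the integrals exposes the
    transform of \<open>q\<close>.\<close>
  also have "\<dots> = complex_of_real (1 / e ^ DIM('a)) * (LINT x|lborel. complex_of_real (e ^ DIM('a)) * (LINT \<eta>|lborel. ?F x \<eta>))"
    unfolding gaussian_fourier_scaled(2)[OF e] h_def[symmetric] integral_mult_left_zero
    by (simp only: mult.assoc)
  also have "\<dots> = (LINT x|lborel. (LINT \<eta>|lborel. ?F x \<eta>))"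
    using e by simp
  also have "\<dots> = (LINT \<eta>|lborel. (LINT x|lborel. ?F x \<eta>))"
    by (rule lborel_pair.Fubini_integral[OF Fi, symmetric])
  also have "\<dots> = (LINT \<eta>|lborel. iexp (- (\<eta> \<bullet> z)) * complex_of_real (h \<eta>) * (LINT x|lborel. iexp (\<eta> \<bullet> x) * complex_of_real (q x)))"
    unfolding split by (simp add: mult_ac flip: integral_mult_right_zero)
  finally show ?thesis
    unfolding ft h_def by (simp add: mult.assoc)
qed

text \<open>Boundedness of q has to precede the inversion formula, where it provides the majorant
  for dominated convergence. It follows from the smoothing identity by Fatou's lemma, which asks
  only for q \<ge> 0.\<close>

lemma fourier_inversion_bound:
  fixes q :: "'a::euclidean_space \<Rightarrow> real" and \<phi> :: "'a \<Rightarrow> real"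
  assumes q: "integrable lborel q" and q0: "\<And>x. 0 \<le> q x" and qc: "continuous_on UNIV q"
    and ft: "\<And>\<xi>. (LINT x|lborel. iexp (\<xi> \<bullet> x) * complex_of_real (q x)) = complex_of_real (\<phi> \<xi>)"
    and \<phi>: "integrable lborel \<phi>"
  shows "q z \<le> (LINT \<eta>|lborel. \<bar>\<phi> \<eta>\<bar>) / sqrt (2 * pi) ^ (2 * DIM('a))"
proof -
  let ?C = "sqrt (2 * pi) ^ DIM('a)"
  let ?B = "LINT \<eta>|lborel. \<bar>\<phi> \<eta>\<bar>"
  let ?h = "\<lambda>y::'a. exp (- (norm y)\<^sup>2 / 2)"
  have C: "0 < ?C" by simp
  have [measurable]: "q \<in> borel_measurable borel" "\<phi> \<in> borel_measurable borel"
    using borel_measurable_integrable[OF q] borel_measurable_integrable[OF \<phi>] by auto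
  define e where "e n = 1 / real (Suc n)" for n
  have e0: "0 < e n" for n by (simp add: e_def)
  have elim: "e \<longlonglongrightarrow> 0"
    unfolding e_def by (rule LIMSEQ_Suc[OF lim_1_over_n])
  have i: "integrable lborel (\<lambda>y. q (z + e n *\<^sub>R y) * ?h y)" for n
    using lborel_integrable_affine[OF e0 _ q, of z n]
    by (rule Bochner_Integration.integrable_bound) (auto simp: abs_mult intro!: mult_left_le)
  have le: "?C * (LINT y|lborel. q (z + e n *\<^sub>R y) * ?h y) \<le> ?B" for n
  proof -
    have "?C * (LINT y|lborel. q (z + e n *\<^sub>R y) * ?h y)
        \<le> norm (complex_of_real (?C * (LINT y|lborel. q (z + e n *\<^sub>R y) * ?h y)))"
      unfolding norm_of_real by (rule abs_ge_self)
    also have "\<dots> \<le> (LINT \<eta>|lborel. \<bar>\<phi> \<eta>\<bar>)"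
      unfolding gaussian_smoothing[OF q ft e0]
      by (rule order_trans[OF integral_norm_bound], rule integral_mono)
        (auto simp: norm_mult abs_mult \<phi> intro!: mult_left_le_one_le AE_I2
          Bochner_Integration.integrable_bound[OF \<phi>])
    finally show ?thesis .
  qed
  have lim: "(\<lambda>n. q (z + e n *\<^sub>R y) * ?h y) \<longlonglongrightarrow> q z * ?h y" for y
  proof -
    have "(\<lambda>n. z + e n *\<^sub>R y) \<longlonglongrightarrow> z + 0 *\<^sub>R y"
      by (intro tendsto_intros elim)
    then have "(\<lambda>n. q (z + e n *\<^sub>R y)) \<longlonglongrightarrow> q z"
      using qc by (intro isCont_tendsto_compose[of z q]) (auto simp: continuous_on_eq_continuous_at)
    then show ?thesis by (intro tendsto_intros)
  qed
  have "ennreal (q z * ?C) = (\<integral>\<^sup>+ y. ennreal (q z * ?h y) \<partial>lborel)"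
    by (subst nn_integral_eq_integral[OF integrable_mult_right[OF gaussian_integrable]])
      (simp_all only: gaussian_integral integral_mult_right_zero, simp add: q0)
  also have "\<dots> = (\<integral>\<^sup>+ y. liminf (\<lambda>n. ennreal (q (z + e n *\<^sub>R y) * ?h y)) \<partial>lborel)"
    by (intro nn_integral_cong lim_imp_Liminf[symmetric] tendsto_ennrealI lim) simp
  also have "\<dots> \<le> liminf (\<lambda>n. \<integral>\<^sup>+ y. ennreal (q (z + e n *\<^sub>R y) * ?h y) \<partial>lborel)"
    by (rule nn_integral_liminf) simp
  also have "\<dots> \<le> liminf (\<lambda>n::nat. ennreal (?B / ?C))"
  proof (rule Liminf_mono, rule always_eventually, rule allI)
    fix n
    have "(LINT y|lborel. q (z + e n *\<^sub>R y) * ?h y) \<le> ?B / ?C"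
      using le[of n] C by (simp only: pos_le_divide_eq mult.commute)
    moreover have "(\<integral>\<^sup>+ y. ennreal (q (z + e n *\<^sub>R y) * ?h y) \<partial>lborel) =
        ennreal (LINT y|lborel. q (z + e n *\<^sub>R y) * ?h y)"
      by (rule nn_integral_eq_integral[OF i]) (simp add: q0)
    ultimately show "(\<integral>\<^sup>+ y. ennreal (q (z + e n *\<^sub>R y) * ?h y) \<partial>lborel) \<le> ennreal (?B / ?C)"
      by (simp only: ennreal_leI)
  qed
  also have "\<dots> = ennreal (?B / ?C)"
    by (intro lim_imp_Liminf) auto
  finally have "q z * ?C \<le> ?B / ?C"
    by (subst (asm) ennreal_le_iff) auto
  then show ?thesis
    using C by (simp add: field_simps power_mult power2_eq_square power_mult_distrib)
qed

text \<open>Both sides of the smoothing identity now converge by dominated convergence as e tends to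
  0, with majorants B times a Gaussian on the left and |\<phi>| on the right. The left side is real,
  so taking real parts turns the character into a cosine.\<close>

lemma fourier_inversion:
  fixes q :: "'a::euclidean_space \<Rightarrow> real" and \<phi> :: "'a \<Rightarrow> real"
  assumes q: "integrable lborel q" and q0: "\<And>x. 0 \<le> q x" and qc: "continuous_on UNIV q"
    and ft: "\<And>\<xi>. (LINT x|lborel. iexp (\<xi> \<bullet> x) * complex_of_real (q x)) = complex_of_real (\<phi> \<xi>)"
    and \<phi>: "integrable lborel \<phi>"
  shows "q z = (LINT \<eta>|lborel. cos (\<eta> \<bullet> z) * \<phi> \<eta>) / sqrt (2 * pi) ^ (2 * DIM('a))"
proof -
  let ?C = "sqrt (2 * pi) ^ DIM('a)"
  let ?h = "\<lambda>y::'a. exp (- (norm y)\<^sup>2 / 2)"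
  obtain B where B: "q x \<le> B" for x
    using fourier_inversion_bound[OF assms] by blast
  have [measurable]: "q \<in> borel_measurable borel" "\<phi> \<in> borel_measurable borel"
    using borel_measurable_integrable[OF q] borel_measurable_integrable[OF \<phi>] by auto
  define e where "e n = 1 / real (Suc n)" for n
  have e0: "0 < e n" for n by (simp add: e_def)
  have elim: "e \<longlonglongrightarrow> 0"
    unfolding e_def by (rule LIMSEQ_Suc[OF lim_1_over_n])
  have "(\<lambda>n. LINT y|lborel. q (z + e n *\<^sub>R y) * ?h y) \<longlonglongrightarrow> (LINT y|lborel. q z * ?h y)"
  proof (rule integral_dominated_convergence[where w="\<lambda>y. B * ?h y"])
    show "AE y in lborel. (\<lambda>n. q (z + e n *\<^sub>R y) * ?h y) \<longlonglongrightarrow> q z * ?h y"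
    proof (intro AE_I2)
      fix y
      have "(\<lambda>n. z + e n *\<^sub>R y) \<longlonglongrightarrow> z + 0 *\<^sub>R y"
        by (intro tendsto_intros elim)
      then have "(\<lambda>n. q (z + e n *\<^sub>R y)) \<longlonglongrightarrow> q z"
        using qc by (intro isCont_tendsto_compose[of z q]) (auto simp: continuous_on_eq_continuous_at)
      then show "(\<lambda>n. q (z + e n *\<^sub>R y) * ?h y) \<longlonglongrightarrow> q z * ?h y"
        by (intro tendsto_intros)
    qed
    show "integrable lborel (\<lambda>y. B * ?h y)"
      by (rule integrable_mult_right[OF gaussian_integrable])
  qed (auto simp: abs_mult q0 B intro!: mult_right_mono)
  then have "(\<lambda>n. complex_of_real (?C * (LINT y|lborel. q (z + e n *\<^sub>R y) * ?h y))) \<longlonglongrightarrow> complex_of_real (?C * (q z * ?C))"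
    by (intro tendsto_intros) (simp only: integral_mult_right_zero gaussian_integral)
  moreover have "(\<lambda>n. LINT \<eta>|lborel. iexp (- (\<eta> \<bullet> z)) * complex_of_real (?h (e n *\<^sub>R \<eta>) * \<phi> \<eta>)) \<longlonglongrightarrow>
      (LINT \<eta>|lborel. iexp (- (\<eta> \<bullet> z)) * complex_of_real (\<phi> \<eta>))"
  proof (rule integral_dominated_convergence[where w="\<lambda>\<eta>. \<bar>\<phi> \<eta>\<bar>"])
    show "AE \<eta> in lborel. (\<lambda>n. iexp (- (\<eta> \<bullet> z)) * complex_of_real (?h (e n *\<^sub>R \<eta>) * \<phi> \<eta>)) \<longlonglongrightarrow>
        iexp (- (\<eta> \<bullet> z)) * complex_of_real (\<phi> \<eta>)"
    proof (intro AE_I2)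
      fix \<eta>
      have "(\<lambda>n. iexp (- (\<eta> \<bullet> z)) * complex_of_real (?h (e n *\<^sub>R \<eta>) * \<phi> \<eta>)) \<longlonglongrightarrow>
          iexp (- (\<eta> \<bullet> z)) * complex_of_real (?h (0 *\<^sub>R \<eta>) * \<phi> \<eta>)"
        by (intro tendsto_intros elim) simp
      then show "(\<lambda>n. iexp (- (\<eta> \<bullet> z)) * complex_of_real (?h (e n *\<^sub>R \<eta>) * \<phi> \<eta>)) \<longlonglongrightarrow>
          iexp (- (\<eta> \<bullet> z)) * complex_of_real (\<phi> \<eta>)" by simp
    qed
  qed (auto simp: norm_mult abs_mult \<phi> intro!: mult_right_le_one_le mult_left_le_one_le)
  ultimately have *: "complex_of_real (?C * (q z * ?C)) = (LINT \<eta>|lborel. iexp (- (\<eta> \<bullet> z)) * complex_of_real (\<phi> \<eta>))"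
    unfolding gaussian_smoothing[OF q ft e0] by (rule LIMSEQ_unique)
  have i: "integrable lborel (\<lambda>\<eta>. iexp (- (\<eta> \<bullet> z)) * complex_of_real (\<phi> \<eta>))"
    by (rule Bochner_Integration.integrable_bound[OF \<phi>]) (auto simp: norm_mult)
  have "?C * (q z * ?C) = Re (LINT \<eta>|lborel. iexp (- (\<eta> \<bullet> z)) * complex_of_real (\<phi> \<eta>))"
    using arg_cong[OF *, of Re] by (simp only: Re_complex_of_real)
  also have "\<dots> = (LINT \<eta>|lborel. Re (iexp (- (\<eta> \<bullet> z)) * complex_of_real (\<phi> \<eta>)))"
    by (rule integral_Re[OF i, symmetric])
  also have "\<dots> = (LINT \<eta>|lborel. cos (\<eta> \<bullet> z) * \<phi> \<eta>)"
    by (simp add: Re_exp)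
  finally have "(LINT \<eta>|lborel. cos (\<eta> \<bullet> z) * \<phi> \<eta>) = ?C * (q z * ?C)" ..
  moreover have "sqrt (2 * pi) ^ (2 * DIM('a)) = ?C * ?C"
    by (simp only: mult_2 power_add)
  ultimately show ?thesis by simp
qed

section \<open>Stable transition densities\<close>

locale stable_density =
  fixes \<nu> \<alpha> :: real and p :: "real \<Rightarrow> 'a::euclidean_space \<Rightarrow> real"
  assumes \<nu>: "0 < \<nu>" and \<alpha>: "0 < \<alpha>" "\<alpha> < 2"
    and p: "stable_transition_density \<nu> \<alpha> p"
begin

definition \<phi> :: "real \<Rightarrow> 'a \<Rightarrow> real" where
  "\<phi> t \<eta> = exp (- t * \<nu> * norm \<eta> powr \<alpha>)"

lemma \<phi>_pos [simp]: "0 < \<phi> t \<eta>" "0 \<le> \<phi> t \<eta>"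
  by (simp_all add: \<phi>_def)

lemma \<phi>_measurable [measurable]: "(\<lambda>(t, \<eta>). \<phi> t \<eta>) \<in> borel_measurable (borel \<Otimes>\<^sub>M borel)"
  unfolding \<phi>_def by measurable

lemma \<phi>_measurable' [measurable]: "\<phi> t \<in> borel_measurable borel"
  unfolding \<phi>_def by measurable

lemma \<phi>_integrable: "0 < t \<Longrightarrow> integrable lborel (\<phi> t)"
  using radial_exp_integrable[of "t * \<nu>" \<alpha>, where 'a='a] \<nu> \<alpha> by (simp add: \<phi>_def[abs_def])

lemma
  assumes "0 < t"
  shows p_continuous: "continuous_on UNIV (p t)"
    and p_nonneg: "0 \<le> p t x"
    and p_integrable: "integrable lborel (p t)"
    and p_fourier: "(LINT x|lborel. iexp (\<xi> \<bullet> x) * complex_of_real (p t x)) = complex_of_real (\<phi> t \<xi>)"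
  using p assms unfolding stable_transition_density_def \<phi>_def by blast+

lemma p_integral: "0 < t \<Longrightarrow> (LINT x|lborel. p t x) = 1"
  using p_fourier[of t 0] \<alpha> by (simp add: \<phi>_def integral_complex_of_real)

lemma p_inversion:
  "0 < t \<Longrightarrow> p t x = (LINT \<eta>|lborel. cos (\<eta> \<bullet> x) * \<phi> t \<eta>) / sqrt (2 * pi) ^ (2 * DIM('a))"
  by (rule fourier_inversion[OF p_integrable p_nonneg p_continuous p_fourier \<phi>_integrable])

text \<open>Each \<open>p t\<close> is specified separately, so joint measurability in (t, x) is not
  part of the data; it comes from the explicit inversion integral. The indicator removes the times t
  \<le> 0, where \<open>p\<close> is arbitrary.\<close>

lemma p_measurable:
  "(\<lambda>(t, x). indicator {0<..} t * p t x) \<in> borel_measurable (borel \<Otimes>\<^sub>M borel)"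
proof -
  have eq: "(\<lambda>(t, x). indicator {0<..} t * p t x) =
      (\<lambda>(t, x). indicator {0<..} t * ((LINT \<eta>|lborel. cos (\<eta> \<bullet> x) * \<phi> t \<eta>) / sqrt (2 * pi) ^ (2 * DIM('a))))"
    by (auto simp: p_inversion split: split_indicator)
  show ?thesis
    unfolding eq by measurable
qed

text \<open>A Gaussian form of the truncation inequality. Where |x| \<ge> r, the weight 1 - exp (-
  |x/r|^2 / 2) is at least \<open>k\<close>, so the tail is at most 1/k times the integral of p
  against this weight. In Fourier terms that integral is a Gaussian average of 1 - \<phi> t (y / r),
  and 1 - exp (- z) \<le> z bounds it by a multiple of t * r^(-\<alpha>).\<close>

lemma p_tail:
  obtains C where "0 < C"
    "\<And>t r. 0 < t \<Longrightarrow> 0 < r \<Longrightarrow> (LINT x|lborel. indicator {x. r \<le> norm x} x * p t x) \<le> C * t * r powr - \<alpha>"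
proof -
  let ?K = "sqrt (2 * pi) ^ DIM('a)"
  let ?h = "\<lambda>y::'a. exp (- (norm y)\<^sup>2 / 2)"
  define M where "M = (LINT y::'a|lborel. ?h y * norm y powr \<alpha>)"
  have Mi: "integrable lborel (\<lambda>y::'a. ?h y * norm y powr \<alpha>)"
  proof -
    have "(\<lambda>u. exp (- u\<^sup>2 / 2) * u powr \<alpha>) \<in> O(\<lambda>u. exp (- 1 * u powr 1))"
      using \<alpha> by real_asymp
    then obtain c where c: "\<forall>\<^sub>F u in at_top. norm (exp (- u\<^sup>2 / 2) * u powr \<alpha>) \<le> c * norm (exp (- 1 * u powr 1))"
      by (rule landau_o.bigE)
    then obtain u0 where u0: "\<And>u. u0 \<le> u \<Longrightarrow> exp (- u\<^sup>2 / 2) * u powr \<alpha> \<le> c * exp (- 1 * u powr 1)"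
      by (auto simp: eventually_at_top_linorder abs_mult)
    \<comment> \<open>The asymptotic comparison holds only from \<open>u0\<close> on; the second
      summand covers the ball |y| < u0, where all factors are bounded.\<close>
    define c' where "c' = max 0 c + (max 0 u0) powr \<alpha> * exp (max 0 u0)"
    have "?h y * norm y powr \<alpha> \<le> c' * exp (- 1 * norm y powr 1)" for y :: 'a
    proof (cases "u0 \<le> norm y")
      case True
      have "c \<le> c'" by (auto simp: c'_def intro: add_increasing2)
      then show ?thesis
        using u0[OF True] by (meson exp_ge_zero mult_right_mono order_trans)
    next
      case False
      then have "norm y powr \<alpha> \<le> (max 0 u0) powr \<alpha>" "exp (norm y) \<le> exp (max 0 u0)"
        using \<alpha> by (auto intro!: powr_mono2)
      then have "?h y * norm y powr \<alpha> * exp (norm y) \<le> 1 * (max 0 u0) powr \<alpha> * exp (max 0 u0)"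
        by (intro mult_mono) auto
      also have "\<dots> \<le> c'" by (simp add: c'_def)
      finally show ?thesis
        by (simp add: exp_minus field_simps)
    qed
    then show ?thesis
      by (intro Bochner_Integration.integrable_bound[OF integrable_mult_right[OF radial_exp_integrable[of 1 1, where 'a='a], of c']])
        (auto simp: abs_mult c'_def max_def intro!: AE_I2)
  qed
  have M0: "0 \<le> M"
    unfolding M_def by simp
  define k where "k = 1 - exp (- 1 / 2 :: real)"
  have k: "0 < k" by (simp add: k_def)
  show thesis
  proof (rule that)
    show "0 < \<nu> * (M + 1) / (k * ?K)"
      using k M0 \<nu> by simp
    fix t r :: real assume t: "0 < t" and r: "0 < r"
    have [measurable]: "p t \<in> borel_measurable borel"
      using borel_measurable_integrable[OF p_integrable[OF t]] by simp
    have hi: "integrable lborel (\<lambda>x. p t x * ?h (x /\<^sub>R r))"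
      by (rule Bochner_Integration.integrable_bound[OF p_integrable[OF t]]) (auto simp: abs_mult intro!: mult_left_le)
    have h\<phi>: "integrable lborel (\<lambda>y. ?h y * \<phi> t (y /\<^sub>R r))"
      by (rule Bochner_Integration.integrable_bound[OF gaussian_integrable])
        (use t \<nu> in \<open>auto simp: abs_mult \<phi>_def intro!: mult_left_le\<close>)
    \<comment> \<open>Rescaling by r brings the integral into the form of
      \<open>gaussian_smoothing\<close> at z = 0 and e = r; a second rescaling on the frequency side
      removes the factor r^d again.\<close>
    have "(LINT x|lborel. p t x * ?h (x /\<^sub>R r)) = r ^ DIM('a) * (LINT y|lborel. p t (0 + r *\<^sub>R y) * ?h y)"
      using r by (subst lborel_integral_affine[OF r, of _ 0]) auto
    then have "complex_of_real (?K * (LINT x|lborel. p t x * ?h (x /\<^sub>R r))) =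
        complex_of_real (r ^ DIM('a)) * complex_of_real (?K * (LINT y|lborel. p t (0 + r *\<^sub>R y) * ?h y))"
      by simp
    also have "\<dots> = complex_of_real (r ^ DIM('a)) * (LINT \<eta>|lborel. complex_of_real (?h (r *\<^sub>R \<eta>) * \<phi> t \<eta>))"
      unfolding gaussian_smoothing[OF p_integrable[OF t] p_fourier[OF t] r] by simp
    also have "\<dots> = complex_of_real (r ^ DIM('a) * (LINT \<eta>|lborel. ?h (r *\<^sub>R \<eta>) * \<phi> t \<eta>))"
      unfolding integral_complex_of_real by (simp only: of_real_mult)
    also have "r ^ DIM('a) * (LINT \<eta>|lborel. ?h (r *\<^sub>R \<eta>) * \<phi> t \<eta>) = (LINT y|lborel. ?h y * \<phi> t (y /\<^sub>R r))"
      using r by (subst (2) lborel_integral_affine[OF r, of _ 0]) auto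
    finally have eq: "?K * (LINT x|lborel. p t x * ?h (x /\<^sub>R r)) = (LINT y|lborel. ?h y * \<phi> t (y /\<^sub>R r))"
      by (simp only: of_real_eq_iff)
    have ti: "integrable lborel (\<lambda>x. indicator {x. r \<le> norm x} x * p t x)"
      by (rule Bochner_Integration.integrable_bound[OF p_integrable[OF t]]) (auto split: split_indicator)
    have "k * (LINT x|lborel. indicator {x. r \<le> norm x} x * p t x) = (LINT x|lborel. k * (indicator {x. r \<le> norm x} x * p t x))"
      by simp
    also have "\<dots> \<le> (LINT x|lborel. p t x - p t x * ?h (x /\<^sub>R r))"
    proof (rule integral_mono)
      fix x
      have "k \<le> 1 - ?h (x /\<^sub>R r)" if "r \<le> norm x"
      proof -
        have "1 \<le> (norm x / r)\<^sup>2" using that r by simp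
        moreover have "norm (x /\<^sub>R r) = norm x / r"
          using r by (simp add: divide_inverse_commute)
        ultimately show ?thesis
          unfolding k_def by simp
      qed
      then have "k * indicator {x. r \<le> norm x} x \<le> 1 - ?h (x /\<^sub>R r)"
        by (auto split: split_indicator)
      from mult_right_mono[OF this p_nonneg[OF t, of x]]
      show "k * (indicator {x. r \<le> norm x} x * p t x) \<le> p t x - p t x * ?h (x /\<^sub>R r)"
        by (simp add: algebra_simps)
    qed (use ti in \<open>simp_all add: p_integrable[OF t] hi[simplified]\<close>)
    also have "\<dots> = 1 - (LINT x|lborel. p t x * ?h (x /\<^sub>R r))"
      by (subst Bochner_Integration.integral_diff[OF p_integrable[OF t] hi]) (simp add: p_integral[OF t])
    finally have "?K * (k * (LINT x|lborel. indicator {x. r \<le> norm x} x * p t x)) \<le> ?K * (1 - (LINT x|lborel. p t x * ?h (x /\<^sub>R r)))"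
      by (rule mult_left_mono) simp
    also have "\<dots> = (LINT y::'a|lborel. ?h y) - (LINT y|lborel. ?h y * \<phi> t (y /\<^sub>R r))"
      unfolding eq[symmetric] gaussian_integral by (simp add: right_diff_distrib)
    also have "\<dots> = (LINT y|lborel. ?h y - ?h y * \<phi> t (y /\<^sub>R r))"
      by (rule Bochner_Integration.integral_diff[OF gaussian_integrable h\<phi>, symmetric])
    also have "\<dots> \<le> (LINT y::'a|lborel. (t * \<nu> * r powr - \<alpha>) * (?h y * norm y powr \<alpha>))"
    proof (rule integral_mono)
      show "integrable lborel (\<lambda>y. ?h y - ?h y * \<phi> t (y /\<^sub>R r))"
        by (rule Bochner_Integration.integrable_diff[OF gaussian_integrable h\<phi>])
      show "integrable lborel (\<lambda>y::'a. (t * \<nu> * r powr - \<alpha>) * (?h y * norm y powr \<alpha>))"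
        by (rule integrable_mult_right[OF Mi])
      fix y :: 'a
      have "1 - \<phi> t (y /\<^sub>R r) \<le> t * \<nu> * (norm (y /\<^sub>R r)) powr \<alpha>"
        unfolding \<phi>_def using exp_ge_add_one_self[of "- t * \<nu> * norm (y /\<^sub>R r) powr \<alpha>"] by simp
      also have "norm (y /\<^sub>R r) powr \<alpha> = norm y powr \<alpha> * r powr - \<alpha>"
        using r by (simp add: powr_mult powr_minus inverse_powr mult.commute)
      finally show "?h y - ?h y * \<phi> t (y /\<^sub>R r) \<le> (t * \<nu> * r powr - \<alpha>) * (?h y * norm y powr \<alpha>)"
        using mult_left_mono[of "1 - \<phi> t (y /\<^sub>R r)" "t * \<nu> * (norm y powr \<alpha> * r powr - \<alpha>)" "?h y"]
        by (simp add: algebra_simps)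
    qed
    also have "\<dots> = t * \<nu> * r powr - \<alpha> * M"
      unfolding M_def by (rule integral_mult_right_zero)
    also have "\<dots> \<le> t * \<nu> * r powr - \<alpha> * (M + 1)"
      using t \<nu> by (intro mult_left_mono) auto
    finally show "(LINT x|lborel. indicator {x. r \<le> norm x} x * p t x) \<le> \<nu> * (M + 1) / (k * ?K) * t * r powr - \<alpha>"
      using k by (simp add: field_simps)
  qed
qed

text \<open>At large times the inversion integral is dominated by low frequencies. For |\<eta>|
  \<le> 1/R and |x| \<le> R the phase is at most 1, so the cosine is at least 1/2; higher
  frequencies carry an exponentially smaller weight. How large s must be depends only on R, while c
  deteriorates as S grows.\<close>

lemma p_lower_bound:
  assumes R: "0 < R"
  obtains S0 where "0 < S0" "\<And>S. S0 \<le> S \<Longrightarrow> \<exists>c>0. \<forall>s\<in>{S0..S}. \<forall>x. norm x \<le> R \<longrightarrow> c \<le> p s x"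
proof -
  let ?K = "sqrt (2 * pi) ^ (2 * DIM('a))"
  define d where "d = 1 / R"
  have d: "0 < d" using R by (simp add: d_def)
  define a where "a = \<nu> * d powr \<alpha>"
  have a: "0 < a" using \<nu> d by (simp add: a_def)
  \<comment> \<open>The radius at which the decay rate is a/2, half of the rate a at radius
    \<open>d\<close>. The gap between the two rates is what lets the inner ball win for large
    s.\<close>
  define d' where "d' = d * (1 / 2) powr (1 / \<alpha>)"
  have d': "0 < d'" "d' \<le> d"
    using d \<alpha> powr_mono2[of "1 / \<alpha>" "1/2" 1] by (auto simp: d'_def intro!: mult_left_le)
  have d'a: "\<nu> * d' powr \<alpha> = a / 2"
    using d \<alpha> by (simp add: d'_def a_def powr_mult powr_powr)
  define v where "v = measure lborel (cball (0::'a) d')"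
  have v: "0 < v"
    using content_cball_pos[of d' "0::'a"] d' by (simp add: v_def)
  define I where "I = (LINT \<eta>|lborel. \<phi> 1 \<eta>)"
  have lim: "((\<lambda>s. exp a * I * exp (- s * a / 2)) \<longlongrightarrow> 0) at_top"
    using a by real_asymp
  have "\<forall>\<^sub>F s in at_top. exp a * I * exp (- s * a / 2) < v / 4"
    using order_tendstoD(2)[OF lim, of "v / 4"] v by simp
  then obtain S0 where S0: "\<And>s. S0 \<le> s \<Longrightarrow> exp a * I * exp (- s * a / 2) < v / 4"
    by (auto simp: eventually_at_top_linorder)
  show thesis
  proof (rule that)
    show "0 < max 1 S0" by simp
    fix S assume "max 1 S0 \<le> S"
    have "exp (- S * a / 2) * (v / 4) / ?K \<le> p s x" if s: "s \<in> {max 1 S0..S}" and x: "norm x \<le> R" for s x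
    proof -
      have s0: "0 < s" "1 \<le> s" "S0 \<le> s" using s by auto
      \<comment> \<open>A pointwise minorant of the integrand: a positive plateau on the inner ball,
        minus a term that covers |\<eta>| > d. One unit of time is kept back in
        \<open>\<phi> 1\<close> so that this error stays integrable, while the other s - 1 units
        give its decay.\<close>
      have "(LINT \<eta>|lborel. 1 / 2 * exp (- s * a / 2) * indicator (cball (0::'a) d') \<eta> - exp (- (s - 1) * a) * \<phi> 1 \<eta>)
          \<le> (LINT \<eta>|lborel. cos (\<eta> \<bullet> x) * \<phi> s \<eta>)"
      proof (rule integral_mono)
        show "integrable lborel (\<lambda>\<eta>. 1 / 2 * exp (- s * a / 2) * indicator (cball (0::'a) d') \<eta> - exp (- (s - 1) * a) * \<phi> 1 \<eta>)"
          by (intro Bochner_Integration.integrable_diff integrable_mult_right \<phi>_integrable integrable_real_indicator)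
            (simp_all add: emeasure_lborel_cball_finite[simplified])
        show "integrable lborel (\<lambda>\<eta>. cos (\<eta> \<bullet> x) * \<phi> s \<eta>)"
          by (rule Bochner_Integration.integrable_bound[OF \<phi>_integrable[OF s0(1)]])
            (auto simp: abs_mult intro!: mult_left_le_one_le)
        fix \<eta> :: 'a
        have cos: "1 / 2 \<le> cos (\<eta> \<bullet> x)" if "norm \<eta> \<le> d"
        proof -
          have "\<bar>\<eta> \<bullet> x\<bar> \<le> norm \<eta> * norm x" by (rule Cauchy_Schwarz_ineq2)
          also have "\<dots> \<le> d * R" using that x d by (intro mult_mono) auto
          finally have "\<bar>\<eta> \<bullet> x\<bar> \<le> 1" using R by (simp add: d_def)
          moreover have "1 \<le> pi / 3" using pi_gt3 by simp
          ultimately have "cos (pi / 3) \<le> cos \<bar>\<eta> \<bullet> x\<bar>"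
            by (intro cos_monotone_0_pi_le) auto
          then show ?thesis by (simp add: cos_60)
        qed
        consider "norm \<eta> \<le> d'" | "d' < norm \<eta>" "norm \<eta> \<le> d" | "d < norm \<eta>" by linarith
        then show "1 / 2 * exp (- s * a / 2) * indicator (cball (0::'a) d') \<eta> - exp (- (s - 1) * a) * \<phi> 1 \<eta> \<le> cos (\<eta> \<bullet> x) * \<phi> s \<eta>"
        proof cases
          case 1
          then have "\<nu> * norm \<eta> powr \<alpha> \<le> a / 2"
            unfolding d'a[symmetric] using \<nu> \<alpha> by (intro mult_left_mono powr_mono2) auto
          then have "s * (\<nu> * norm \<eta> powr \<alpha>) \<le> s * (a / 2)"
            using s0 by (intro mult_left_mono) auto
          then have "exp (- s * a / 2) \<le> \<phi> s \<eta>"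
            by (simp add: \<phi>_def mult.assoc)
          then have "1 / 2 * exp (- s * a / 2) \<le> cos (\<eta> \<bullet> x) * \<phi> s \<eta>"
            using cos 1 d' by (intro mult_mono) auto
          moreover have "0 \<le> exp (- (s - 1) * a) * \<phi> 1 \<eta>" by simp
          ultimately have "1 / 2 * exp (- s * a / 2) * 1 - exp (- (s - 1) * a) * \<phi> 1 \<eta> \<le> cos (\<eta> \<bullet> x) * \<phi> s \<eta>"
            by linarith
          then show ?thesis using 1 by simp
        next
          case 2
          then have "0 \<le> cos (\<eta> \<bullet> x) * \<phi> s \<eta>" using cos by simp
          moreover have "0 \<le> exp (- (s - 1) * a) * \<phi> 1 \<eta>" by simp
          ultimately have "1 / 2 * exp (- s * a / 2) * 0 - exp (- (s - 1) * a) * \<phi> 1 \<eta> \<le> cos (\<eta> \<bullet> x) * \<phi> s \<eta>"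
            by linarith
          then show ?thesis using 2 by simp
        next
          case 3
          then have "a \<le> \<nu> * norm \<eta> powr \<alpha>"
            unfolding a_def using \<nu> d \<alpha> by (intro mult_left_mono powr_mono2) auto
          then have "(s - 1) * a \<le> (s - 1) * (\<nu> * norm \<eta> powr \<alpha>)"
            using s0 by (intro mult_left_mono) auto
          then have "\<phi> s \<eta> \<le> exp (- (s - 1) * a) * \<phi> 1 \<eta>"
            by (simp add: \<phi>_def exp_add[symmetric] algebra_simps)
          moreover have "- \<phi> s \<eta> \<le> cos (\<eta> \<bullet> x) * \<phi> s \<eta>"
            using mult_right_mono[OF cos_ge_minus_one[of "\<eta> \<bullet> x"] \<phi>_pos(2)[of s \<eta>]] by simp
          ultimately have "1 / 2 * exp (- s * a / 2) * 0 - exp (- (s - 1) * a) * \<phi> 1 \<eta> \<le> cos (\<eta> \<bullet> x) * \<phi> s \<eta>"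
            by linarith
          moreover have "indicator (cball (0::'a) d') \<eta> = (0::real)" using 3 d' by simp
          ultimately show ?thesis by metis
        qed
      qed
      also have "(LINT \<eta>|lborel. 1 / 2 * exp (- s * a / 2) * indicator (cball (0::'a) d') \<eta> - exp (- (s - 1) * a) * \<phi> 1 \<eta>) =
          1 / 2 * exp (- s * a / 2) * v - exp (- (s - 1) * a) * I"
        by (subst Bochner_Integration.integral_diff) (auto intro!: \<phi>_integrable simp: emeasure_lborel_cball_finite[simplified] v_def I_def)
      finally have "1 / 2 * exp (- s * a / 2) * v - exp (- (s - 1) * a) * I \<le> ?K * p s x"
        unfolding p_inversion[OF s0(1)] by simp
      moreover have "exp (- (s - 1) * a) * I = exp (- s * a / 2) * (exp a * I * exp (- s * a / 2))"
      proof -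
        have "exp (- (s - 1) * a) = exp (- s * a / 2) * exp a * exp (- s * a / 2)"
          by (simp add: exp_add[symmetric] algebra_simps)
        then show ?thesis by simp
      qed
      moreover have "exp (- s * a / 2) * (exp a * I * exp (- s * a / 2)) \<le> exp (- s * a / 2) * (v / 4)"
        using S0[OF s0(3)] by (intro mult_left_mono) auto
      ultimately have "exp (- s * a / 2) * (v / 4) \<le> ?K * p s x"
        by linarith
      moreover have "exp (- S * a / 2) * (v / 4) \<le> exp (- s * a / 2) * (v / 4)"
        using s a v by (intro mult_right_mono) auto
      ultimately have "exp (- S * a / 2) * (v / 4) \<le> ?K * p s x"
        by linarith
      from divide_right_mono[OF this, of ?K] show ?thesis by simp
    qed
    moreover have "0 < exp (- S * a / 2) * (v / 4) / ?K" using v by simp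
    ultimately show "\<exists>c>0. \<forall>s\<in>{max 1 S0..S}. \<forall>x. norm x \<le> R \<longrightarrow> c \<le> p s x" by blast
  qed
qed

end

section \<open>The first passage time of the subordinator\<close>

locale subordinator =
  fixes N :: "'v measure" and \<beta> :: real and D :: "real \<Rightarrow> 'v \<Rightarrow> real" and f :: "real \<Rightarrow> real \<Rightarrow> real"
  assumes \<beta>: "0 < \<beta>" "\<beta> < 1"
    and D: "stable_subordinator N \<beta> D"
    and f: "first_passage_density N D f"

sublocale subordinator \<subseteq> prob_space N
  using D by (simp add: stable_subordinator_def)

context subordinator
begin

lemma D_measurable: "0 \<le> r \<Longrightarrow> D r \<in> borel_measurable N"
  using D by (simp add: stable_subordinator_def)

lemma D_laplace: "0 \<le> r \<Longrightarrow> 0 \<le> l \<Longrightarrow> (LINT \<omega>|N. exp (- l * D r \<omega>)) = exp (- r * l powr \<beta>)"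
  using D by (simp add: stable_subordinator_def)

lemma D_mono_AE: "AE \<omega> in N. D 0 \<omega> = 0 \<and> mono_on {0..} (\<lambda>r. D r \<omega>)"
  using D by (auto simp: stable_subordinator_def)

text \<open>A function that is not integrable has Bochner integral 0, whereas the prescribed Laplace
  transform is positive.\<close>

lemma D_exp_integrable: "0 \<le> r \<Longrightarrow> 0 \<le> l \<Longrightarrow> integrable N (\<lambda>\<omega>. exp (- l * D r \<omega>))"
  using D_laplace[of r l] not_integrable_integral_eq[of N "\<lambda>\<omega>. exp (- l * D r \<omega>)"] by fastforce

text \<open>The exponential Markov inequality. The free parameter l is set to 1 for statements about
  large r and to 1/t for the behaviour at small t.\<close>

lemma D_le_bound:
  assumes r: "0 \<le> r" and l: "0 \<le> l"
  shows "prob {\<omega>\<in>space N. D r \<omega> \<le> t} \<le> exp (l * t - r * l powr \<beta>)"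
proof -
  note [measurable] = D_measurable[OF r]
  have "exp (- l * t) * prob {\<omega>\<in>space N. D r \<omega> \<le> t} = (LINT \<omega>|N. exp (- l * t) * indicator {\<omega>\<in>space N. D r \<omega> \<le> t} \<omega>)"
    by simp
  also have "\<dots> \<le> (LINT \<omega>|N. exp (- l * D r \<omega>))"
    using D_exp_integrable[OF r l] l
    by (intro integral_mono) (auto split: split_indicator simp: emeasure_eq_measure intro!: mult_left_mono)
  also have "\<dots> = exp (- r * l powr \<beta>)"
    by (rule D_laplace[OF r l])
  finally show ?thesis
    by (simp add: exp_minus exp_diff field_simps)
qed

text \<open>Were D r bounded below by \<open>t\<close>, its Laplace exponent would grow at least linearly.\<close>

lemma D_le_pos:
  assumes r: "0 \<le> r" and t: "0 < t"
  shows "0 < prob {\<omega>\<in>space N. D r \<omega> \<le> t}"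
proof (rule ccontr)
  note [measurable] = D_measurable[OF r]
  assume "\<not> ?thesis"
  then have "prob {\<omega>\<in>space N. D r \<omega> \<le> t} = 0"
    by (simp add: zero_less_measure_iff)
  then have "AE \<omega> in N. \<not> D r \<omega> \<le> t"
    by (subst (asm) prob_eq_0) auto
  then have *: "exp (- r * l powr \<beta>) \<le> exp (- l * t)" if "0 \<le> l" for l
    unfolding D_laplace[OF r that, symmetric]
    using that D_exp_integrable[OF r that]
    by (intro integral_le_const) (auto elim!: eventually_mono intro!: mult_left_mono)
  \<comment> \<open>Since \<beta> < 1, the true Laplace exponent grows slower than linearly, which
    contradicts \<open>*\<close> for large l.\<close>
  have "\<forall>\<^sub>F l in at_top. r * l powr \<beta> < l * t"
    using \<beta> t r by real_asymp
  then obtain l where "r * l powr \<beta> < l * t" "0 \<le> l"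
    by (metis (mono_tags, lifting) eventually_at_top_linorder linorder_linear)
  then show False using *[of l] by simp
qed

lemma f_nonneg: "0 < t \<Longrightarrow> 0 \<le> f t s"
  using f by (simp add: first_passage_density_def)

lemma f_distributed: "0 < t \<Longrightarrow> distributed N lborel (first_passage D t) (\<lambda>s. ennreal (f t s))"
  using f by (simp add: first_passage_density_def)

lemma f_measurable: "0 < t \<Longrightarrow> f t \<in> borel_measurable borel"
  using distributed_real_measurable[OF _ f_distributed[of t]] f_nonneg[of t] by simp

lemma first_passage_measurable: "0 < t \<Longrightarrow> first_passage D t \<in> borel_measurable N"
  using distributed_measurable[OF f_distributed[of t]] by simp

lemma nn_integral_f:
  assumes "0 < t" "A \<in> sets borel"
  shows "(\<integral>\<^sup>+ s. ennreal (f t s) * indicator A s \<partial>lborel) = prob {\<omega>\<in>space N. first_passage D t \<omega> \<in> A}"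
  using distributed_emeasure[OF f_distributed[OF assms(1)], of A] assms(2)
  by (simp add: emeasure_eq_measure vimage_def Int_def conj_commute)

text \<open>Ensures that the set whose infimum defines \<open>first_passage\<close> is nonempty, so
  that \<open>Inf\<close> has its intended meaning on almost every path.\<close>

lemma unbounded_AE: "AE \<omega> in N. \<exists>n::nat. t < D (real n) \<omega>"
proof -
  note [measurable] = D_measurable[OF of_nat_0_le_iff]
  let ?A = "{\<omega>\<in>space N. \<forall>n::nat. D (real n) \<omega> \<le> t}"
  have "prob ?A \<le> exp (t - real n)" for n :: nat
  proof -
    have "prob ?A \<le> prob {\<omega>\<in>space N. D (real n) \<omega> \<le> t}"
      by (intro finite_measure_mono) auto
    also have "\<dots> \<le> exp (t - real n)"
      using D_le_bound[of "real n" 1 t] by simp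
    finally show ?thesis .
  qed
  moreover have "(\<lambda>n::nat. exp (t - real n)) \<longlonglongrightarrow> 0"
    by real_asymp
  ultimately have "prob ?A \<le> 0"
    by (intro LIMSEQ_le_const) auto
  then have "prob ?A = 0"
    by (simp add: measure_le_0_iff)
  then have "AE \<omega> in N. \<omega> \<notin> ?A"
    by (intro AE_not_in) (auto simp: null_sets_def emeasure_eq_measure)
  then show ?thesis
    by (auto simp: not_le)
qed

lemma first_passage_AE:
  assumes "0 \<le> S"
  shows "AE \<omega> in N. 0 \<le> first_passage D t \<omega> \<and> (D S \<omega> \<le> t \<longrightarrow> S \<le> first_passage D t \<omega>) \<and>
    (t < D S \<omega> \<longrightarrow> first_passage D t \<omega> \<le> S)"
  using unbounded_AE[of t] D_mono_AE
proof eventually_elim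
  case (elim \<omega>)
  let ?A = "{r. 0 \<le> r \<and> t < D r \<omega>}"
  have ne: "?A \<noteq> {}" using elim(1) of_nat_0_le_iff by blast
  have bdd: "bdd_below ?A" by (auto simp: bdd_below_def)
  have "0 \<le> Inf ?A" using ne by (intro cInf_greatest) auto
  moreover have "S \<le> Inf ?A" if S: "D S \<omega> \<le> t"
  proof (rule cInf_greatest[OF ne])
    fix r assume "r \<in> ?A"
    have "\<not> r \<le> S"
    proof
      assume "r \<le> S"
      then have "D r \<omega> \<le> D S \<omega>"
        using elim(2) assms \<open>r \<in> ?A\<close> by (auto simp: mono_on_def)
      then show False using S \<open>r \<in> ?A\<close> by simp
    qed
    then show "S \<le> r" by simp
  qed
  moreover have "Inf ?A \<le> S" if "t < D S \<omega>"
    using that assms bdd by (intro cInf_lower) auto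
  ultimately show ?case by (simp add: first_passage_def)
qed

lemma nn_integral_f_Ioc:
  assumes t: "0 < t" and S: "0 \<le> S"
  shows "(\<integral>\<^sup>+ s. ennreal (f t s) * indicator {0<..S} s \<partial>lborel) \<ge> ennreal (1 - prob {\<omega>\<in>space N. D S \<omega> \<le> t})"
proof -
  note [measurable] = D_measurable[OF S] first_passage_measurable[OF t]
  \<comment> \<open>The stable density is given only at positive times, so 0 is excluded from the
    interval; as a null set it may be added back for the comparison with the law of the first
    passage time.\<close>
  have "AE s in lborel. (s::real) \<noteq> 0" by (rule AE_lborel_singleton)
  then have "(\<integral>\<^sup>+ s. ennreal (f t s) * indicator {0<..S} s \<partial>lborel) = (\<integral>\<^sup>+ s. ennreal (f t s) * indicator {0..S} s \<partial>lborel)"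
    by (intro nn_integral_cong_AE) (auto elim!: eventually_mono split: split_indicator)
  also have "\<dots> = prob {\<omega>\<in>space N. first_passage D t \<omega> \<in> {0..S}}"
    using t by (intro nn_integral_f) auto
  also have "\<dots> \<ge> prob {\<omega>\<in>space N. \<not> D S \<omega> \<le> t}"
  proof (intro ennreal_leI finite_measure_mono_AE)
    show "AE \<omega> in N. \<omega> \<in> {\<omega>\<in>space N. \<not> D S \<omega> \<le> t} \<longrightarrow> \<omega> \<in> {\<omega>\<in>space N. first_passage D t \<omega> \<in> {0..S}}"
      using first_passage_AE[OF S, of t] by eventually_elim auto
  qed auto
  also have "prob {\<omega>\<in>space N. \<not> D S \<omega> \<le> t} = 1 - prob {\<omega>\<in>space N. D S \<omega> \<le> t}"
    by (rule prob_neg) simp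
  finally show ?thesis .
qed

text \<open>On almost every path, D S0 \<le> t < D S forces the first passage over t to happen
  between S0 and S.\<close>

lemma nn_integral_f_Icc:
  assumes t: "0 < t" and S: "0 \<le> S0" "S0 \<le> S"
  shows "(\<integral>\<^sup>+ s. ennreal (f t s) * indicator {S0..S} s \<partial>lborel) \<ge>
    ennreal (prob {\<omega>\<in>space N. D S0 \<omega> \<le> t} - prob {\<omega>\<in>space N. D S \<omega> \<le> t})"
proof -
  have S': "0 \<le> S" using S by simp
  note [measurable] = D_measurable[OF S(1)] D_measurable[OF S'] first_passage_measurable[OF t]
  let ?A = "{\<omega>\<in>space N. first_passage D t \<omega> \<in> {S0..S}}"
  have "prob {\<omega>\<in>space N. D S0 \<omega> \<le> t} \<le> prob (?A \<union> {\<omega>\<in>space N. D S \<omega> \<le> t})"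
  proof (intro finite_measure_mono_AE)
    show "AE \<omega> in N. \<omega> \<in> {\<omega>\<in>space N. D S0 \<omega> \<le> t} \<longrightarrow> \<omega> \<in> ?A \<union> {\<omega>\<in>space N. D S \<omega> \<le> t}"
      using first_passage_AE[OF S(1), of t] first_passage_AE[OF S', of t] by eventually_elim auto
  qed auto
  also have "\<dots> \<le> prob ?A + prob {\<omega>\<in>space N. D S \<omega> \<le> t}"
    by (rule measure_Un_le) auto
  finally show ?thesis
    using t by (subst nn_integral_f) (auto intro!: ennreal_leI)
qed

end

section \<open>The kernel G\<close>

locale time_changed_stable = stable_density \<nu> \<alpha> p + subordinator N \<beta> D f
  for \<nu> \<alpha> :: real and p :: "real \<Rightarrow> 'a::euclidean_space \<Rightarrow> real"
    and N :: "'v measure" and \<beta> D f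
begin

definition G :: "real \<Rightarrow> 'a \<Rightarrow> real" where
  "G = kernel_G p f"

text \<open>The indicator discards s \<le> 0, where \<open>p\<close> is arbitrary, so that joint
  measurability can be stated on the whole line.\<close>

definition g :: "real \<Rightarrow> real \<Rightarrow> 'a \<Rightarrow> real" where
  "g t s x = indicator {0<..} s * p s x * f t s"

lemma G_eq: "G t x = (LINT s|lborel. g t s x)"
  by (simp add: G_def kernel_G_def g_def set_lebesgue_integral_def mult.assoc)

lemma g_nonneg: "0 < t \<Longrightarrow> 0 \<le> g t s x"
  by (auto simp: g_def p_nonneg f_nonneg split: split_indicator)

lemma g_measurable:
  assumes "0 < t"
  shows "(\<lambda>(s, x). g t s x) \<in> borel_measurable (borel \<Otimes>\<^sub>M borel)"
proof -
  note [measurable] = p_measurable f_measurable[OF assms]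
  have eq: "(\<lambda>(s, x). g t s x) = (\<lambda>z. (case z of (s, x) \<Rightarrow> indicator {0<..} s * p s x) * f t (fst z))"
    by (auto simp: g_def)
  show ?thesis unfolding eq by measurable
qed

lemma G_nonneg: "0 < t \<Longrightarrow> 0 \<le> G t x"
  by (simp add: G_eq g_nonneg)

lemma G_measurable:
  assumes "0 < t"
  shows "G t \<in> borel_measurable borel"
proof -
  note [measurable] = g_measurable[OF assms]
  show ?thesis unfolding G_eq[abs_def] by measurable
qed

lemma nn_integral_p:
  assumes "0 < s"
  shows "(\<integral>\<^sup>+ x. ennreal (p s x) \<partial>lborel) = 1"
  by (subst nn_integral_eq_integral[OF p_integrable[OF assms]]) (simp_all add: p_nonneg assms p_integral)

lemma nn_integral_g:
  assumes t: "0 < t" and [measurable]: "A \<in> sets borel"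
  shows "(\<integral>\<^sup>+ x. (\<integral>\<^sup>+ s. ennreal (g t s x) \<partial>lborel) * indicator A x \<partial>lborel) =
    (\<integral>\<^sup>+ s. ennreal (f t s) * indicator {0<..} s * (\<integral>\<^sup>+ x. ennreal (p s x) * indicator A x \<partial>lborel) \<partial>lborel)"
proof -
  note [measurable] = g_measurable[OF t]
  have "(\<integral>\<^sup>+ x. (\<integral>\<^sup>+ s. ennreal (g t s x) \<partial>lborel) * indicator A x \<partial>lborel) =
      (\<integral>\<^sup>+ x. (\<integral>\<^sup>+ s. ennreal (g t s x) * indicator A x \<partial>lborel) \<partial>lborel)"
    by (simp add: nn_integral_multc)
  also have "\<dots> = (\<integral>\<^sup>+ s. (\<integral>\<^sup>+ x. ennreal (g t s x) * indicator A x \<partial>lborel) \<partial>lborel)"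
    by (rule lborel_pair.Fubini'[symmetric]) measurable
  also have "\<dots> = (\<integral>\<^sup>+ s. ennreal (f t s) * indicator {0<..} s * (\<integral>\<^sup>+ x. ennreal (p s x) * indicator A x \<partial>lborel) \<partial>lborel)"
  proof (rule nn_integral_cong)
    fix s :: real
    show "(\<integral>\<^sup>+ x. ennreal (g t s x) * indicator A x \<partial>lborel) =
        ennreal (f t s) * indicator {0<..} s * (\<integral>\<^sup>+ x. ennreal (p s x) * indicator A x \<partial>lborel)"
    proof (cases "0 < s")
      case True
      have [measurable]: "p s \<in> borel_measurable borel"
        using borel_measurable_integrable[OF p_integrable[OF True]] by simp
      have "(\<integral>\<^sup>+ x. ennreal (g t s x) * indicator A x \<partial>lborel) = (\<integral>\<^sup>+ x. ennreal (f t s) * (ennreal (p s x) * indicator A x) \<partial>lborel)"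
        using True by (intro nn_integral_cong) (simp add: g_def ennreal_mult p_nonneg f_nonneg t mult_ac)
      also have "\<dots> = ennreal (f t s) * (\<integral>\<^sup>+ x. ennreal (p s x) * indicator A x \<partial>lborel)"
        by (rule nn_integral_cmult) measurable
      finally show ?thesis using True by simp
    qed (simp add: g_def)
  qed
  finally show ?thesis .
qed

text \<open>The double integral over s and x is finite, hence so is the inner integral at almost
  every x. At exceptional points the Bochner integral defining \<open>G\<close> returns 0, which is
  why pointwise lower bounds on \<open>G\<close> are stated almost everywhere.\<close>

lemma G_eq_nn_integral:
  assumes t: "0 < t"
  shows "AE x in lborel. ennreal (G t x) = (\<integral>\<^sup>+ s. ennreal (g t s x) \<partial>lborel)"
proof -
  note [measurable] = g_measurable[OF t] f_measurable[OF t]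
  have "(\<integral>\<^sup>+ x. (\<integral>\<^sup>+ s. ennreal (g t s x) \<partial>lborel) \<partial>lborel) =
      (\<integral>\<^sup>+ s. ennreal (f t s) * indicator {0<..} s * (\<integral>\<^sup>+ x. ennreal (p s x) \<partial>lborel) \<partial>lborel)"
    using nn_integral_g[OF t, of UNIV] by simp
  also have "\<dots> \<le> (\<integral>\<^sup>+ s. ennreal (f t s) * indicator UNIV s \<partial>lborel)"
    by (intro nn_integral_mono) (auto simp: nn_integral_p split: split_indicator)
  also have "\<dots> < \<infinity>"
    using t by (subst nn_integral_f) auto
  finally have fin: "(\<integral>\<^sup>+ x. (\<integral>\<^sup>+ s. ennreal (g t s x) \<partial>lborel) \<partial>lborel) < \<infinity>" .
  have "(\<lambda>x. \<integral>\<^sup>+ s. ennreal (g t s x) \<partial>lborel) \<in> borel_measurable lborel"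
    by measurable
  from nn_integral_PInf_AE[OF this] fin
  have "AE x in lborel. (\<integral>\<^sup>+ s. ennreal (g t s x) \<partial>lborel) \<noteq> \<infinity>"
    by simp
  then show ?thesis
  proof eventually_elim
    case (elim x)
    have "integrable lborel (\<lambda>s. g t s x)"
      using elim t by (intro integrableI_bounded) (auto simp: g_nonneg less_top)
    then show ?case
      unfolding G_eq using t by (subst nn_integral_eq_integral) (auto simp: g_nonneg)
  qed
qed

lemma nn_integral_G:
  assumes t: "0 < t" and A: "A \<in> sets borel"
  shows "(\<integral>\<^sup>+ x. ennreal (G t x) * indicator A x \<partial>lborel) =
    (\<integral>\<^sup>+ s. ennreal (f t s) * indicator {0<..} s * (\<integral>\<^sup>+ x. ennreal (p s x) * indicator A x \<partial>lborel) \<partial>lborel)"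
proof -
  have "(\<integral>\<^sup>+ x. ennreal (G t x) * indicator A x \<partial>lborel) = (\<integral>\<^sup>+ x. (\<integral>\<^sup>+ s. ennreal (g t s x) \<partial>lborel) * indicator A x \<partial>lborel)"
    using G_eq_nn_integral[OF t] by (intro nn_integral_cong_AE) (auto elim!: eventually_mono)
  then show ?thesis using nn_integral_g[OF assms] by simp
qed

lemma G_integrable:
  assumes t: "0 < t"
  shows "integrable lborel (G t)"
proof (rule integrableI_bounded)
  show "G t \<in> borel_measurable lborel" using G_measurable[OF t] by simp
  have "(\<integral>\<^sup>+ x. ennreal (norm (G t x)) \<partial>lborel) = (\<integral>\<^sup>+ x. ennreal (G t x) * indicator UNIV x \<partial>lborel)"
    using t by (simp add: G_nonneg)
  also have "\<dots> \<le> (\<integral>\<^sup>+ s. ennreal (f t s) * indicator UNIV s \<partial>lborel)"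
    unfolding nn_integral_G[OF t borel_open[OF open_UNIV]]
    by (intro nn_integral_mono) (auto simp: nn_integral_p split: split_indicator)
  also have "\<dots> < \<infinity>"
    using t by (subst nn_integral_f) auto
  finally show "(\<integral>\<^sup>+ x. ennreal (norm (G t x)) \<partial>lborel) < \<infinity>" .
qed

text \<open>At operational time s the stable process is typically within s^(1/\<alpha>) of its
  start, and operational time at t is of order t^\<beta>; hence the exponent \<kappa> =
  \<alpha>/\<beta>. Operational time is at most \<open>e\<close> with probability at least 3/4, and
  up to then the ball keeps mass at least 3/4; the product 9/16 exceeds 1/2.\<close>

lemma G_concentrated:
  obtains c \<kappa> where "0 < c" "0 < \<kappa>"
    "\<And>t r. 0 < r \<Longrightarrow> 0 < t \<Longrightarrow> t \<le> c * r powr \<kappa> \<Longrightarrow>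
      ennreal (1 / 2) \<le> (\<integral>\<^sup>+ x. ennreal (G t x) * indicator (ball 0 r) x \<partial>lborel)"
proof -
  obtain C where C: "0 < C"
    "\<And>t r. 0 < t \<Longrightarrow> 0 < r \<Longrightarrow> (LINT x|lborel. indicator {x. r \<le> norm x} x * p t x) \<le> C * t * r powr - \<alpha>"
    using p_tail by blast
  show thesis
  proof (rule that)
    show "0 < (12 * C) powr (- 1 / \<beta>)" "0 < \<alpha> / \<beta>"
      using C \<alpha> \<beta> by auto
    fix t r :: real
    assume r: "0 < r" and t: "0 < t" and tr: "t \<le> (12 * C) powr (- 1 / \<beta>) * r powr (\<alpha> / \<beta>)"
    \<comment> \<open>Makes the tail bound C * s * r^(-\<alpha>) at most 1/4 for every s \<le>
      e.\<close>
    define e where "e = r powr \<alpha> / (4 * C)"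
    have e: "0 < e" using r C by (simp add: e_def)
    have near: "ennreal (3 / 4) \<le> (\<integral>\<^sup>+ x. ennreal (p s x) * indicator (ball 0 r) x \<partial>lborel)" if s: "s \<in> {0<..e}" for s
    proof -
      have s0: "0 < s" using s by simp
      have [measurable]: "p s \<in> borel_measurable borel"
        using borel_measurable_integrable[OF p_integrable[OF s0]] by simp
      have i: "integrable lborel (\<lambda>x. indicator {x. r \<le> norm x} x * p s x)"
        by (rule Bochner_Integration.integrable_bound[OF p_integrable[OF s0]])
          (auto split: split_indicator)
      have i': "integrable lborel (\<lambda>x. p s x * indicator (ball 0 r) x)"
        using integrable_mult_indicator[OF _ p_integrable[OF s0], of "ball 0 r"] by (simp add: mult.commute)
      have "1 = (LINT x|lborel. indicator {x. r \<le> norm x} x * p s x + p s x * indicator (ball 0 r) x)"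
        unfolding p_integral[OF s0, symmetric] by (rule Bochner_Integration.integral_cong) (auto split: split_indicator)
      also have "\<dots> = (LINT x|lborel. indicator {x. r \<le> norm x} x * p s x) + (LINT x|lborel. p s x * indicator (ball 0 r) x)"
        by (rule Bochner_Integration.integral_add[OF i i'])
      also have "(LINT x|lborel. indicator {x. r \<le> norm x} x * p s x) \<le> C * s * r powr - \<alpha>"
        by (rule C(2)[OF s0 r])
      also have "C * s * r powr - \<alpha> \<le> C * e * r powr - \<alpha>"
        using s C by (intro mult_right_mono mult_left_mono) auto
      also have "C * e * r powr - \<alpha> = 1 / 4"
        using C r by (simp add: e_def powr_minus field_simps)
      finally have "3 / 4 \<le> (LINT x|lborel. p s x * indicator (ball 0 r) x)" by simp
      then have "ennreal (3 / 4) \<le> (\<integral>\<^sup>+ x. ennreal (p s x * indicator (ball 0 r) x) \<partial>lborel)"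
        using s0 by (subst nn_integral_eq_integral[OF i']) (auto simp: p_nonneg intro!: ennreal_leI)
      also have "\<dots> = (\<integral>\<^sup>+ x. ennreal (p s x) * indicator (ball 0 r) x \<partial>lborel)"
        by (intro nn_integral_cong) (auto split: split_indicator)
      finally show ?thesis .
    qed
    have "t powr \<beta> \<le> ((12 * C) powr (- 1 / \<beta>) * r powr (\<alpha> / \<beta>)) powr \<beta>"
      using t tr \<beta> by (intro powr_mono2) auto
    also have "\<dots> = e / 3"
    proof -
      have "(k powr (- 1 / \<beta>) * r powr (\<alpha> / \<beta>)) powr \<beta> = r powr \<alpha> / k" if "0 < k" for k
        using that r \<beta> by (simp add: powr_mult powr_powr powr_neg_one)
      from this[of "12 * C"] show ?thesis
        using C by (simp add: e_def)
    qed
    finally have "3 \<le> e * t powr - \<beta>"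
      using t by (simp add: powr_minus field_simps)
    moreover have "(1 / t) powr \<beta> = t powr - \<beta>"
      using t by (simp add: powr_minus powr_divide field_simps)
    \<comment> \<open>With Laplace parameter 1/t the exponent is 1 - e * t^(-\<beta>). The 12 in the
      choice of the constant gives t^\<beta> \<le> e/3, so the exponent is at most -2.\<close>
    moreover have "prob {\<omega>\<in>space N. D e \<omega> \<le> t} \<le> exp (1 / t * t - e * (1 / t) powr \<beta>)"
      using e t by (intro D_le_bound) auto
    ultimately have "prob {\<omega>\<in>space N. D e \<omega> \<le> t} \<le> exp (- 2)"
      using t by (auto elim!: order_trans)
    also have "exp (- 2) \<le> (1 / 4 :: real)"
    proof -
      have "2 * 2 \<le> exp (1::real) * exp 1"
        using exp_ge_add_one_self[of 1] by (intro mult_mono) auto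
      then show ?thesis by (simp add: exp_minus exp_add[symmetric] field_simps)
    qed
    finally have "ennreal (3 / 4) \<le> ennreal (1 - prob {\<omega>\<in>space N. D e \<omega> \<le> t})"
      by (intro ennreal_leI) simp
    also have "\<dots> \<le> (\<integral>\<^sup>+ s. ennreal (f t s) * indicator {0<..e} s \<partial>lborel)"
      using nn_integral_f_Ioc[OF t, of e] e by simp
    finally have f: "ennreal (3 / 4) \<le> (\<integral>\<^sup>+ s. ennreal (f t s) * indicator {0<..e} s \<partial>lborel)" .
    have "ennreal (1 / 2) \<le> ennreal (3 / 4 * (3 / 4))"
      by (rule ennreal_leI) simp
    also have "\<dots> = ennreal (3 / 4) * ennreal (3 / 4)"
      by (rule ennreal_mult) simp_all
    also have "\<dots> \<le> (\<integral>\<^sup>+ s. ennreal (f t s) * indicator {0<..e} s \<partial>lborel) * ennreal (3 / 4)"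
      by (rule mult_right_mono[OF f]) simp
    also have "\<dots> = (\<integral>\<^sup>+ s. ennreal (f t s) * indicator {0<..e} s * ennreal (3 / 4) \<partial>lborel)"
      using f_measurable[OF t] by (intro nn_integral_multc[symmetric]) simp
    also have "\<dots> \<le> (\<integral>\<^sup>+ x. ennreal (G t x) * indicator (ball 0 r) x \<partial>lborel)"
      unfolding nn_integral_G[OF t borel_open[OF open_ball]]
      by (intro nn_integral_mono) (auto split: split_indicator intro!: mult_left_mono near)
    finally show "ennreal (1 / 2) \<le> (\<integral>\<^sup>+ x. ennreal (G t x) * indicator (ball 0 r) x \<partial>lborel)" .
  qed
qed

text \<open>\<open>G\<close> averages \<open>p\<close> over operational time, and \<open>p\<close>
  is at least c for operational times in [S0, S]. These have probability at least q/2 uniformly over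
  t in [a, b]: reaching S0 is least likely at t = a, and overshooting S is most likely at t =
  b.\<close>

lemma G_lower_bound:
  assumes a: "0 < a" and R: "0 < R"
  obtains c where "0 < c" "\<And>t. t \<in> {a..b} \<Longrightarrow> AE x in lborel. norm x \<le> R \<longrightarrow> c \<le> G t x"
proof -
  obtain S0 where S0: "0 < S0" "\<And>S. S0 \<le> S \<Longrightarrow> \<exists>c>0. \<forall>s\<in>{S0..S}. \<forall>x. norm x \<le> R \<longrightarrow> c \<le> p s x"
    using p_lower_bound[OF R] by blast
  define q where "q = prob {\<omega>\<in>space N. D S0 \<omega> \<le> a}"
  have q: "0 < q" unfolding q_def using S0 a by (intro D_le_pos) auto
  have "((\<lambda>s. exp (b - s)) \<longlongrightarrow> 0) at_top" by real_asymp
  then have "\<forall>\<^sub>F s in at_top. exp (b - s) < q / 2"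
    using q by (intro order_tendstoD) auto
  \<comment> \<open>Overshooting S by time t has probability at most exp (b - S), by the exponential
    bound with parameter 1; this S lets it consume only half of q.\<close>
  then obtain S where S: "S0 \<le> S" "exp (b - S) < q / 2"
    by (metis (mono_tags, lifting) eventually_at_top_linorder linorder_linear)
  obtain c where c: "0 < c" "\<And>s x. s \<in> {S0..S} \<Longrightarrow> norm x \<le> R \<Longrightarrow> c \<le> p s x"
    using S0(2)[OF S(1)] by blast
  show thesis
  proof (rule that)
    show "0 < q / 2 * c" using q c by simp
    fix t assume t: "t \<in> {a..b}"
    then have t0: "0 < t" using a by simp
    have S': "0 \<le> S0" "0 \<le> S" using S S0 by auto
    note [measurable] = D_measurable[OF S'(1)] D_measurable[OF S'(2)]
    have "q \<le> prob {\<omega>\<in>space N. D S0 \<omega> \<le> t}"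
      unfolding q_def using t by (intro finite_measure_mono) auto
    moreover have "prob {\<omega>\<in>space N. D S \<omega> \<le> t} \<le> exp (t - S)"
      using D_le_bound[OF S'(2), of 1 t] by simp
    moreover have "exp (t - S) \<le> exp (b - S)" using t by simp
    ultimately have "ennreal (q / 2) \<le> ennreal (prob {\<omega>\<in>space N. D S0 \<omega> \<le> t} - prob {\<omega>\<in>space N. D S \<omega> \<le> t})"
      using S by (intro ennreal_leI) linarith
    also have "\<dots> \<le> (\<integral>\<^sup>+ s. ennreal (f t s) * indicator {S0..S} s \<partial>lborel)"
      using nn_integral_f_Icc[OF t0 S'(1) S(1)] .
    finally have f: "ennreal (q / 2) \<le> (\<integral>\<^sup>+ s. ennreal (f t s) * indicator {S0..S} s \<partial>lborel)" .
    show "AE x in lborel. norm x \<le> R \<longrightarrow> q / 2 * c \<le> G t x"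
      using G_eq_nn_integral[OF t0]
    proof eventually_elim
      case (elim x)
      show ?case
      proof
        assume x: "norm x \<le> R"
        have "ennreal (q / 2 * c) = ennreal (q / 2) * ennreal c"
          using q c by (intro ennreal_mult) auto
        also have "\<dots> \<le> (\<integral>\<^sup>+ s. ennreal (f t s) * indicator {S0..S} s \<partial>lborel) * ennreal c"
          by (rule mult_right_mono[OF f]) simp
        also have "\<dots> = (\<integral>\<^sup>+ s. ennreal (f t s) * indicator {S0..S} s * ennreal c \<partial>lborel)"
          using f_measurable[OF t0] by (intro nn_integral_multc[symmetric]) simp
        also have "\<dots> \<le> (\<integral>\<^sup>+ s. ennreal (g t s x) \<partial>lborel)"
        proof (rule nn_integral_mono)
          fix s
          show "ennreal (f t s) * indicator {S0..S} s * ennreal c \<le> ennreal (g t s x)"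
          proof (cases "s \<in> {S0..S}")
            case True
            then have "f t s * c \<le> g t s x"
              using mult_left_mono[OF c(2)[OF True x] f_nonneg[OF t0]] S0 by (simp add: g_def mult.commute)
            then show ?thesis
              using True c t0 by (simp add: ennreal_mult[symmetric] f_nonneg ennreal_leI)
          qed simp
        qed
        finally show "q / 2 * c \<le> G t x"
          unfolding elim[symmetric] using t0 by (simp add: G_nonneg)
      qed
    qed
  qed
qed

end

section \<open>Independence of past and future noise\<close>

lemma (in prob_space) expectation_square_le:
  fixes Y :: "'a \<Rightarrow> real"
  assumes "integrable M Y" "integrable M (\<lambda>\<omega>. (Y \<omega>)\<^sup>2)"
  shows "(expectation Y)\<^sup>2 \<le> expectation (\<lambda>\<omega>. (Y \<omega>)\<^sup>2)"
  using variance_eq[OF assms] variance_positive[of Y] by simp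

lemma (in prob_space) gaussian_square_integrable:
  assumes "gaussian_rv M Z"
  shows "integrable M (\<lambda>\<omega>. (Z \<omega>)\<^sup>2)"
proof -
  have [measurable]: "Z \<in> borel_measurable M" using assms by (simp add: gaussian_rv_def)
  consider m where "AE \<omega> in M. Z \<omega> = m"
    | m s where "0 < s" "distributed M lborel Z (\<lambda>z. ennreal (normal_density m s z))"
    using assms by (auto simp: gaussian_rv_def)
  then show ?thesis
  proof cases
    case 1
    then have "integrable M (\<lambda>\<omega>. (Z \<omega>)\<^sup>2) \<longleftrightarrow> integrable M (\<lambda>_. m\<^sup>2)"
      by (intro integrable_cong_AE) (auto elim!: eventually_mono)
    then show ?thesis by simp
  next
    case 2
    \<comment> \<open>The second moment is decomposed as x^2 = (x - m)^2 + 2 m x - m^2, three terms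
      whose integrability is known.\<close>
    have "integrable lborel (\<lambda>x. normal_density m s x * (x - m)\<^sup>2 + 2 * m * (normal_density m s x * x) - m\<^sup>2 * normal_density m s x)"
      using 2(1) by (intro Bochner_Integration.integrable_add Bochner_Integration.integrable_diff integrable_mult_right
        integrable_normal_moment integrable_normal_moment_nz_1 integrable_normal_density)
    then have "integrable lborel (\<lambda>x. normal_density m s x * x\<^sup>2)"
      by (rule Bochner_Integration.integrable_cong[THEN iffD1, rotated -1]) (auto simp: power2_eq_square algebra_simps)
    then show ?thesis
      by (subst (asm) distributed_integrable[OF 2(2)]) (auto simp: normal_density_nonneg)
  qed
qed

lemma (in prob_space) square_integrable_imp_integrable:
  fixes Z :: "'a \<Rightarrow> real"
  assumes [measurable]: "Z \<in> borel_measurable M" and "integrable M (\<lambda>\<omega>. (Z \<omega>)\<^sup>2)"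
  shows "integrable M Z"
proof (rule Bochner_Integration.integrable_bound)
  show "integrable M (\<lambda>\<omega>. 1 + (Z \<omega>)\<^sup>2)" using assms by simp
  have "\<bar>z\<bar> \<le> \<bar>1 + z\<^sup>2\<bar>" for z :: real
    using zero_le_power2[of "\<bar>z\<bar> - 1"] by (simp add: power2_eq_square algebra_simps abs_if split: if_splits)
  then show "AE \<omega> in M. norm (Z \<omega>) \<le> norm (1 + (Z \<omega>)\<^sup>2)" by simp
qed simp

lemma square_integrable_mult:
  fixes Y Z :: "'w \<Rightarrow> real"
  assumes [measurable]: "Y \<in> borel_measurable M" "Z \<in> borel_measurable M"
    and i: "integrable M (\<lambda>\<omega>. (Y \<omega>)\<^sup>2)" "integrable M (\<lambda>\<omega>. (Z \<omega>)\<^sup>2)"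
  shows "integrable M (\<lambda>\<omega>. Y \<omega> * Z \<omega>)"
proof (rule Bochner_Integration.integrable_bound)
  show "integrable M (\<lambda>\<omega>. (Y \<omega>)\<^sup>2 + (Z \<omega>)\<^sup>2)" using i by simp
  have "\<bar>y * z\<bar> \<le> \<bar>y\<^sup>2 + z\<^sup>2\<bar>" for y z :: real
    using zero_le_power2[of "\<bar>y\<bar> - \<bar>z\<bar>"] zero_le_power2[of y] zero_le_power2[of z]
    unfolding power2_diff abs_mult power2_abs by linarith
  then show "AE \<omega> in M. norm (Y \<omega> * Z \<omega>) \<le> norm ((Y \<omega>)\<^sup>2 + (Z \<omega>)\<^sup>2)" by simp
qed simp

lemma (in prob_space) gaussian_char:
  assumes Z: "gaussian_rv M Z" and 0: "expectation Z = 0"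
  shows "(LINT \<omega>|M. iexp (Z \<omega>)) = complex_of_real (exp (- expectation (\<lambda>\<omega>. (Z \<omega>)\<^sup>2) / 2))"
proof -
  have [measurable]: "Z \<in> borel_measurable M" using Z by (simp add: gaussian_rv_def)
  consider m where "AE \<omega> in M. Z \<omega> = m"
    | m s where "0 < s" "distributed M lborel Z (\<lambda>z. ennreal (normal_density m s z))"
    using Z by (auto simp: gaussian_rv_def)
  then show ?thesis
  proof cases
    case 1
    then have "expectation Z = expectation (\<lambda>_. m)"
      by (rule integral_cong_AE[rotated -1]) simp_all
    then have "AE \<omega> in M. Z \<omega> = 0" using 0 1 by (simp add: prob_space)
    then have AE: "AE \<omega> in M. iexp (Z \<omega>) = 1" "AE \<omega> in M. (Z \<omega>)\<^sup>2 = 0"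
      by (auto elim!: eventually_mono)
    have "(LINT \<omega>|M. iexp (Z \<omega>)) = (LINT \<omega>|M. 1)"
      using AE(1) by (rule integral_cong_AE[rotated -1]) simp_all
    moreover have "expectation (\<lambda>\<omega>. (Z \<omega>)\<^sup>2) = expectation (\<lambda>_. 0)"
      using AE(2) by (rule integral_cong_AE[rotated -1]) simp_all
    ultimately show ?thesis by (simp add: prob_space)
  next
    case 2
    have m: "m = 0" using normal_distributed_expectation[OF 2] 0 by simp
    have v: "expectation (\<lambda>\<omega>. (Z \<omega>)\<^sup>2) = s\<^sup>2" using normal_distributed_variance[OF 2] 0 by simp
    have d: "distributed M lborel (\<lambda>\<omega>. (Z \<omega> - m) / s) std_normal_density"
      using normal_standard_normal_convert[OF 2(1), of Z m] 2(2) by simp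
    have "char std_normal_distribution s = char (distr M lborel (\<lambda>\<omega>. (Z \<omega> - m) / s)) s"
      using d by (simp add: distributed_def)
    also have "\<dots> = (LINT \<omega>|M. iexp (s * ((Z \<omega> - m) / s)))"
      unfolding char_def by (subst integral_distr) auto
    also have "\<dots> = (LINT \<omega>|M. iexp (Z \<omega>))"
      using 2(1) by (simp add: m)
    finally have "(LINT \<omega>|M. iexp (Z \<omega>)) = char std_normal_distribution s" ..
    then show ?thesis
      by (simp only: v char_std_normal_distribution)
  qed
qed

text \<open>
  After adding a constant, \<open>h\<close> becomes the density of a probability measure, so the uniqueness
  theorem for characteristic functions applies to signed weights.
\<close>

lemma (in prob_space) weighted_char_unique:
  fixes h X :: "'a \<Rightarrow> real"
  assumes [measurable]: "h \<in> borel_measurable M" "X \<in> borel_measurable M" "B \<in> sets borel"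
    and bnd: "\<And>\<omega>. \<omega> \<in> space M \<Longrightarrow> \<bar>h \<omega>\<bar> \<le> C"
    and 0: "\<And>\<xi>. (LINT \<omega>|M. complex_of_real (h \<omega>) * iexp (\<xi> * X \<omega>)) = 0"
  shows "(LINT \<omega>|M. h \<omega> * indicator B (X \<omega>)) = 0"
proof -
  \<comment> \<open>At least C, so that 1 + h/c is nonnegative, and at least 1, so that the division
    is safe. The hypothesis at \<xi> = 0 says that h has mean 0, which makes this weight a
    probability density.\<close>
  define c where "c = max 1 C"
  have c: "0 < c" "\<And>\<omega>. \<omega> \<in> space M \<Longrightarrow> \<bar>h \<omega>\<bar> \<le> c"
    using bnd by (force simp: c_def)+
  define k where "k \<omega> = 1 + h \<omega> / c" for \<omega>
  have [measurable]: "k \<in> borel_measurable M" unfolding k_def by measurable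
  have k0: "0 \<le> k \<omega>" if "\<omega> \<in> space M" for \<omega>
    using c(1) c(2)[OF that] by (auto simp: k_def field_simps abs_le_iff)
  have kAE: "AE \<omega> in M. 0 \<le> k \<omega>" using k0 by (intro AE_I2)
  have hi: "integrable M h"
    using c by (intro integrable_const_bound[where B=c]) (auto intro: AE_I2)
  have ki: "integrable M k" unfolding k_def using hi by simp
  have "complex_of_real (expectation h) = 0"
    using 0[of 0] by (simp add: integral_complex_of_real)
  then have h0: "expectation h = 0" by simp
  have k1: "expectation k = 1"
    unfolding k_def using hi by (simp add: prob_space h0)
  have emk: "emeasure (density M (\<lambda>\<omega>. ennreal (k \<omega>))) (space M) = 1"
    using k1 kAE by (simp add: emeasure_density nn_integral_eq_integral[OF ki] cong: nn_integral_cong)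
  interpret K: prob_space "density M (\<lambda>\<omega>. ennreal (k \<omega>))"
    by (rule prob_spaceI) (simp add: emk)
  define \<mu> where "\<mu> = distr (density M (\<lambda>\<omega>. ennreal (k \<omega>))) borel X"
  have 1: "real_distribution \<mu>"
    unfolding \<mu>_def by (rule K.real_distribution_distr) simp
  have 2: "real_distribution (distr M borel X)"
    by (rule real_distribution_distr) simp
  have "char \<mu> = char (distr M borel X)"
  proof
    fix \<xi>
    have i: "integrable M (\<lambda>\<omega>. iexp (\<xi> * X \<omega>))"
      by (rule integrable_iexp) auto
    have ih: "integrable M (\<lambda>\<omega>. complex_of_real (h \<omega>) * iexp (\<xi> * X \<omega>))"
      using c by (intro integrable_const_bound[where B=c]) (auto simp: norm_mult intro: AE_I2)
    have "char \<mu> \<xi> = (LINT \<omega>|M. k \<omega> *\<^sub>R iexp (\<xi> * X \<omega>))"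
      unfolding \<mu>_def char_def using kAE by (subst integral_distr) (auto simp: integral_density)
    also have "\<dots> = (LINT \<omega>|M. iexp (\<xi> * X \<omega>) + complex_of_real (1 / c) * (complex_of_real (h \<omega>) * iexp (\<xi> * X \<omega>)))"
      using c by (intro Bochner_Integration.integral_cong) (auto simp: k_def scaleR_conv_of_real field_simps)
    also have "\<dots> = (LINT \<omega>|M. iexp (\<xi> * X \<omega>)) + complex_of_real (1 / c) * (LINT \<omega>|M. complex_of_real (h \<omega>) * iexp (\<xi> * X \<omega>))"
      by (simp only: Bochner_Integration.integral_add[OF i integrable_mult_right[OF ih]] integral_mult_right_zero)
    also have "\<dots> = char (distr M borel X) \<xi>"
      unfolding 0 char_def by (subst integral_distr) auto
    finally show "char \<mu> \<xi> = char (distr M borel X) \<xi>" .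
  qed
  then have eq: "\<mu> = distr M borel X" by (rule Levy_uniqueness[OF 1 2])
  have Bi: "integrable M (\<lambda>\<omega>. indicator B (X \<omega>) :: real)"
    by (intro integrable_const_bound[where B=1]) auto
  have hBi: "integrable M (\<lambda>\<omega>. h \<omega> * indicator B (X \<omega>))"
    using c by (intro integrable_const_bound[where B=c]) (auto split: split_indicator intro: AE_I2)
  have "(LINT \<omega>|M. indicator B (X \<omega>)) = (LINT x|distr M borel X. indicator B x :: real)"
    by (subst integral_distr) auto
  also have "\<dots> = (LINT x|\<mu>. indicator B x)" by (simp only: eq)
  also have "\<dots> = (LINT \<omega>|M. k \<omega> *\<^sub>R indicator B (X \<omega>))"
    unfolding \<mu>_def using kAE by (subst integral_distr) (auto simp: integral_density)
  also have "\<dots> = (LINT \<omega>|M. indicator B (X \<omega>) + (1 / c) * (h \<omega> * indicator B (X \<omega>)))"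
    by (intro Bochner_Integration.integral_cong) (auto simp: k_def algebra_simps)
  also have "\<dots> = (LINT \<omega>|M. indicator B (X \<omega>)) + (1 / c) * (LINT \<omega>|M. h \<omega> * indicator B (X \<omega>))"
    by (simp only: Bochner_Integration.integral_add[OF Bi integrable_mult_right[OF hBi]] integral_mult_right_zero)
  finally show ?thesis using c by simp
qed

text \<open>Conjugating the hypothesis at - \<xi> gives the same hypothesis for \<open>cnj\<close>
  of H. Real and imaginary part are combinations of H and its conjugate, so the real version applies
  to each.\<close>

lemma (in prob_space) weighted_char_unique_complex:
  fixes H :: "'a \<Rightarrow> complex" and X :: "'a \<Rightarrow> real"
  assumes H[measurable]: "H \<in> borel_measurable M" and [measurable]: "X \<in> borel_measurable M" "B \<in> sets borel"
    and bnd: "\<And>\<omega>. \<omega> \<in> space M \<Longrightarrow> norm (H \<omega>) \<le> C"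
    and 0: "\<And>\<xi>. (LINT \<omega>|M. H \<omega> * iexp (\<xi> * X \<omega>)) = 0"
  shows "(LINT \<omega>|M. H \<omega> * indicator B (X \<omega>)) = 0"
proof -
  have i: "integrable M (\<lambda>\<omega>. H \<omega> * iexp (\<xi> * X \<omega>))" for \<xi>
    using bnd by (intro integrable_const_bound[where B=C]) (auto simp: norm_mult intro: AE_I2)
  have "0 \<le> C" using bnd not_empty norm_ge_zero order_trans by blast
  then have iB: "integrable M (\<lambda>\<omega>. H \<omega> * indicator B (X \<omega>))"
    using bnd by (intro integrable_const_bound[where B=C]) (auto intro: AE_I2 split: split_indicator)
  have cnj_eq: "cnj (H \<omega> * iexp (- \<xi> * X \<omega>)) = cnj (H \<omega>) * iexp (\<xi> * X \<omega>)" for \<omega> \<xi>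
    by (simp add: exp_cnj)
  have ic: "integrable M (\<lambda>\<omega>. cnj (H \<omega>) * iexp (\<xi> * X \<omega>))" for \<xi>
    using integrable_cnj[OF i[of "- \<xi>"]] by (simp only: cnj_eq)
  have zero': "(LINT \<omega>|M. cnj (H \<omega>) * iexp (\<xi> * X \<omega>)) = 0" for \<xi>
  proof -
    have "(LINT \<omega>|M. cnj (H \<omega>) * iexp (\<xi> * X \<omega>)) = cnj (LINT \<omega>|M. H \<omega> * iexp (- \<xi> * X \<omega>))"
      by (simp only: cnj_eq[symmetric] Bochner_Integration.integral_cnj)
    then show ?thesis by (simp only: 0 complex_cnj_zero)
  qed
  have re: "complex_of_real (Re z) = (1 / 2) * z + (1 / 2) * cnj z" for z
    by (simp add: complex_eq_iff)
  have im: "complex_of_real (Im z) = (- \<i> / 2) * z + (\<i> / 2) * cnj z" for z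
    by (simp add: complex_eq_iff)
  have "(LINT \<omega>|M. Re (H \<omega>) * indicator B (X \<omega>)) = 0"
  proof (rule weighted_char_unique)
    show "\<bar>Re (H \<omega>)\<bar> \<le> C" if "\<omega> \<in> space M" for \<omega>
      using bnd[OF that] abs_Re_le_cmod order_trans by blast
    show "(LINT \<omega>|M. complex_of_real (Re (H \<omega>)) * iexp (\<xi> * X \<omega>)) = 0" for \<xi>
      unfolding re distrib_right mult.assoc
      by (simp only: Bochner_Integration.integral_add[OF integrable_mult_right[OF i] integrable_mult_right[OF ic]]
        integral_mult_right_zero 0 zero' mult_zero_right add_0)
  qed auto
  moreover have "(LINT \<omega>|M. Im (H \<omega>) * indicator B (X \<omega>)) = 0"
  proof (rule weighted_char_unique)
    show "\<bar>Im (H \<omega>)\<bar> \<le> C" if "\<omega> \<in> space M" for \<omega>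
      using bnd[OF that] abs_Im_le_cmod order_trans by blast
    show "(LINT \<omega>|M. complex_of_real (Im (H \<omega>)) * iexp (\<xi> * X \<omega>)) = 0" for \<xi>
      unfolding im distrib_right mult.assoc
      by (simp only: Bochner_Integration.integral_add[OF integrable_mult_right[OF i] integrable_mult_right[OF ic]]
        integral_mult_right_zero 0 zero' mult_zero_right add_0)
  qed auto
  moreover have "Re (H \<omega> * indicator B (X \<omega>)) = Re (H \<omega>) * indicator B (X \<omega>)"
    "Im (H \<omega> * indicator B (X \<omega>)) = Im (H \<omega>) * indicator B (X \<omega>)" for \<omega>
    by (auto split: split_indicator)
  ultimately show ?thesis
    by (simp add: complex_eq_iff integral_Re[OF iB, symmetric] integral_Im[OF iB, symmetric])
qed

section \<open>Linear spans of the noise and their Gaussian law\<close>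

locale white_noise =
  fixes M :: "'w measure" and W :: "(real \<times> 'a::euclidean_space) set \<Rightarrow> 'w \<Rightarrow> real"
  assumes white_noise: "space_time_white_noise M W"

sublocale white_noise \<subseteq> prob_space M
  using white_noise by (simp add: space_time_white_noise_def)

context white_noise
begin

text \<open>Joint Gaussianity of the noise is assumed in the form that every finite combination is
  Gaussian; the span is the class on which characteristic functions can be computed.\<close>

definition linear_span :: "(real \<times> 'a) set set \<Rightarrow> ('w \<Rightarrow> real) set" where
  "linear_span S = {Z. \<exists>J c. finite J \<and> J \<subseteq> S \<and> Z = (\<lambda>\<omega>. \<Sum>A\<in>J. c A * W A \<omega>)}"

lemma linear_span_mono: "S \<subseteq> T \<Longrightarrow> linear_span S \<subseteq> linear_span T"
  unfolding linear_span_def by blast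

lemma linear_span_base: "A \<in> S \<Longrightarrow> W A \<in> linear_span S"
  unfolding linear_span_def by (intro CollectI exI[of _ "{A}"] exI[of _ "\<lambda>_. 1"]) auto

lemma linear_span_zero: "(\<lambda>_. 0) \<in> linear_span S"
  unfolding linear_span_def by (intro CollectI exI[of _ "{}"]) auto

lemma linear_span_add_scaled:
  assumes "Y \<in> linear_span S" "Z \<in> linear_span S"
  shows "(\<lambda>\<omega>. Y \<omega> + c * Z \<omega>) \<in> linear_span S"
proof -
  obtain I a where Y: "finite I" "I \<subseteq> S" "Y = (\<lambda>\<omega>. \<Sum>A\<in>I. a A * W A \<omega>)"
    using assms(1) by (auto simp: linear_span_def)
  obtain J b where Z: "finite J" "J \<subseteq> S" "Z = (\<lambda>\<omega>. \<Sum>A\<in>J. b A * W A \<omega>)"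
    using assms(2) by (auto simp: linear_span_def)
  define d where "d A = (if A \<in> I then a A else 0) + c * (if A \<in> J then b A else 0)" for A
  have "(\<Sum>A\<in>I. a A * W A \<omega>) = (\<Sum>A\<in>I \<union> J. (if A \<in> I then a A else 0) * W A \<omega>)" for \<omega>
    using Y(1) Z(1) by (intro sum.mono_neutral_cong_left) auto
  moreover have "(\<Sum>A\<in>J. b A * W A \<omega>) = (\<Sum>A\<in>I \<union> J. (if A \<in> J then b A else 0) * W A \<omega>)" for \<omega>
    using Y(1) Z(1) by (intro sum.mono_neutral_cong_left) auto
  ultimately have "(\<lambda>\<omega>. Y \<omega> + c * Z \<omega>) = (\<lambda>\<omega>. \<Sum>A\<in>I \<union> J. d A * W A \<omega>)"
    by (simp add: Y(3) Z(3) d_def sum_distrib_left distrib_right sum.distrib mult.assoc)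
  then show ?thesis
    unfolding linear_span_def using Y Z by (intro CollectI exI[of _ "I \<union> J"] exI[of _ d]) auto
qed

lemma linear_span_add: "Y \<in> linear_span S \<Longrightarrow> Z \<in> linear_span S \<Longrightarrow> (\<lambda>\<omega>. Y \<omega> + Z \<omega>) \<in> linear_span S"
  using linear_span_add_scaled[of Y S Z 1] by simp

lemma linear_span_scale: "Z \<in> linear_span S \<Longrightarrow> (\<lambda>\<omega>. c * Z \<omega>) \<in> linear_span S"
  using linear_span_add_scaled[OF linear_span_zero, of Z S c] by simp

lemma linear_span_gaussian: "Z \<in> linear_span noise_sets \<Longrightarrow> gaussian_rv M Z"
  using white_noise[unfolded space_time_white_noise_def, THEN conjunct2, THEN conjunct1]
  by (auto simp: linear_span_def)

lemma linear_span_measurable: "Z \<in> linear_span noise_sets \<Longrightarrow> Z \<in> borel_measurable M"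
  using linear_span_gaussian[of Z] unfolding gaussian_rv_def by blast

lemma linear_span_square_integrable: "Z \<in> linear_span noise_sets \<Longrightarrow> integrable M (\<lambda>\<omega>. (Z \<omega>)\<^sup>2)"
  by (rule gaussian_square_integrable[OF linear_span_gaussian])

lemma linear_span_integrable: "Z \<in> linear_span noise_sets \<Longrightarrow> integrable M Z"
  by (rule square_integrable_imp_integrable[OF linear_span_measurable linear_span_square_integrable])

lemma linear_span_mult_integrable:
  "Y \<in> linear_span noise_sets \<Longrightarrow> Z \<in> linear_span noise_sets \<Longrightarrow> integrable M (\<lambda>\<omega>. Y \<omega> * Z \<omega>)"
  by (rule square_integrable_mult[OF linear_span_measurable linear_span_measurable
    linear_span_square_integrable linear_span_square_integrable])

lemmas W_in_span = linear_span_base[of _ noise_sets]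
lemmas W_measurable = linear_span_measurable[OF W_in_span]

lemma W_mean: "A \<in> noise_sets \<Longrightarrow> expectation (W A) = 0"
  by (rule white_noise[unfolded space_time_white_noise_def, THEN conjunct2, THEN conjunct2, THEN conjunct1, rule_format])

lemma W_covariance:
  "A \<in> noise_sets \<Longrightarrow> B \<in> noise_sets \<Longrightarrow> expectation (\<lambda>\<omega>. W A \<omega> * W B \<omega>) = measure lborel (A \<inter> B)"
  by (rule white_noise[unfolded space_time_white_noise_def, THEN conjunct2, THEN conjunct2, THEN conjunct2, rule_format])

lemma linear_span_mean:
  assumes "Z \<in> linear_span noise_sets"
  shows "expectation Z = 0"
proof -
  obtain J c where J: "finite J" "J \<subseteq> noise_sets" "Z = (\<lambda>\<omega>. \<Sum>A\<in>J. c A * W A \<omega>)"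
    using assms by (auto simp: linear_span_def)
  have "expectation Z = (\<Sum>A\<in>J. expectation (\<lambda>\<omega>. c A * W A \<omega>))"
    unfolding J(3) using J by (intro Bochner_Integration.integral_sum integrable_mult_right linear_span_integrable W_in_span) auto
  also have "\<dots> = 0"
    using J by (intro sum.neutral) (auto simp: W_mean)
  finally show ?thesis .
qed

lemma linear_span_orthogonal:
  assumes Y: "Y \<in> linear_span S" and Z: "Z \<in> linear_span T" and ST: "S \<subseteq> noise_sets" "T \<subseteq> noise_sets"
    and disj: "\<And>A B. A \<in> S \<Longrightarrow> B \<in> T \<Longrightarrow> A \<inter> B = {}"
  shows "expectation (\<lambda>\<omega>. Y \<omega> * Z \<omega>) = 0"
proof -
  obtain I a where I: "finite I" "I \<subseteq> S" "Y = (\<lambda>\<omega>. \<Sum>A\<in>I. a A * W A \<omega>)"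
    using Y by (auto simp: linear_span_def)
  obtain J b where J: "finite J" "J \<subseteq> T" "Z = (\<lambda>\<omega>. \<Sum>A\<in>J. b A * W A \<omega>)"
    using Z by (auto simp: linear_span_def)
  have i: "integrable M (\<lambda>\<omega>. a A * b B * (W A \<omega> * W B \<omega>))" if "A \<in> I" "B \<in> J" for A B
    using that I J ST by (intro integrable_mult_right linear_span_mult_integrable W_in_span) auto
  have "expectation (\<lambda>\<omega>. Y \<omega> * Z \<omega>) = expectation (\<lambda>\<omega>. \<Sum>A\<in>I. \<Sum>B\<in>J. a A * b B * (W A \<omega> * W B \<omega>))"
    by (simp add: I(3) J(3) sum_product mult_ac)
  also have "\<dots> = (\<Sum>A\<in>I. \<Sum>B\<in>J. expectation (\<lambda>\<omega>. a A * b B * (W A \<omega> * W B \<omega>)))"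
    using i by (subst Bochner_Integration.integral_sum, force)
      (intro sum.cong refl Bochner_Integration.integral_sum, auto)
  also have "\<dots> = 0"
  proof (intro sum.neutral ballI)
    fix A B assume "A \<in> I" "B \<in> J"
    then have "A \<in> S" "B \<in> T" using I J by auto
    then have "expectation (\<lambda>\<omega>. W A \<omega> * W B \<omega>) = 0"
      using ST disj by (subst W_covariance) auto
    then show "expectation (\<lambda>\<omega>. a A * b B * (W A \<omega> * W B \<omega>)) = 0" by simp
  qed
  finally show ?thesis .
qed

text \<open>The closed end of the past and the open end of the future match the filtration and the
  intervals {a<..b} of simple processes, and make the two families disjoint.\<close>

definition past :: "real \<Rightarrow> (real \<times> 'a) set set" where
  "past a = {A \<in> noise_sets. A \<subseteq> {0..a} \<times> UNIV}"

definition future :: "real \<Rightarrow> (real \<times> 'a) set set" where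
  "future a = {A \<in> noise_sets. A \<subseteq> {a<..} \<times> UNIV}"

lemma past_future: "past a \<subseteq> noise_sets" "future a \<subseteq> noise_sets"
  "A \<in> past a \<Longrightarrow> B \<in> future a \<Longrightarrow> A \<inter> B = {}"
  by (fastforce simp: past_def future_def)+

lemma span_past_future:
  "Z \<in> linear_span (past a) \<Longrightarrow> Z \<in> linear_span noise_sets"
  "Z \<in> linear_span (future a) \<Longrightarrow> Z \<in> linear_span noise_sets"
  using linear_span_mono[OF past_future(1)] linear_span_mono[OF past_future(2)] by blast+

text \<open>Past and future elements are uncorrelated because the underlying sets are disjoint.
  Their sum is again a centred Gaussian, with the sum of the variances, so its characteristic
  function factors.\<close>

lemma iexp_past_future:
  assumes Z: "Z \<in> linear_span (past a)" and Y: "Y \<in> linear_span (future a)"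
  shows "(LINT \<omega>|M. iexp (Z \<omega>) * (iexp (Y \<omega>) - (LINT \<omega>|M. iexp (Y \<omega>)))) = 0"
proof -
  note Z' = span_past_future(1)[OF Z] and Y' = span_past_future(2)[OF Y]
  note ZY = linear_span_add[OF Z' Y']
  note [measurable] = linear_span_measurable[OF Z'] linear_span_measurable[OF Y']
  note i = linear_span_square_integrable[OF Z'] linear_span_square_integrable[OF Y'] linear_span_mult_integrable[OF Z' Y']
  have "expectation (\<lambda>\<omega>. (Z \<omega> + Y \<omega>)\<^sup>2) = expectation (\<lambda>\<omega>. (Z \<omega>)\<^sup>2 + (Y \<omega>)\<^sup>2 + 2 * (Z \<omega> * Y \<omega>))"
    by (intro Bochner_Integration.integral_cong) (auto simp: power2_sum)
  also have "\<dots> = expectation (\<lambda>\<omega>. (Z \<omega>)\<^sup>2) + expectation (\<lambda>\<omega>. (Y \<omega>)\<^sup>2)"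
    using i linear_span_orthogonal[OF Z Y past_future] by simp
  finally have v: "expectation (\<lambda>\<omega>. (Z \<omega> + Y \<omega>)\<^sup>2) = expectation (\<lambda>\<omega>. (Z \<omega>)\<^sup>2) + expectation (\<lambda>\<omega>. (Y \<omega>)\<^sup>2)" .
  note char = gaussian_char[OF linear_span_gaussian linear_span_mean]
  have prod: "(LINT \<omega>|M. iexp (Z \<omega> + Y \<omega>)) = (LINT \<omega>|M. iexp (Z \<omega>)) * (LINT \<omega>|M. iexp (Y \<omega>))"
    unfolding char[OF ZY ZY] char[OF Z' Z'] char[OF Y' Y'] v
    by (simp only: minus_add_distrib add_divide_distrib exp_add of_real_mult)
  have i1: "integrable M (\<lambda>\<omega>. iexp (Z \<omega> + Y \<omega>))" and i2: "integrable M (\<lambda>\<omega>. iexp (Z \<omega>))"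
    by (rule integrable_iexp; simp)+
  have "iexp (Z \<omega>) * (iexp (Y \<omega>) - c) = iexp (Z \<omega> + Y \<omega>) - iexp (Z \<omega>) * c" for \<omega> c
    by (simp only: right_diff_distrib of_real_add distrib_left exp_add)
  then show ?thesis
    by (simp only: Bochner_Integration.integral_diff[OF i1 integrable_mult_left[OF i2]] prod
      integral_mult_left_zero diff_self)
qed

text \<open>Converts characters of the past into indicator functions one variable at a time. The
  free factor \<open>iexp (Z \<omega>)\<close> keeps the induction going: the test character of the
  next variable is absorbed into Z, and uniqueness of weighted characteristic functions then trades
  it for an indicator.\<close>

lemma cylinder_past_future:
  assumes Y: "Y \<in> linear_span (future a)"
    and J: "finite J" "J \<subseteq> past a" and B: "\<And>A. A \<in> J \<Longrightarrow> B A \<in> sets borel"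
    and Z: "Z \<in> linear_span (past a)"
  shows "(LINT \<omega>|M. (\<Prod>A\<in>J. indicator (B A) (W A \<omega>)) * iexp (Z \<omega>) * (iexp (Y \<omega>) - (LINT \<omega>|M. iexp (Y \<omega>)))) = 0"
  using J B Z
proof (induction J arbitrary: Z rule: finite_induct)
  case empty
  then show ?case using iexp_past_future[OF _ Y] by simp
next
  case (insert A J)
  define c where "c = (LINT \<omega>|M. iexp (Y \<omega>))"
  have c: "norm c \<le> 1"
  proof -
    have "norm c \<le> (LINT \<omega>|M. norm (iexp (Y \<omega>)))"
      unfolding c_def by (rule integral_norm_bound)
    then show ?thesis by (simp add: prob_space)
  qed
  let ?H = "\<lambda>\<omega>. (\<Prod>A\<in>J. indicator (B A) (W A \<omega>)) * iexp (Z \<omega>) * (iexp (Y \<omega>) - c) :: complex"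
  have A: "A \<in> past a" "B A \<in> sets borel" using insert.prems by auto
  have J: "A' \<in> J \<Longrightarrow> A' \<in> noise_sets" "A' \<in> J \<Longrightarrow> B A' \<in> sets borel" for A'
    using insert.prems past_future(1) by auto
  note [measurable] = linear_span_measurable[OF span_past_future(2)[OF Y]]
    linear_span_measurable[OF span_past_future(1)[OF insert.prems(3)]]
    W_measurable[OF J(1)] W_measurable[of A] J(2) A(2)
  have AN: "A \<in> noise_sets" using A past_future(1) by auto
  have [measurable]: "?H \<in> borel_measurable M"
    by measurable
  have "(LINT \<omega>|M. ?H \<omega> * indicator (B A) (W A \<omega>)) = 0"
  proof (rule weighted_char_unique_complex)
    fix \<omega> assume "\<omega> \<in> space M"
    have "norm (\<Prod>A\<in>J. indicator (B A) (W A \<omega>) :: complex) \<le> 1"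
      by (subst prod_norm[symmetric], rule prod_le_1) (auto split: split_indicator)
    moreover have "norm (iexp (Y \<omega>) - c) \<le> 1 + 1"
      using c by (intro norm_triangle_le_diff) simp
    ultimately have "norm (?H \<omega>) \<le> 1 * 1 * (1 + 1)"
      unfolding norm_mult by (intro mult_mono) auto
    then show "norm (?H \<omega>) \<le> 2" by simp
  next
    fix \<xi>
    have "(\<lambda>\<omega>. Z \<omega> + \<xi> * W A \<omega>) \<in> linear_span (past a)"
      using insert.prems A by (intro linear_span_add_scaled linear_span_base)
    from insert.IH[OF _ _ this] insert.prems
    have "(LINT \<omega>|M. (\<Prod>A\<in>J. indicator (B A) (W A \<omega>)) * iexp (Z \<omega> + \<xi> * W A \<omega>) * (iexp (Y \<omega>) - c)) = 0"
      by (simp add: c_def)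
    then show "(LINT \<omega>|M. ?H \<omega> * iexp (\<xi> * W A \<omega>)) = 0"
      by (simp add: distrib_left exp_add mult_ac)
  qed (use AN in measurable)
  then show ?case
    using insert.hyps by (simp add: c_def mult_ac)
qed

end

section \<open>The augmented noise filtration and independence from the future\<close>

context white_noise
begin

lemma noise_filtration_generator:
  "{W A -` B \<inter> space M | A B. A \<in> noise_sets \<and> A \<subseteq> {0..a} \<times> UNIV \<and> B \<in> sets borel} \<union> null_sets M \<subseteq> sets M"
  using measurable_sets[OF W_measurable] by auto

lemma space_noise_filtration [simp]: "space (noise_filtration M W a) = space M"
  by (simp add: noise_filtration_def space_measure_of_conv)

lemma sets_noise_filtration:
  "sets (noise_filtration M W a) = sigma_sets (space M)
    ({W A -` B \<inter> space M | A B. A \<in> noise_sets \<and> A \<subseteq> {0..a} \<times> UNIV \<and> B \<in> sets borel} \<union> null_sets M)"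
  unfolding noise_filtration_def
  using order_trans[OF noise_filtration_generator sets.space_closed] by (rule sets_measure_of)

lemma noise_filtration_subalgebra: "subalgebra M (noise_filtration M W a)"
  unfolding subalgebra_def sets_noise_filtration
  using sets.sigma_sets_subset[OF noise_filtration_generator] by simp

lemma noise_filtration_measurable: "X \<in> borel_measurable (noise_filtration M W a) \<Longrightarrow> X \<in> borel_measurable M"
  by (rule measurable_from_subalg[OF noise_filtration_subalgebra])

lemma noise_filtration_mono:
  assumes "a \<le> b" and X: "X \<in> borel_measurable (noise_filtration M W a)"
  shows "X \<in> borel_measurable (noise_filtration M W b)"
proof -
  have "{0..a} \<times> UNIV \<subseteq> {0..b} \<times> (UNIV :: 'a set)" using assms by auto
  then have "subalgebra (noise_filtration M W b) (noise_filtration M W a)"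
    unfolding subalgebra_def sets_noise_filtration by (auto intro!: sigma_sets_mono')
  then show ?thesis using X by (rule measurable_from_subalg)
qed

lemma W_adapted:
  assumes "A \<in> past a"
  shows "W A \<in> borel_measurable (noise_filtration M W a)"
proof (rule measurableI)
  fix B :: "real set" assume "B \<in> sets borel"
  then show "W A -` B \<inter> space (noise_filtration M W a) \<in> sets (noise_filtration M W a)"
    using assms unfolding sets_noise_filtration space_noise_filtration past_def
    by (intro sigma_sets.Basic UnI1) blast
qed simp

text \<open>Finite intersections of the preimages generating the filtration. One Borel set per index
  is enough, since two conditions on the same \<open>W A\<close> merge into one; this gives
  stability under intersection.\<close>

definition cylinders :: "real \<Rightarrow> 'w set set" where
  "cylinders a = {{\<omega>\<in>space M. \<forall>A\<in>J. W A \<omega> \<in> B A} | J B. finite J \<and> J \<subseteq> past a \<and> (\<forall>A\<in>J. B A \<in> sets borel)}"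

lemma cylinder_event:
  assumes "F \<in> cylinders a"
  shows "F \<in> sets M"
proof -
  obtain J B where F: "F = {\<omega>\<in>space M. \<forall>A\<in>J. W A \<omega> \<in> B A}" "finite J" "J \<subseteq> past a" "\<And>A. A \<in> J \<Longrightarrow> B A \<in> sets borel"
    using assms unfolding cylinders_def by blast
  have "{\<omega>\<in>space M. W A \<omega> \<in> B A} \<in> sets M" if "A \<in> J" for A
    using measurable_sets[OF W_measurable F(4)[OF that], of A] that F(3) past_future(1)
    by (auto simp: vimage_def Int_def conj_commute)
  then show ?thesis
    unfolding F(1) using F(2) by (intro sets.sets_Collect_finite_All)
qed

lemma cylinder_Int:
  assumes "F \<in> cylinders a" "F' \<in> cylinders a"
  shows "F \<inter> F' \<in> cylinders a"
proof -
  obtain J B where F: "F = {\<omega>\<in>space M. \<forall>A\<in>J. W A \<omega> \<in> B A}" "finite J" "J \<subseteq> past a" "\<And>A. A \<in> J \<Longrightarrow> B A \<in> sets borel"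
    using assms(1) unfolding cylinders_def by blast
  obtain J' B' where F': "F' = {\<omega>\<in>space M. \<forall>A\<in>J'. W A \<omega> \<in> B' A}" "finite J'" "J' \<subseteq> past a" "\<And>A. A \<in> J' \<Longrightarrow> B' A \<in> sets borel"
    using assms(2) unfolding cylinders_def by blast
  define C where "C A = (if A \<in> J then B A else UNIV) \<inter> (if A \<in> J' then B' A else UNIV)" for A
  have "F \<inter> F' = {\<omega>\<in>space M. \<forall>A\<in>J \<union> J'. W A \<omega> \<in> C A}"
    by (auto simp: F(1) F'(1) C_def)
  moreover have "\<forall>A\<in>J \<union> J'. C A \<in> sets borel"
    using F(4) F'(4) by (auto simp: C_def)
  ultimately show ?thesis
    unfolding cylinders_def using F(2,3) F'(2,3)
    by (intro CollectI exI[of _ "J \<union> J'"] exI[of _ C]) auto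
qed

text \<open>The centred weight \<open>indicator F \<omega> - prob F\<close> integrates to 0 against
  every character of Y, by the preceding factorisation with Z = 0. Hence it integrates to 0 against
  every indicator of Y, which is independence.\<close>

lemma cylinder_independent:
  assumes Y: "Y \<in> linear_span (future a)" and F: "F \<in> cylinders a" and C: "C \<in> sets borel"
  shows "prob (F \<inter> (Y -` C \<inter> space M)) = prob F * prob (Y -` C \<inter> space M)"
proof -
  obtain J B where J: "F = {\<omega>\<in>space M. \<forall>A\<in>J. W A \<omega> \<in> B A}" "finite J" "J \<subseteq> past a" "\<And>A. A \<in> J \<Longrightarrow> B A \<in> sets borel"
    using F unfolding cylinders_def by blast
  have ind: "(\<Prod>A\<in>J. indicator (B A) (W A \<omega>)) = (indicator F \<omega> :: complex)" if \<omega>: "\<omega> \<in> space M" for \<omega>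
  proof (cases "\<omega> \<in> F")
    case False
    then obtain A where "A \<in> J" "W A \<omega> \<notin> B A" using \<omega> J(1) by blast
    then show ?thesis using False J(2) by (auto intro!: prod_zero bexI[of _ A])
  qed (use J in \<open>auto intro!: prod.neutral\<close>)
  have [measurable]: "Y \<in> borel_measurable M" "F \<in> sets M" "C \<in> sets borel"
    using linear_span_measurable[OF span_past_future(2)[OF Y]] cylinder_event[OF F] C by auto
  have i: "integrable M (\<lambda>\<omega>. complex_of_real (indicator F \<omega>) * iexp (\<xi> * Y \<omega>))" for \<xi>
    by (intro integrable_const_bound[where B=1]) (auto simp: norm_mult split: split_indicator)
  have i': "integrable M (\<lambda>\<omega>. complex_of_real (indicator F \<omega>))"
    by (intro integrable_const_bound[where B=1]) (auto split: split_indicator)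
  have i'': "integrable M (\<lambda>\<omega>. iexp (\<xi> * Y \<omega>))" for \<xi>
    by (rule integrable_iexp) auto
  have "(LINT \<omega>|M. (indicator F \<omega> - prob F) * indicator C (Y \<omega>)) = 0"
  proof (rule weighted_char_unique)
    show "\<bar>indicator F \<omega> - prob F\<bar> \<le> 1" for \<omega>
      using prob_le_1[of F] by (auto split: split_indicator)
    fix \<xi>
    let ?c = "LINT \<omega>|M. iexp (\<xi> * Y \<omega>)"
    have "(LINT \<omega>|M. complex_of_real (indicator F \<omega>) * iexp (\<xi> * Y \<omega>)) - (LINT \<omega>|M. complex_of_real (indicator F \<omega>) * ?c) =
        (LINT \<omega>|M. complex_of_real (indicator F \<omega>) * iexp (\<xi> * Y \<omega>) - complex_of_real (indicator F \<omega>) * ?c)"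
      by (rule Bochner_Integration.integral_diff[OF i integrable_mult_left[OF i'], symmetric])
    also have "\<dots> = (LINT \<omega>|M. (\<Prod>A\<in>J. indicator (B A) (W A \<omega>)) * iexp 0 * (iexp (\<xi> * Y \<omega>) - ?c))"
      by (intro Bochner_Integration.integral_cong) (auto simp: ind right_diff_distrib split: split_indicator)
    also have "\<dots> = 0"
      by (rule cylinder_past_future[OF linear_span_scale[OF Y] J(2,3) _ linear_span_zero]) (rule J(4))
    finally have "(LINT \<omega>|M. complex_of_real (indicator F \<omega>) * iexp (\<xi> * Y \<omega>)) = complex_of_real (prob F) * ?c"
      by (simp only: integral_mult_left_zero integral_complex_of_real) simp
    moreover have "(LINT \<omega>|M. complex_of_real (indicator F \<omega> - prob F) * iexp (\<xi> * Y \<omega>)) =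
        (LINT \<omega>|M. complex_of_real (indicator F \<omega>) * iexp (\<xi> * Y \<omega>)) - complex_of_real (prob F) * ?c"
      unfolding of_real_diff left_diff_distrib
      by (simp only: Bochner_Integration.integral_diff[OF i integrable_mult_right[OF i'']] integral_mult_right_zero)
    ultimately show "(LINT \<omega>|M. complex_of_real (indicator F \<omega> - prob F) * iexp (\<xi> * Y \<omega>)) = 0"
      by (simp only: diff_self)
  qed auto
  moreover have "(LINT \<omega>|M. (indicator F \<omega> - prob F) * indicator C (Y \<omega>)) =
      (LINT \<omega>|M. indicator (F \<inter> (Y -` C \<inter> space M)) \<omega> - prob F * indicator (Y -` C \<inter> space M) \<omega>)"
    by (intro Bochner_Integration.integral_cong) (auto split: split_indicator)
  moreover have "\<dots> = prob (F \<inter> (Y -` C \<inter> space M)) - prob F * prob (Y -` C \<inter> space M)"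
    by (subst Bochner_Integration.integral_diff) (auto intro!: integrable_mult_right simp: emeasure_eq_measure)
  ultimately show ?thesis by simp
qed

text \<open>Independence passes from intersection-stable families to the sigma-algebras they
  generate. Null sets join the cylinders because the filtration is augmented by them; they are
  independent of everything.\<close>

lemma future_independent:
  assumes X: "X \<in> borel_measurable (noise_filtration M W a)" and Y: "Y \<in> linear_span (future a)"
  shows "indep_var borel X borel Y"
proof -
  have [measurable]: "Y \<in> borel_measurable M"
    using linear_span_measurable[OF span_past_future(2)[OF Y]] by simp
  let ?G = "cylinders a \<union> null_sets M"
  let ?Y = "{Y -` C \<inter> space M | C. C \<in> sets borel}"
  have "indep_set (sigma_sets (space M) ?G) (sigma_sets (space M) ?Y)"
  proof (rule indep_set_sigma_sets)
    show "indep_set ?G ?Y"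
    proof (rule indep_setI)
      show "?G \<subseteq> events" using cylinder_event by auto
      show "?Y \<subseteq> events" by auto
      fix F H assume "F \<in> ?G" "H \<in> ?Y"
      then show "prob (F \<inter> H) = prob F * prob H"
      proof (elim UnE)
        assume "F \<in> null_sets M"
        moreover have "H \<in> sets M" using \<open>H \<in> ?Y\<close> by auto
        ultimately have "F \<inter> H \<in> null_sets M" by (rule null_set_Int2)
        with \<open>F \<in> null_sets M\<close> show ?thesis by (simp add: measure_eq_0_null_sets)
      qed (use cylinder_independent[OF Y] in auto)
    qed
    show "Int_stable ?G"
      by (rule Int_stableI) (auto intro: cylinder_Int null_set_Int1 null_set_Int2 dest: cylinder_event)
    show "Int_stable ?Y"
    proof (rule Int_stableI)
      fix a b assume "a \<in> ?Y" "b \<in> ?Y"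
      then obtain A B where "a = Y -` A \<inter> space M" "A \<in> sets borel" "b = Y -` B \<inter> space M" "B \<in> sets borel"
        by blast
      then have "a \<inter> b = Y -` (A \<inter> B) \<inter> space M" "A \<inter> B \<in> sets borel" by auto
      then show "a \<inter> b \<in> ?Y" by blast
    qed
  qed
  note indep = this
  have "{W A -` B \<inter> space M | A B. A \<in> noise_sets \<and> A \<subseteq> {0..a} \<times> UNIV \<and> B \<in> sets borel} \<subseteq> cylinders a"
  proof safe
    fix A :: "(real \<times> 'a) set" and B assume "A \<in> noise_sets" "A \<subseteq> {0..a} \<times> UNIV" "B \<in> sets (borel :: real measure)"
    then show "W A -` B \<inter> space M \<in> cylinders a"
      unfolding cylinders_def
      by (intro CollectI exI[of _ "{A}"] exI[of _ "\<lambda>_. B"]) (auto simp: past_def)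
  qed
  then have sub: "sets (noise_filtration M W a) \<subseteq> sigma_sets (space M) ?G"
    unfolding sets_noise_filtration by (intro sigma_sets_mono') blast
  have "{X -` A \<inter> space M | A. A \<in> sets borel} \<subseteq> sets (noise_filtration M W a)"
    using measurable_sets[OF X] by auto
  from sets.sigma_sets_subset[OF this]
  have "sigma_sets (space M) {X -` A \<inter> space M | A. A \<in> sets borel} \<subseteq> sets (noise_filtration M W a)"
    by simp
  with sub have sub': "sigma_sets (space M) {X -` A \<inter> space M | A. A \<in> sets borel} \<subseteq> sigma_sets (space M) ?G"
    by (rule order_trans[rotated])
  have "indep_set (sigma_sets (space M) {X -` A \<inter> space M | A. A \<in> sets borel}) (sigma_sets (space M) ?Y)"
    using indep unfolding indep_set_def
    by (rule indep_sets_mono_sets) (use sub' in \<open>auto split: bool.split\<close>)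
  then show ?thesis
    unfolding indep_var_eq using noise_filtration_measurable[OF X] by simp
qed

lemma future_factorization:
  fixes h :: "real \<Rightarrow> real"
  assumes X: "X \<in> borel_measurable (noise_filtration M W a)" and Y: "Y \<in> linear_span (future a)"
    and h: "h \<in> borel_measurable borel" and Xi: "integrable M X" and hi: "integrable M (\<lambda>\<omega>. h (Y \<omega>))"
  shows "expectation (\<lambda>\<omega>. X \<omega> * h (Y \<omega>)) = expectation X * expectation (\<lambda>\<omega>. h (Y \<omega>))"
    and "integrable M (\<lambda>\<omega>. X \<omega> * h (Y \<omega>))"
proof -
  have i: "indep_var borel X borel (\<lambda>\<omega>. h (Y \<omega>))"
    using indep_var_compose[OF future_independent[OF X Y] measurable_ident h] by (simp add: comp_def id_def)
  show "expectation (\<lambda>\<omega>. X \<omega> * h (Y \<omega>)) = expectation X * expectation (\<lambda>\<omega>. h (Y \<omega>))"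
    by (rule indep_var_lebesgue_integral[OF i Xi hi])
  show "integrable M (\<lambda>\<omega>. X \<omega> * h (Y \<omega>))"
    by (rule indep_var_integrable[OF i Xi hi])
qed

end

section \<open>The Walsh isometry\<close>

lemma integrable_pair_mult:
  fixes f :: "'w \<Rightarrow> real" and g :: "'z \<Rightarrow> real"
  assumes "sigma_finite_measure M" "sigma_finite_measure L" and f: "integrable M f" and g: "integrable L g"
  shows "integrable (M \<Otimes>\<^sub>M L) (\<lambda>z. f (fst z) * g (snd z))"
    and "(LINT z|(M \<Otimes>\<^sub>M L). f (fst z) * g (snd z)) = (LINT x|M. f x) * (LINT y|L. g y)"
proof -
  interpret M: sigma_finite_measure M by fact
  interpret L: sigma_finite_measure L by fact
  interpret P: pair_sigma_finite M L ..
  have [measurable]: "f \<in> borel_measurable M" "g \<in> borel_measurable L"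
    using f g by auto
  show i: "integrable (M \<Otimes>\<^sub>M L) (\<lambda>z. f (fst z) * g (snd z))"
    by (rule P.Fubini_integrable) (use f g in \<open>auto simp: abs_mult\<close>)
  show "(LINT z|(M \<Otimes>\<^sub>M L). f (fst z) * g (snd z)) = (LINT x|M. f x) * (LINT y|L. g y)"
    using P.integral_fst'[OF i] by simp
qed

context white_noise
begin

lemma noise_sets_Un: "A \<in> noise_sets \<Longrightarrow> B \<in> noise_sets \<Longrightarrow> A \<union> B \<in> noise_sets"
  using emeasure_subadditive[of A lborel B]
  by (auto simp: noise_sets_def less_top[symmetric] top_unique)

text \<open>Additivity is not postulated for the noise. The covariance makes the mean square of the
  defect \<open>W (A \<union> B) \<omega> - W A \<omega> - W B \<omega>\<close> vanish, so it holds
  almost surely.\<close>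

lemma W_additive:
  assumes A: "A \<in> noise_sets" and B: "B \<in> noise_sets" and disj: "A \<inter> B = {}"
  shows "AE \<omega> in M. W (A \<union> B) \<omega> = W A \<omega> + W B \<omega>"
proof -
  note AB = noise_sets_Un[OF A B]
  have fin: "emeasure lborel A \<noteq> \<infinity>" "emeasure lborel B \<noteq> \<infinity>" "A \<in> sets lborel" "B \<in> sets lborel"
    using A B by (auto simp: noise_sets_def)
  note i = linear_span_mult_integrable[OF W_in_span W_in_span]
  let ?Z = "\<lambda>\<omega>. (W (A \<union> B) \<omega> - W A \<omega> - W B \<omega>)\<^sup>2"
  have eq: "?Z = (\<lambda>\<omega>. W (A \<union> B) \<omega> * W (A \<union> B) \<omega> + W A \<omega> * W A \<omega> + W B \<omega> * W B \<omega>
      - 2 * (W (A \<union> B) \<omega> * W A \<omega>) - 2 * (W (A \<union> B) \<omega> * W B \<omega>) + 2 * (W A \<omega> * W B \<omega>))"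
    by (auto simp: power2_eq_square algebra_simps)
  have Zi: "integrable M ?Z"
    unfolding eq using A B AB by (intro Bochner_Integration.integrable_add Bochner_Integration.integrable_diff integrable_mult_right i)
  have "expectation ?Z = 0"
    unfolding eq using A B AB fin
    by (simp add: i W_covariance disj Int_absorb1 Int_absorb2 measure_Union Int_commute[of B A])
  then have "AE \<omega> in M. ?Z \<omega> = 0"
    using integral_nonneg_eq_0_iff_AE[OF Zi] by simp
  then show ?thesis by eventually_elim simp
qed

lemma rectangle_noise_sets:
  assumes "0 \<le> a" "A \<in> sets borel" "emeasure lborel A < \<infinity>"
  shows "{a<..b} \<times> A \<in> noise_sets"
proof -
  have "emeasure (lborel \<Otimes>\<^sub>M lborel) ({a<..b} \<times> A) = emeasure lborel {a<..b} * emeasure lborel A"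
    using assms by (intro lborel.emeasure_pair_measure_Times) auto
  moreover have "emeasure lborel {a<..b} < \<infinity>" by (cases "a \<le> b") auto
  ultimately have "emeasure lborel ({a<..b} \<times> A) < \<infinity>"
    using assms by (simp add: lborel_prod ennreal_mult_less_top)
  moreover have "{a<..b} \<times> A \<in> sets borel"
    using assms by (intro borel_Times) auto
  ultimately show ?thesis
    using assms by (auto simp: noise_sets_def)
qed

text \<open>Independence is available for a single element of the future span at a time. The product
  Y Z is reduced to squares of Y + Z, Y and Z by polarisation.\<close>

lemma future_pair:
  assumes X: "X \<in> borel_measurable (noise_filtration M W a)" and Xi: "integrable M X"
    and Y: "Y \<in> linear_span (future a)" and Z: "Z \<in> linear_span (future a)"
  shows "expectation (\<lambda>\<omega>. X \<omega> * (Y \<omega> * Z \<omega>)) = expectation X * expectation (\<lambda>\<omega>. Y \<omega> * Z \<omega>)"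
    and "integrable M (\<lambda>\<omega>. X \<omega> * (Y \<omega> * Z \<omega>))"
proof -
  note YZ = linear_span_add[OF Y Z]
  have sq: "(\<lambda>x::real. x\<^sup>2) \<in> borel_measurable borel" by simp
  note i = linear_span_square_integrable[OF span_past_future(2)]
  note fY = future_factorization[OF X Y sq Xi i[OF Y]]
  note fZ = future_factorization[OF X Z sq Xi i[OF Z]]
  note fYZ = future_factorization[OF X YZ sq Xi i[OF YZ]]
  have eq: "Y \<omega> * Z \<omega> = (1 / 2) * ((Y \<omega> + Z \<omega>)\<^sup>2 - (Y \<omega>)\<^sup>2 - (Z \<omega>)\<^sup>2)" for \<omega>
    by (simp add: power2_eq_square algebra_simps)
  have eq': "X \<omega> * (Y \<omega> * Z \<omega>) = (1 / 2) * (X \<omega> * (Y \<omega> + Z \<omega>)\<^sup>2 - X \<omega> * (Y \<omega>)\<^sup>2 - X \<omega> * (Z \<omega>)\<^sup>2)" for \<omega>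
    unfolding eq by (simp add: algebra_simps)
  show "integrable M (\<lambda>\<omega>. X \<omega> * (Y \<omega> * Z \<omega>))"
    unfolding eq' using fY(2) fZ(2) fYZ(2)
    by (intro integrable_mult_right Bochner_Integration.integrable_diff)
  have "expectation (\<lambda>\<omega>. X \<omega> * (Y \<omega> * Z \<omega>)) =
      (1 / 2) * (expectation (\<lambda>\<omega>. X \<omega> * (Y \<omega> + Z \<omega>)\<^sup>2) - expectation (\<lambda>\<omega>. X \<omega> * (Y \<omega>)\<^sup>2) - expectation (\<lambda>\<omega>. X \<omega> * (Z \<omega>)\<^sup>2))"
    unfolding eq' using fY(2) fZ(2) fYZ(2) by simp
  also have "\<dots> = expectation X * ((1 / 2) * (expectation (\<lambda>\<omega>. (Y \<omega> + Z \<omega>)\<^sup>2) - expectation (\<lambda>\<omega>. (Y \<omega>)\<^sup>2) - expectation (\<lambda>\<omega>. (Z \<omega>)\<^sup>2)))"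
    unfolding fY(1) fZ(1) fYZ(1) by (simp add: algebra_simps)
  also have "\<dots> = expectation X * expectation (\<lambda>\<omega>. Y \<omega> * Z \<omega>)"
    unfolding eq using i[OF Y] i[OF Z] i[OF YZ] by simp
  finally show "expectation (\<lambda>\<omega>. X \<omega> * (Y \<omega> * Z \<omega>)) = expectation X * expectation (\<lambda>\<omega>. Y \<omega> * Z \<omega>)" .
qed

lemma bounded_mult_integrable:
  fixes X Y :: "'w \<Rightarrow> real"
  assumes [measurable]: "X \<in> borel_measurable M" and "\<forall>\<omega>\<in>space M. \<bar>X \<omega>\<bar> \<le> C" and Y: "integrable M Y"
  shows "integrable M (\<lambda>\<omega>. X \<omega> * Y \<omega>)"
proof (rule Bochner_Integration.integrable_bound)
  show "integrable M (\<lambda>\<omega>. C * Y \<omega>)" using Y by simp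
  have [measurable]: "Y \<in> borel_measurable M" using Y by simp
  show "(\<lambda>\<omega>. X \<omega> * Y \<omega>) \<in> borel_measurable M" by measurable
  show "AE \<omega> in M. norm (X \<omega> * Y \<omega>) \<le> norm (C * Y \<omega>)"
  proof (intro AE_I2)
    fix \<omega> assume "\<omega> \<in> space M"
    then have "\<bar>X \<omega>\<bar> \<le> \<bar>C\<bar>" using assms(2) by force
    then show "norm (X \<omega> * Y \<omega>) \<le> norm (C * Y \<omega>)"
      by (simp add: abs_mult mult_right_mono)
  qed
qed

text \<open>The first rectangle is cut at the later starting time a'. The part before a' is known at
  a', so its product with the centred noise on the second rectangle has mean 0. The part after a'
  lies, like the second rectangle, in the future of a', so the weights split off and the covariance
  remains.\<close>

lemma elementary_isometry_ordered:
  assumes X: "X \<in> borel_measurable (noise_filtration M W a)" "\<forall>\<omega>\<in>space M. \<bar>X \<omega>\<bar> \<le> C"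
    and X': "X' \<in> borel_measurable (noise_filtration M W a')" "\<forall>\<omega>\<in>space M. \<bar>X' \<omega>\<bar> \<le> C'"
    and a: "0 \<le> a" "a \<le> a'"
    and A: "A \<in> sets borel" "emeasure lborel A < \<infinity>" and A': "A' \<in> sets borel" "emeasure lborel A' < \<infinity>"
  shows "expectation (\<lambda>\<omega>. (X \<omega> * W ({a<..b} \<times> A) \<omega>) * (X' \<omega> * W ({a'<..b'} \<times> A') \<omega>)) =
      expectation (\<lambda>\<omega>. X \<omega> * X' \<omega>) * measure lborel (({a<..b} \<times> A) \<inter> ({a'<..b'} \<times> A'))" (is ?E)
    and "integrable M (\<lambda>\<omega>. (X \<omega> * W ({a<..b} \<times> A) \<omega>) * (X' \<omega> * W ({a'<..b'} \<times> A') \<omega>))" (is ?I)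
proof -
  \<comment> \<open>The minimum covers the case b < a', in which the first rectangle lies entirely
    before a' and \<open>R2\<close> is empty.\<close>
  define R1 where "R1 = {a<..min b a'} \<times> A"
  define R2 where "R2 = {a'<..b} \<times> A"
  define R' where "R' = {a'<..b'} \<times> A'"
  have R: "{a<..b} \<times> A = R1 \<union> R2" "R1 \<inter> R2 = {}"
    using a by (auto simp: R1_def R2_def)
  have N: "R1 \<in> noise_sets" "R2 \<in> noise_sets" "R' \<in> noise_sets"
    unfolding R1_def R2_def R'_def using a A A' by (auto intro!: rectangle_noise_sets)
  have P: "R1 \<in> past a'" "R2 \<in> future a'" "R' \<in> future a'"
    using N a by (auto simp: past_def future_def R1_def R2_def R'_def)
  note [measurable] = noise_filtration_measurable[OF X(1)] noise_filtration_measurable[OF X'(1)]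
    W_measurable[OF N(1)] W_measurable[OF N(2)] W_measurable[OF N(3)]
    W_measurable[OF noise_sets_Un[OF N(1,2)]]
  have XX: "(\<lambda>\<omega>. X \<omega> * X' \<omega>) \<in> borel_measurable (noise_filtration M W a')"
    using noise_filtration_mono[OF a(2) X(1)] X'(1) by simp
  have X'i: "integrable M X'"
    using bounded_mult_integrable[of X' C' "\<lambda>_. 1"] X' by simp
  have XXi: "integrable M (\<lambda>\<omega>. X \<omega> * X' \<omega>)"
    using X(2) by (rule bounded_mult_integrable[OF _ _ X'i, rotated]) simp
  have p1: "(\<lambda>\<omega>. X \<omega> * X' \<omega> * W R1 \<omega>) \<in> borel_measurable (noise_filtration M W a')"
    using XX W_adapted[OF P(1)] by simp
  have p1i: "integrable M (\<lambda>\<omega>. X \<omega> * X' \<omega> * W R1 \<omega>)"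
  proof -
    have "integrable M (\<lambda>\<omega>. X' \<omega> * W R1 \<omega>)"
      using X'(2) linear_span_integrable[OF W_in_span[OF N(1)]] by (rule bounded_mult_integrable[rotated]) simp
    from bounded_mult_integrable[OF _ X(2) this] show ?thesis by (simp add: mult.assoc)
  qed
  have Wi: "integrable M (W R')" by (rule linear_span_integrable[OF W_in_span[OF N(3)]])
  note f1 = future_factorization[OF p1 linear_span_base[OF P(3)] measurable_ident p1i, unfolded id_def, OF Wi]
  note f2 = future_pair[OF XX XXi linear_span_base[OF P(2)] linear_span_base[OF P(3)]]
  have AE: "AE \<omega> in M. (X \<omega> * W (R1 \<union> R2) \<omega>) * (X' \<omega> * W R' \<omega>) =
      X \<omega> * X' \<omega> * W R1 \<omega> * W R' \<omega> + X \<omega> * X' \<omega> * (W R2 \<omega> * W R' \<omega>)"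
    using W_additive[OF N(1,2) R(2)] by eventually_elim (simp add: algebra_simps)
  have i: "integrable M (\<lambda>\<omega>. X \<omega> * X' \<omega> * W R1 \<omega> * W R' \<omega> + X \<omega> * X' \<omega> * (W R2 \<omega> * W R' \<omega>))"
    using f1(2) f2(2) by (rule Bochner_Integration.integrable_add)
  have "integrable M (\<lambda>\<omega>. (X \<omega> * W (R1 \<union> R2) \<omega>) * (X' \<omega> * W R' \<omega>))"
    by (rule integrable_cong_AE_imp[OF i]) (use AE in auto)
  then show ?I by (simp only: R(1) R'_def)
  have "expectation (\<lambda>\<omega>. (X \<omega> * W (R1 \<union> R2) \<omega>) * (X' \<omega> * W R' \<omega>)) =
      expectation (\<lambda>\<omega>. X \<omega> * X' \<omega> * W R1 \<omega> * W R' \<omega> + X \<omega> * X' \<omega> * (W R2 \<omega> * W R' \<omega>))"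
    using AE by (rule integral_cong_AE[rotated -1]) measurable
  also have "\<dots> = expectation (\<lambda>\<omega>. X \<omega> * X' \<omega>) * measure lborel (R2 \<inter> R')"
    using f1 f2 W_mean[OF N(3)] W_covariance[OF N(2,3)] by simp
  also have "R2 \<inter> R' = (R1 \<union> R2) \<inter> R'"
    by (auto simp: R1_def R'_def)
  finally show ?E by (simp only: R(1) R'_def)
qed

definition elementary_value :: "('w \<Rightarrow> real) \<times> real \<times> real \<times> 'a set \<Rightarrow> 'w \<times> real \<times> 'a \<Rightarrow> real" where
  "elementary_value e = (case e of (X, a, b, A) \<Rightarrow> \<lambda>z. X (fst z) * indicator ({a<..b} \<times> A) (snd z))"

definition elementary_integral :: "('w \<Rightarrow> real) \<times> real \<times> real \<times> 'a set \<Rightarrow> 'w \<Rightarrow> real" where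
  "elementary_integral e = (case e of (X, a, b, A) \<Rightarrow> \<lambda>\<omega>. X \<omega> * W ({a<..b} \<times> A) \<omega>)"

lemma simple_value_sum: "simple_value S z = (\<Sum>i\<in>{0..<length S}. elementary_value (S ! i) z)"
proof -
  have "simple_value S z = (\<Sum>e\<leftarrow>S. elementary_value e z)"
    unfolding simple_value_def elementary_value_def
    by (cases z, simp, intro arg_cong[of _ _ sum_list] map_cong refl) (auto split: prod.split split_indicator)
  then show ?thesis by (simp add: sum_list_sum_nth)
qed

lemma simple_integral_sum: "simple_integral W S \<omega> = (\<Sum>i\<in>{0..<length S}. elementary_integral (S ! i) \<omega>)"
proof -
  have "simple_integral W S \<omega> = (\<Sum>e\<leftarrow>S. elementary_integral e \<omega>)"
    unfolding simple_integral_def elementary_integral_def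
    by (intro arg_cong[of _ _ sum_list] map_cong refl) (auto split: prod.split)
  then show ?thesis by (simp add: sum_list_sum_nth)
qed

lemma elementary_isometry:
  assumes S: "simple_process M W S" and e: "e \<in> set S" "e' \<in> set S"
  shows "expectation (\<lambda>\<omega>. elementary_integral e \<omega> * elementary_integral e' \<omega>) =
      (LINT z|(M \<Otimes>\<^sub>M lborel). elementary_value e z * elementary_value e' z)"
    and "integrable M (\<lambda>\<omega>. elementary_integral e \<omega> * elementary_integral e' \<omega>)"
    and "integrable (M \<Otimes>\<^sub>M lborel) (\<lambda>z. elementary_value e z * elementary_value e' z)"
proof -
  obtain X a b A where ed: "e = (X, a, b, A)" by (metis prod_cases4)
  obtain X' a' b' A' where ed': "e' = (X', a', b', A')" by (metis prod_cases4)
  obtain C where X: "X \<in> borel_measurable (noise_filtration M W a)" "\<forall>\<omega>\<in>space M. \<bar>X \<omega>\<bar> \<le> C"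
    and a: "0 \<le> a" and A: "A \<in> sets borel" "emeasure lborel A < \<infinity>"
    using S e(1) unfolding simple_process_def ed by fast
  obtain C' where X': "X' \<in> borel_measurable (noise_filtration M W a')" "\<forall>\<omega>\<in>space M. \<bar>X' \<omega>\<bar> \<le> C'"
    and a': "0 \<le> a'" and A': "A' \<in> sets borel" "emeasure lborel A' < \<infinity>"
    using S e(2) unfolding simple_process_def ed' by fast
  let ?R = "{a<..b} \<times> A" and ?R' = "{a'<..b'} \<times> A'"
  note [measurable] = noise_filtration_measurable[OF X(1)] noise_filtration_measurable[OF X'(1)]
  have X'i: "integrable M X'"
    using bounded_mult_integrable[of X' C' "\<lambda>_. 1"] X' by simp
  have XXi: "integrable M (\<lambda>\<omega>. X \<omega> * X' \<omega>)"
    using X(2) by (rule bounded_mult_integrable[OF _ _ X'i, rotated]) simp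
  have RN: "?R \<in> noise_sets" "?R' \<in> noise_sets"
    using a a' A A' by (auto intro!: rectangle_noise_sets)
  have Rf: "?R \<inter> ?R' \<in> sets lborel" "emeasure lborel (?R \<inter> ?R') < \<infinity>"
    using RN emeasure_mono[of "?R \<inter> ?R'" ?R lborel] by (auto simp: noise_sets_def)
  have Ri: "integrable lborel (indicator (?R \<inter> ?R') :: _ \<Rightarrow> real)"
    using Rf by (intro integrable_real_indicator) auto
  have eq: "(\<lambda>z. elementary_value e z * elementary_value e' z) =
      (\<lambda>z. (X (fst z) * X' (fst z)) * indicator (?R \<inter> ?R') (snd z))"
    by (auto simp: elementary_value_def ed ed' split: split_indicator)
  note pm = integrable_pair_mult[OF sigma_finite_measure_axioms lborel.sigma_finite_measure_axioms XXi Ri]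
  show "integrable (M \<Otimes>\<^sub>M lborel) (\<lambda>z. elementary_value e z * elementary_value e' z)"
    unfolding eq by (rule pm(1))
  have v: "(LINT z|(M \<Otimes>\<^sub>M lborel). elementary_value e z * elementary_value e' z) =
      expectation (\<lambda>\<omega>. X \<omega> * X' \<omega>) * measure lborel (?R \<inter> ?R')"
    unfolding eq pm(2) by simp
  have "expectation (\<lambda>\<omega>. elementary_integral e \<omega> * elementary_integral e' \<omega>) =
      expectation (\<lambda>\<omega>. X \<omega> * X' \<omega>) * measure lborel (?R \<inter> ?R') \<and>
    integrable M (\<lambda>\<omega>. elementary_integral e \<omega> * elementary_integral e' \<omega>)"
  proof (cases "a \<le> a'")
    case True
    show ?thesis
      using elementary_isometry_ordered[OF X X' a True A A', of b b'] by (simp add: elementary_integral_def ed ed')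
  next
    case False
    then have "a' \<le> a" by simp
    from elementary_isometry_ordered[OF X' X a' this A' A, of b' b] show ?thesis
      by (simp add: elementary_integral_def ed ed' mult.commute[of "X' _ * _"] mult.commute[of "X' _" "X _"] Int_commute)
  qed
  then show "expectation (\<lambda>\<omega>. elementary_integral e \<omega> * elementary_integral e' \<omega>) =
      (LINT z|(M \<Otimes>\<^sub>M lborel). elementary_value e z * elementary_value e' z)"
    and "integrable M (\<lambda>\<omega>. elementary_integral e \<omega> * elementary_integral e' \<omega>)"
    using v by simp_all
qed

end

section \<open>Isometry and moments of the Walsh integral\<close>

context white_noise
begin

lemma simple_isometry:
  assumes S: "simple_process M W S"
  shows "(\<integral>\<^sup>+ z. ennreal ((simple_value S z)\<^sup>2) \<partial>(M \<Otimes>\<^sub>M lborel)) =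
      (\<integral>\<^sup>+ \<omega>. ennreal ((simple_integral W S \<omega>)\<^sup>2) \<partial>M)" (is ?eq)
    and "integrable M (\<lambda>\<omega>. (simple_integral W S \<omega>)\<^sup>2)" (is ?int)
proof -
  let ?I = "{0..<length S}"
  have e: "S ! i \<in> set S" if "i \<in> ?I" for i using that by simp
  have I2: "(simple_integral W S \<omega>)\<^sup>2 = (\<Sum>i\<in>?I. \<Sum>j\<in>?I. elementary_integral (S ! i) \<omega> * elementary_integral (S ! j) \<omega>)" for \<omega>
    unfolding simple_integral_sum power2_eq_square by (rule sum_product)
  have V2: "(simple_value S z)\<^sup>2 = (\<Sum>i\<in>?I. \<Sum>j\<in>?I. elementary_value (S ! i) z * elementary_value (S ! j) z)" for z
    unfolding simple_value_sum power2_eq_square by (rule sum_product)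
  note iso = elementary_isometry[OF S e e]
  show int: ?int
    unfolding I2 by (intro Bochner_Integration.integrable_sum iso)
  have int': "integrable (M \<Otimes>\<^sub>M lborel) (\<lambda>z. (simple_value S z)\<^sup>2)"
    unfolding V2 by (intro Bochner_Integration.integrable_sum iso)
  have "expectation (\<lambda>\<omega>. (simple_integral W S \<omega>)\<^sup>2) =
      (\<Sum>i\<in>?I. \<Sum>j\<in>?I. expectation (\<lambda>\<omega>. elementary_integral (S ! i) \<omega> * elementary_integral (S ! j) \<omega>))"
    unfolding I2 by (subst Bochner_Integration.integral_sum, intro Bochner_Integration.integrable_sum iso, assumption+,
      intro sum.cong refl Bochner_Integration.integral_sum iso)
  also have "\<dots> = (\<Sum>i\<in>?I. \<Sum>j\<in>?I. LINT z|(M \<Otimes>\<^sub>M lborel). elementary_value (S ! i) z * elementary_value (S ! j) z)"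
    by (intro sum.cong refl iso)
  also have "\<dots> = (LINT z|(M \<Otimes>\<^sub>M lborel). (simple_value S z)\<^sup>2)"
    unfolding V2 by (subst Bochner_Integration.integral_sum, intro Bochner_Integration.integrable_sum iso, assumption+,
      intro sum.cong refl Bochner_Integration.integral_sum[symmetric] iso)
  finally show ?eq
    using int int' by (subst (1 2) nn_integral_eq_integral) auto
qed

text \<open>The mean vanishes because the random weight of each elementary process is measurable at
  the left end of its interval, hence independent of the centred noise on it.\<close>

lemma simple_process_measurable:
  assumes S: "simple_process M W S"
  shows "simple_integral W S \<in> borel_measurable M" and "simple_value S \<in> borel_measurable (M \<Otimes>\<^sub>M lborel)"
    and "expectation (simple_integral W S) = 0"
proof -
  have e: "elementary_integral e \<in> borel_measurable M \<and> elementary_value e \<in> borel_measurable (M \<Otimes>\<^sub>M lborel) \<and>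
      integrable M (elementary_integral e) \<and> expectation (elementary_integral e) = 0" if e: "e \<in> set S" for e
  proof -
    obtain X a b A where ed: "e = (X, a, b, A)" by (metis prod_cases4)
    obtain C where X: "X \<in> borel_measurable (noise_filtration M W a)" "\<forall>\<omega>\<in>space M. \<bar>X \<omega>\<bar> \<le> C"
      and a: "0 \<le> a" and A: "A \<in> sets borel" "emeasure lborel A < \<infinity>"
      using S e unfolding simple_process_def ed by fast
    have N: "{a<..b} \<times> A \<in> noise_sets" using a A by (rule rectangle_noise_sets)
    then have F: "{a<..b} \<times> A \<in> future a" by (auto simp: future_def)
    note [measurable] = noise_filtration_measurable[OF X(1)] W_measurable[OF N]
    have [measurable]: "{a<..b} \<times> A \<in> sets borel" using N by (simp add: noise_sets_def)
    have Xi: "integrable M X"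
      using bounded_mult_integrable[of X C "\<lambda>_. 1"] X by simp
    have Wi: "integrable M (W ({a<..b} \<times> A))" by (rule linear_span_integrable[OF W_in_span[OF N]])
    note f = future_factorization[OF X(1) linear_span_base[OF F] measurable_ident Xi, unfolded id_def, OF Wi]
    have 1: "(\<lambda>\<omega>. X \<omega> * W ({a<..b} \<times> A) \<omega>) \<in> borel_measurable M"
      and 2: "(\<lambda>z. X (fst z) * indicator ({a<..b} \<times> A) (snd z)) \<in> borel_measurable (M \<Otimes>\<^sub>M lborel)"
      by measurable
    have 3: "expectation (\<lambda>\<omega>. X \<omega> * W ({a<..b} \<times> A) \<omega>) = 0"
      using f(1) W_mean[OF N] by simp
    show ?thesis
      unfolding ed elementary_integral_def elementary_value_def prod.case
      by (intro conjI 1 2 3 f(2))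
  qed
  have e': "elementary_integral (S ! i) \<in> borel_measurable M" "elementary_value (S ! i) \<in> borel_measurable (M \<Otimes>\<^sub>M lborel)"
      "integrable M (elementary_integral (S ! i))" "expectation (elementary_integral (S ! i)) = 0" if "i \<in> {0..<length S}" for i
    using e[of "S ! i"] that by simp_all
  show "simple_integral W S \<in> borel_measurable M"
    unfolding simple_integral_sum[abs_def] by (rule borel_measurable_sum[OF e'(1)])
  show "simple_value S \<in> borel_measurable (M \<Otimes>\<^sub>M lborel)"
    unfolding simple_value_sum[abs_def] by (rule borel_measurable_sum[OF e'(2)])
  show "expectation (simple_integral W S) = 0"
  proof -
    have "expectation (simple_integral W S) = (\<Sum>i\<in>{0..<length S}. expectation (elementary_integral (S ! i)))"
      unfolding simple_integral_sum[abs_def] by (rule Bochner_Integration.integral_sum[OF e'(3)])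
    also have "\<dots> = 0" by (rule sum.neutral) (use e'(4) in blast)
    finally show ?thesis .
  qed
qed

text \<open>Pointwise, right side minus left side is (2 f - g)^2. Takes the place of the triangle
  inequality for the square norm.\<close>

lemma nn_integral_square_add_le:
  fixes f g :: "'z \<Rightarrow> real"
  assumes [measurable]: "f \<in> borel_measurable N" "g \<in> borel_measurable N"
  shows "(\<integral>\<^sup>+ z. ennreal ((g z)\<^sup>2) \<partial>N) \<le> 2 * (\<integral>\<^sup>+ z. ennreal ((f z - g z)\<^sup>2) \<partial>N) + 2 * (\<integral>\<^sup>+ z. ennreal ((f z)\<^sup>2) \<partial>N)"
proof -
  have "(g z)\<^sup>2 \<le> 2 * (f z - g z)\<^sup>2 + 2 * (f z)\<^sup>2" for z
    using zero_le_power2[of "2 * f z - g z"] by (simp add: power2_eq_square algebra_simps)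
  then have "(\<integral>\<^sup>+ z. ennreal ((g z)\<^sup>2) \<partial>N) \<le> (\<integral>\<^sup>+ z. 2 * ennreal ((f z - g z)\<^sup>2) + 2 * ennreal ((f z)\<^sup>2) \<partial>N)"
    by (intro nn_integral_mono) (simp add: ennreal_plus[symmetric] ennreal_mult' [symmetric] ennreal_leI
      flip: ennreal_numeral del: ennreal_plus)
  also have "\<dots> = 2 * (\<integral>\<^sup>+ z. ennreal ((f z - g z)\<^sup>2) \<partial>N) + 2 * (\<integral>\<^sup>+ z. ennreal ((f z)\<^sup>2) \<partial>N)"
    by (simp add: nn_integral_add nn_integral_cmult)
  finally show ?thesis .
qed

text \<open>All three facts pass to the limit from simple processes. The mean square distance of Z
  to some simple integral is finite, which bounds Z itself; and since simple integrals are centred,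
  the square of the mean of Z is at most that distance, which tends to 0.\<close>

lemma has_walsh_integral_moments:
  assumes "has_walsh_integral M W \<Phi> Z"
  shows "integrable M (\<lambda>\<omega>. (Z \<omega>)\<^sup>2)" and "expectation Z = 0"
    and "(\<integral>\<^sup>+ z. ennreal ((\<Phi> z)\<^sup>2) \<partial>(M \<Otimes>\<^sub>M lborel)) \<le> 4 * (\<integral>\<^sup>+ \<omega>. ennreal ((Z \<omega>)\<^sup>2) \<partial>M)"
proof -
  obtain S where [measurable]: "\<Phi> \<in> borel_measurable (M \<Otimes>\<^sub>M lborel)" "Z \<in> borel_measurable M"
    and S: "\<And>n::nat. simple_process M W (S n)"
    and lim1: "(\<lambda>n. \<integral>\<^sup>+ z. ennreal ((simple_value (S n) z - \<Phi> z)\<^sup>2) \<partial>(M \<Otimes>\<^sub>M lborel)) \<longlonglongrightarrow> 0"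
    and lim2: "(\<lambda>n. \<integral>\<^sup>+ \<omega>. ennreal ((simple_integral W (S n) \<omega> - Z \<omega>)\<^sup>2) \<partial>M) \<longlonglongrightarrow> 0"
    using assms unfolding has_walsh_integral_def by blast
  note [measurable] = simple_process_measurable(1,2)[OF S]
  let ?d = "\<lambda>n. \<integral>\<^sup>+ z. ennreal ((simple_value (S n) z - \<Phi> z)\<^sup>2) \<partial>(M \<Otimes>\<^sub>M lborel)"
  let ?e = "\<lambda>n. \<integral>\<^sup>+ \<omega>. ennreal ((simple_integral W (S n) \<omega> - Z \<omega>)\<^sup>2) \<partial>M"
  have "\<forall>\<^sub>F n in sequentially. ?e n < 1"
    using lim2 by (rule order_tendstoD) simp
  then obtain n0 where n0: "\<And>n. n0 \<le> n \<Longrightarrow> ?e n < 1"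
    by (auto simp: eventually_sequentially)
  have I2: "(\<integral>\<^sup>+ \<omega>. ennreal ((simple_integral W (S n) \<omega>)\<^sup>2) \<partial>M) < \<infinity>" for n
    using simple_isometry(2)[OF S, of n] by (subst nn_integral_eq_integral) auto
  have "(\<integral>\<^sup>+ \<omega>. ennreal ((Z \<omega>)\<^sup>2) \<partial>M) \<le> 2 * ?e n0 + 2 * (\<integral>\<^sup>+ \<omega>. ennreal ((simple_integral W (S n0) \<omega>)\<^sup>2) \<partial>M)"
    by (rule nn_integral_square_add_le) measurable
  also have "\<dots> < \<infinity>"
    using I2[of n0] n0[of n0] by (auto simp: ennreal_mult_less_top intro: less_trans)
  finally show Z2: "integrable M (\<lambda>\<omega>. (Z \<omega>)\<^sup>2)"
    by (intro integrableI_bounded) simp_all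
  have Zi: "integrable M Z" by (rule square_integrable_imp_integrable[OF _ Z2]) simp
  have "ennreal ((expectation Z)\<^sup>2) \<le> ?e n" if n: "n0 \<le> n" for n
  proof -
    let ?D = "\<lambda>\<omega>. simple_integral W (S n) \<omega> - Z \<omega>"
    have "?e n < \<infinity>" using n0[OF n] by (auto intro: less_trans)
    then have D2: "integrable M (\<lambda>\<omega>. (?D \<omega>)\<^sup>2)"
      by (intro integrableI_bounded) simp_all
    have Di: "integrable M ?D" by (rule square_integrable_imp_integrable[OF _ D2]) simp
    have Ii: "integrable M (simple_integral W (S n))"
      by (rule square_integrable_imp_integrable[OF _ simple_isometry(2)[OF S]]) simp
    have "expectation ?D = - expectation Z"
      using Ii Zi simple_process_measurable(3)[OF S, of n] by simp
    then have "(expectation Z)\<^sup>2 \<le> expectation (\<lambda>\<omega>. (?D \<omega>)\<^sup>2)"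
      using expectation_square_le[OF Di D2] by simp
    then show ?thesis
      by (subst nn_integral_eq_integral[OF D2]) (auto intro: ennreal_leI)
  qed
  then have "ennreal ((expectation Z)\<^sup>2) \<le> 0"
    by (intro LIMSEQ_le_const[OF lim2]) blast
  then show "expectation Z = 0"
    by (simp add: ennreal_eq_0_iff)
  \<comment> \<open>Replacing \<Phi> by a simple process and the simple integral by Z costs a factor
    2 each time. The resulting one-sided isometry with constant 4 is strong enough for the blow-up,
    where the constant enters only the threshold.\<close>
  have "(\<integral>\<^sup>+ z. ennreal ((\<Phi> z)\<^sup>2) \<partial>(M \<Otimes>\<^sub>M lborel)) \<le> 2 * ?d n + 4 * ?e n + 4 * (\<integral>\<^sup>+ \<omega>. ennreal ((Z \<omega>)\<^sup>2) \<partial>M)" for n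
  proof -
    have "(\<integral>\<^sup>+ z. ennreal ((\<Phi> z)\<^sup>2) \<partial>(M \<Otimes>\<^sub>M lborel)) \<le> 2 * ?d n + 2 * (\<integral>\<^sup>+ z. ennreal ((simple_value (S n) z)\<^sup>2) \<partial>(M \<Otimes>\<^sub>M lborel))"
      by (rule nn_integral_square_add_le) measurable
    also have "(\<integral>\<^sup>+ z. ennreal ((simple_value (S n) z)\<^sup>2) \<partial>(M \<Otimes>\<^sub>M lborel)) = (\<integral>\<^sup>+ \<omega>. ennreal ((simple_integral W (S n) \<omega>)\<^sup>2) \<partial>M)"
      by (rule simple_isometry(1)[OF S])
    also have "\<dots> \<le> 2 * (\<integral>\<^sup>+ \<omega>. ennreal ((Z \<omega> - simple_integral W (S n) \<omega>)\<^sup>2) \<partial>M) + 2 * (\<integral>\<^sup>+ \<omega>. ennreal ((Z \<omega>)\<^sup>2) \<partial>M)"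
      by (rule nn_integral_square_add_le) measurable
    also have "(\<integral>\<^sup>+ \<omega>. ennreal ((Z \<omega> - simple_integral W (S n) \<omega>)\<^sup>2) \<partial>M) = ?e n"
      by (simp only: power2_commute)
    finally show ?thesis
      by (simp add: distrib_left mult_left_mono add.assoc mult.assoc[symmetric])
  qed
  moreover have "(\<lambda>n. 2 * ?d n + 4 * ?e n + 4 * (\<integral>\<^sup>+ \<omega>. ennreal ((Z \<omega>)\<^sup>2) \<partial>M)) \<longlonglongrightarrow> 2 * 0 + 4 * 0 + 4 * (\<integral>\<^sup>+ \<omega>. ennreal ((Z \<omega>)\<^sup>2) \<partial>M)"
    by (intro tendsto_add ennreal_tendsto_cmult lim1 lim2 tendsto_const) simp_all
  ultimately show "(\<integral>\<^sup>+ z. ennreal ((\<Phi> z)\<^sup>2) \<partial>(M \<Otimes>\<^sub>M lborel)) \<le> 4 * (\<integral>\<^sup>+ \<omega>. ennreal ((Z \<omega>)\<^sup>2) \<partial>M)"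
    by (intro LIMSEQ_le_const) auto
qed

section \<open>Second moments of a mild solution\<close>

lemma second_moment_shift:
  assumes Z: "Z \<in> borel_measurable M" and Z2: "integrable M (\<lambda>\<omega>. (Z \<omega>)\<^sup>2)" and Z0: "expectation Z = 0"
    and u: "AE \<omega> in M. u \<omega> = m + Z \<omega>"
  shows "second_moment M u = ennreal (m\<^sup>2) + (\<integral>\<^sup>+ \<omega>. ennreal ((Z \<omega>)\<^sup>2) \<partial>M)"
proof -
  have Zi: "integrable M Z" by (rule square_integrable_imp_integrable[OF Z Z2])
  have eq: "(m + Z \<omega>)\<^sup>2 = m\<^sup>2 + 2 * m * Z \<omega> + (Z \<omega>)\<^sup>2" for \<omega>
    by (simp add: power2_sum)
  have i: "integrable M (\<lambda>\<omega>. (m + Z \<omega>)\<^sup>2)"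
    unfolding eq using Zi Z2 by simp
  have "second_moment M u = (\<integral>\<^sup>+ \<omega>. ennreal ((m + Z \<omega>)\<^sup>2) \<partial>M)"
    unfolding second_moment_def using u by (intro nn_integral_cong_AE) auto
  also have "\<dots> = ennreal (expectation (\<lambda>\<omega>. (m + Z \<omega>)\<^sup>2))"
    by (rule nn_integral_eq_integral[OF i]) simp
  also have "expectation (\<lambda>\<omega>. (m + Z \<omega>)\<^sup>2) = m\<^sup>2 + expectation (\<lambda>\<omega>. (Z \<omega>)\<^sup>2)"
    unfolding eq using Zi Z2 Z0 by (simp add: prob_space)
  also have "ennreal \<dots> = ennreal (m\<^sup>2) + (\<integral>\<^sup>+ \<omega>. ennreal ((Z \<omega>)\<^sup>2) \<partial>M)"
    using Z2 by (subst nn_integral_eq_integral) (auto intro: ennreal_plus)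
  finally show ?thesis .
qed

lemma mild_solution_measurable:
  assumes "mild_solution M W G \<sigma> u0 u" "0 \<le> t"
  shows "u t x \<in> borel_measurable M"
  using assms noise_filtration_measurable unfolding mild_solution_def by blast

text \<open>Where the second moment is finite, the equation supplies a centred Walsh integral Z. Its
  cross term with the deterministic part vanishes, so the second moment is the sum of two
  nonnegative contributions and dominates each. The first bound is trivial where the second moment
  is infinite.\<close>

lemma mild_solution_moments:
  assumes mild: "mild_solution M W G \<sigma> u0 u" and t: "0 < t"
  shows "ennreal ((LINT y|lborel. G t (x - y) * u0 y)\<^sup>2) \<le> second_moment M (u t x)"
    and "second_moment M (u t x) < \<infinity> \<Longrightarrow> mild_integrand G \<sigma> u t x \<in> borel_measurable (M \<Otimes>\<^sub>M lborel)"
    and "second_moment M (u t x) < \<infinity> \<Longrightarrow>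
      (\<integral>\<^sup>+ z. ennreal ((mild_integrand G \<sigma> u t x z)\<^sup>2) \<partial>(M \<Otimes>\<^sub>M lborel)) \<le> 4 * second_moment M (u t x)"
proof -
  let ?m = "LINT y|lborel. G t (x - y) * u0 y"
  have *: "ennreal (?m\<^sup>2) \<le> second_moment M (u t x) \<and>
      mild_integrand G \<sigma> u t x \<in> borel_measurable (M \<Otimes>\<^sub>M lborel) \<and>
      (\<integral>\<^sup>+ z. ennreal ((mild_integrand G \<sigma> u t x z)\<^sup>2) \<partial>(M \<Otimes>\<^sub>M lborel)) \<le> 4 * second_moment M (u t x)"
    if fin: "second_moment M (u t x) < \<infinity>"
  proof -
    obtain Z where Z: "has_walsh_integral M W (mild_integrand G \<sigma> u t x) Z"
      using mild t fin unfolding mild_solution_def by blast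
    then have "AE \<omega> in M. u t x \<omega> = ?m + Z \<omega>"
      using mild t unfolding mild_solution_def by blast
    moreover have "Z \<in> borel_measurable M" "mild_integrand G \<sigma> u t x \<in> borel_measurable (M \<Otimes>\<^sub>M lborel)"
      using Z unfolding has_walsh_integral_def by blast+
    moreover note Zm = has_walsh_integral_moments[OF Z]
    ultimately have "second_moment M (u t x) = ennreal (?m\<^sup>2) + (\<integral>\<^sup>+ \<omega>. ennreal ((Z \<omega>)\<^sup>2) \<partial>M)"
      by (intro second_moment_shift)
    then have "ennreal (?m\<^sup>2) \<le> second_moment M (u t x)" "(\<integral>\<^sup>+ \<omega>. ennreal ((Z \<omega>)\<^sup>2) \<partial>M) \<le> second_moment M (u t x)"
      by simp_all
    moreover from this(2) Zm(3)
    have "(\<integral>\<^sup>+ z. ennreal ((mild_integrand G \<sigma> u t x z)\<^sup>2) \<partial>(M \<Otimes>\<^sub>M lborel)) \<le> 4 * second_moment M (u t x)"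
      by (meson mult_left_mono order_trans zero_le)
    ultimately show ?thesis
      using \<open>mild_integrand G \<sigma> u t x \<in> borel_measurable (M \<Otimes>\<^sub>M lborel)\<close> by blast
  qed
  show "ennreal (?m\<^sup>2) \<le> second_moment M (u t x)"
    using * by (cases "second_moment M (u t x) < \<infinity>") (auto simp: less_top[symmetric])
  show "second_moment M (u t x) < \<infinity> \<Longrightarrow> mild_integrand G \<sigma> u t x \<in> borel_measurable (M \<Otimes>\<^sub>M lborel)"
    "second_moment M (u t x) < \<infinity> \<Longrightarrow>
      (\<integral>\<^sup>+ z. ennreal ((mild_integrand G \<sigma> u t x z)\<^sup>2) \<partial>(M \<Otimes>\<^sub>M lborel)) \<le> 4 * second_moment M (u t x)"
    using * by blast+
qed

text \<open>Jensen's inequality, from the tangent line of \<open>y powr (1 + \<gamma>)\<close> at \<open>A\<close>.\<close>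

lemma second_moment_powr:
  assumes [measurable]: "X \<in> borel_measurable M" and \<gamma>: "0 < \<gamma>" and A: "0 < A" and le: "ennreal A \<le> second_moment M X"
  shows "ennreal (A powr (1 + \<gamma>)) \<le> (\<integral>\<^sup>+ \<omega>. ennreal ((\<bar>X \<omega>\<bar> powr (1 + \<gamma>))\<^sup>2) \<partial>M)"
proof -
  let ?k = "(1 + \<gamma>) * A powr \<gamma>"
  have tangent: "?k * x\<^sup>2 \<le> (\<bar>x\<bar> powr (1 + \<gamma>))\<^sup>2 + \<gamma> * A powr (1 + \<gamma>)" for x :: real
  proof -
    define r where "r = x\<^sup>2 / A"
    have r: "0 \<le> r" using A by (simp add: r_def)
    \<comment> \<open>Young's inequality with second factor 1 is the tangent line at r = 1; the
      scaling r = x^2 / A moves the point of contact to A.\<close>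
    have "r * 1 \<le> r powr (1 + \<gamma>) / (1 + \<gamma>) + 1 powr ((1 + \<gamma>) / \<gamma>) / ((1 + \<gamma>) / \<gamma>)"
      using \<gamma> r by (intro Youngs_inequality) (auto simp: field_simps)
    moreover have "1 powr ((1 + \<gamma>) / \<gamma>) / ((1 + \<gamma>) / \<gamma>) = \<gamma> / (1 + \<gamma>)"
      by simp
    ultimately have "r \<le> (r powr (1 + \<gamma>) + \<gamma>) / (1 + \<gamma>)"
      by (simp add: add_divide_distrib)
    then have "(1 + \<gamma>) * r \<le> r powr (1 + \<gamma>) + \<gamma>"
      using \<gamma> by (simp add: field_simps)
    then have "((1 + \<gamma>) * r) * A powr (1 + \<gamma>) \<le> (r powr (1 + \<gamma>) + \<gamma>) * A powr (1 + \<gamma>)"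
      by (rule mult_right_mono) simp
    moreover have "((1 + \<gamma>) * r) * A powr (1 + \<gamma>) = ?k * x\<^sup>2"
      using A by (simp add: r_def powr_add)
    moreover have "r powr (1 + \<gamma>) * A powr (1 + \<gamma>) = (\<bar>x\<bar> powr (1 + \<gamma>))\<^sup>2"
    proof -
      have "r powr (1 + \<gamma>) * A powr (1 + \<gamma>) = (r * A) powr (1 + \<gamma>)"
        using r A by (simp add: powr_mult)
      also have "r * A = \<bar>x\<bar> * \<bar>x\<bar>" using A by (simp add: r_def power2_eq_square)
      finally show ?thesis by (simp only: powr_mult power2_eq_square abs_ge_zero)
    qed
    ultimately show ?thesis by (simp add: distrib_right)
  qed
  have "ennreal (A powr (1 + \<gamma>)) + ennreal (\<gamma> * A powr (1 + \<gamma>)) = ennreal ?k * ennreal A"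
    using A \<gamma> by (simp add: ennreal_mult[symmetric] ennreal_plus[symmetric] powr_add algebra_simps del: ennreal_plus)
  also have "\<dots> \<le> ennreal ?k * (\<integral>\<^sup>+ \<omega>. ennreal (\<bar>X \<omega>\<bar>\<^sup>2) \<partial>M)"
    using le unfolding second_moment_def by (rule mult_left_mono) simp
  also have "\<dots> = (\<integral>\<^sup>+ \<omega>. ennreal ?k * ennreal (\<bar>X \<omega>\<bar>\<^sup>2) \<partial>M)"
    by (rule nn_integral_cmult[symmetric]) measurable
  also have "\<dots> \<le> (\<integral>\<^sup>+ \<omega>. ennreal ((\<bar>X \<omega>\<bar> powr (1 + \<gamma>))\<^sup>2) + ennreal (\<gamma> * A powr (1 + \<gamma>)) \<partial>M)"
    using \<gamma> tangent by (intro nn_integral_mono)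
      (simp add: ennreal_mult[symmetric] ennreal_plus[symmetric] ennreal_leI del: ennreal_plus)
  also have "\<dots> = (\<integral>\<^sup>+ \<omega>. ennreal ((\<bar>X \<omega>\<bar> powr (1 + \<gamma>))\<^sup>2) \<partial>M) + ennreal (\<gamma> * A powr (1 + \<gamma>))"
    by (subst nn_integral_add) (auto simp: emeasure_space_1)
  finally show ?thesis
    by (simp add: add.commute[of _ "ennreal (\<gamma> * A powr (1 + \<gamma>))"] ennreal_add_left_cancel_le)
qed

end

section \<open>Blow-up of the second moment\<close>

lemma lborel_distr_reflect: "distr lborel borel (\<lambda>z. x - z) = (lborel :: 'a::euclidean_space measure)"
  using lborel_affine[of "-1" x, symmetric] by (simp add: density_1)

lemma nn_integral_lborel_reflect:
  fixes x :: "'a::euclidean_space"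
  assumes [measurable]: "h \<in> borel_measurable borel"
  shows "(\<integral>\<^sup>+ z. h (x - z) \<partial>lborel) = (\<integral>\<^sup>+ z. h z \<partial>lborel)"
  by (subst (2) lborel_distr_reflect[of x, symmetric], subst nn_integral_distr) auto

lemma AE_lborel_reflect:
  fixes x :: "'a::euclidean_space"
  assumes "AE w in lborel. P w"
  shows "AE z in lborel. P (x - z)"
proof (rule AE_distrD[where M=lborel and M'=borel and f="\<lambda>z. x - z"])
  show "AE w in distr lborel borel (\<lambda>z. x - z). P w"
    unfolding lborel_distr_reflect by fact
qed simp

lemma powr_nat_power: "0 \<le> x \<Longrightarrow> (x ^ n) powr k = (x powr k) ^ n" for x k :: real
  by (induction n) (simp_all add: powr_mult)

text \<open>Collects what the blow-up argument uses about the kernel. The exponent \<kappa> relates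
  time to space: within time \<delta> * r^\<kappa> half of the mass is still in the ball of radius
  r.\<close>

locale blowup_kernel =
  fixes G :: "real \<Rightarrow> 'a::euclidean_space \<Rightarrow> real" and \<delta> \<kappa> :: real
  assumes G_measurable: "0 < t \<Longrightarrow> G t \<in> borel_measurable borel"
    and G_nonneg: "0 < t \<Longrightarrow> 0 \<le> G t x"
    and G_integrable: "0 < t \<Longrightarrow> integrable lborel (G t)"
    and G_lower_bound: "0 < a \<Longrightarrow> 0 < R \<Longrightarrow> \<exists>c>0. \<forall>t\<in>{a..b}. AE x in lborel. norm x \<le> R \<longrightarrow> c \<le> G t x"
    and \<delta>: "0 < \<delta>" and \<kappa>: "0 < \<kappa>"
    and G_concentrated: "0 < r \<Longrightarrow> 0 < t \<Longrightarrow> t \<le> \<delta> * r powr \<kappa> \<Longrightarrow>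
      ennreal (1 / 2) \<le> (\<integral>\<^sup>+ x. ennreal (G t x) * indicator (ball 0 r) x \<partial>lborel)"

context blowup_kernel
begin

definition v :: real where "v = measure lborel (ball (0::'a) 1)"

text \<open>The factor by which the admissible time step \<delta> * r^\<kappa> shrinks when the
  margin r is halved.\<close>

definition \<theta> :: real where "\<theta> = (1/2) powr \<kappa>"

text \<open>The first time step. The first margin in space is 1/4, which explains the first bound;
  the second keeps the total time \<tau> / (1 - \<theta>) of all steps at most 1/2, the length of
  [1, 3/2].\<close>

definition \<tau> :: real where "\<tau> = min (\<delta> * (1/4) powr \<kappa>) ((1 - \<theta>) / 2)"

text \<open>The solution a of a^\<gamma> * \<tau> / (4 v) = 4 \<Lambda> with \<Lambda> =
  \<theta>^(-1/\<gamma>). From this starting value each step multiplies the lower bound by exactly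
  \<Lambda>, once the factor 4 of the moment bound is cancelled.\<close>

definition threshold :: "real \<Rightarrow> real" where
  "threshold \<gamma> = (16 * v * \<theta> powr (- 1 / \<gamma>) / \<tau>) powr (1 / \<gamma>)"

lemma v_pos: "0 < v"
  unfolding v_def by (rule content_ball_pos) simp

lemma \<theta>_bounds: "0 < \<theta>" "\<theta> < 1"
  using powr_less_mono2[of \<kappa> "1/2" 1] \<kappa> by (simp_all add: \<theta>_def)

lemma \<tau>_bounds: "0 < \<tau>" "\<tau> \<le> \<delta> * (1/4) powr \<kappa>" "\<tau> \<le> (1 - \<theta>) / 2"
proof -
  show "0 < \<tau>" using \<theta>_bounds \<delta> by (simp add: \<tau>_def)
  show "\<tau> \<le> \<delta> * (1/4) powr \<kappa>" "\<tau> \<le> (1 - \<theta>) / 2"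
    unfolding \<tau>_def by (rule min.cobounded1, rule min.cobounded2)
qed

lemma threshold_pos: "0 < threshold \<gamma>"
  using v_pos \<theta>_bounds \<tau>_bounds by (simp add: threshold_def)

text \<open>Cauchy--Schwarz on the ball, in the form \<open>G\<^sup>2 + k\<^sup>2 \<ge> 2 k G\<close> with the optimal constant \<open>k\<close>.\<close>

lemma G_square_concentrated:
  assumes r: "0 < r" "r \<le> 1" and t: "0 < t" "t \<le> \<delta> * r powr \<kappa>"
  shows "ennreal (1 / (4 * v)) \<le> (\<integral>\<^sup>+ w. ennreal ((G t w)\<^sup>2) * indicator (ball 0 r) w \<partial>lborel)"
proof -
  \<comment> \<open>Maximises k - k^2 * v, with value 1/(4 v); r \<le> 1 allows the volume of the
    ball to be bounded by \<open>v\<close>.\<close>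
  define k where "k = 1 / (2 * v)"
  have k: "0 < k" using v_pos by (simp add: k_def)
  note [measurable] = G_measurable[OF t(1)] borel_open[OF open_ball]
  have "ennreal (1 / (4 * v)) + ennreal (k\<^sup>2 * v) = ennreal (1 / (4 * v) + k\<^sup>2 * v)"
    using v_pos by (intro ennreal_plus[symmetric]) auto
  also have "1 / (4 * v) + k\<^sup>2 * v = 2 * k * (1 / 2)"
    using v_pos by (simp add: k_def power2_eq_square field_simps)
  also have "ennreal (2 * k * (1 / 2)) = ennreal (2 * k) * ennreal (1 / 2)"
    using k by (intro ennreal_mult) auto
  also have "\<dots> \<le> ennreal (2 * k) * (\<integral>\<^sup>+ w. ennreal (G t w) * indicator (ball 0 r) w \<partial>lborel)"
    by (rule mult_left_mono[OF G_concentrated[OF r(1) t]]) simp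
  also have "\<dots> = (\<integral>\<^sup>+ w. ennreal (2 * k) * (ennreal (G t w) * indicator (ball 0 r) w) \<partial>lborel)"
    by (rule nn_integral_cmult[symmetric]) measurable
  also have "\<dots> \<le> (\<integral>\<^sup>+ w. ennreal ((G t w)\<^sup>2) * indicator (ball 0 r) w + ennreal (k\<^sup>2) * indicator (ball 0 1) w \<partial>lborel)"
  proof (rule nn_integral_mono)
    fix w
    have "2 * k * G t w \<le> (G t w)\<^sup>2 + k\<^sup>2"
      using zero_le_power2[of "G t w - k"] by (simp add: power2_diff algebra_simps)
    then have "ennreal (2 * k) * ennreal (G t w) \<le> ennreal ((G t w)\<^sup>2) + ennreal (k\<^sup>2)"
      using k t by (simp add: ennreal_mult[symmetric] ennreal_plus[symmetric] G_nonneg ennreal_leI del: ennreal_plus)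
    then show "ennreal (2 * k) * (ennreal (G t w) * indicator (ball 0 r) w) \<le>
        ennreal ((G t w)\<^sup>2) * indicator (ball 0 r) w + ennreal (k\<^sup>2) * indicator (ball 0 1) w"
      using r by (auto split: split_indicator)
  qed
  also have "\<dots> = (\<integral>\<^sup>+ w. ennreal ((G t w)\<^sup>2) * indicator (ball 0 r) w \<partial>lborel) + (\<integral>\<^sup>+ w. ennreal (k\<^sup>2) * indicator (ball (0::'a) 1) w \<partial>lborel)"
    by (rule nn_integral_add) measurable
  also have "(\<integral>\<^sup>+ w. ennreal (k\<^sup>2) * indicator (ball (0::'a) 1) w \<partial>lborel) = ennreal (k\<^sup>2 * v)"
    using emeasure_bounded_finite[OF bounded_ball, of "0::'a" 1] k v_pos
    by (subst nn_integral_cmult_indicator) (auto simp: v_def ennreal_mult emeasure_eq_ennreal_measure)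
  finally show ?thesis
    by (simp add: add.commute[of _ "ennreal (k\<^sup>2 * v)"] ennreal_add_left_cancel_le)
qed

end

locale noise_equation = white_noise M W + blowup_kernel G \<delta> \<kappa>
  for M :: "'w measure" and W :: "(real \<times> 'a::euclidean_space) set \<Rightarrow> 'w \<Rightarrow> real"
    and G :: "real \<Rightarrow> 'a \<Rightarrow> real" and \<delta> \<kappa> +
  fixes \<sigma> :: "real \<Rightarrow> real" and u0 :: "'a \<Rightarrow> real" and u :: "real \<Rightarrow> 'a \<Rightarrow> 'w \<Rightarrow> real" and \<gamma> :: real
  assumes mild: "mild_solution M W G \<sigma> u0 u"
    and \<gamma>: "0 < \<gamma>" and \<sigma>: "\<And>z. \<bar>z\<bar> powr (1 + \<gamma>) \<le> \<sigma> z"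
begin

definition F :: "real \<Rightarrow> 'a \<Rightarrow> ennreal" where
  "F t x = second_moment M (u t x)"

text \<open>One step of the iteration for a constant bound A. The mass \<open>k\<close> of the
  squared kernel is left as a parameter: it comes from concentration in the short steps and from the
  pointwise lower bound in the final spreading step.\<close>

lemma F_integral_lower_bound:
  assumes r: "0 \<le> r" "r < r'" "r' \<le> t" and B: "B \<in> sets borel" and A: "0 < A"
    and F: "\<And>s y. s \<in> {r<..<r'} \<Longrightarrow> y \<in> B \<Longrightarrow> ennreal A \<le> F s y"
    and k: "\<And>s. s \<in> {r<..<r'} \<Longrightarrow> ennreal k \<le> (\<integral>\<^sup>+ y. ennreal ((G (t - s) (x - y))\<^sup>2) * indicator B y \<partial>lborel)"
    and k0: "0 \<le> k"
  shows "ennreal (A powr (1 + \<gamma>) * k * (r' - r)) \<le> 4 * F t x"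
proof (cases "F t x < \<infinity>")
  case True
  have t: "0 < t" using r by simp
  let ?\<Phi> = "mild_integrand G \<sigma> u t x"
  have [measurable]: "?\<Phi> \<in> borel_measurable (M \<Otimes>\<^sub>M lborel)"
    using mild_solution_moments(2)[OF mild t] True by (simp add: F_def)
  interpret P: pair_sigma_finite M "lborel :: (real \<times> 'a) measure" ..
  \<comment> \<open>Integrating over \<omega> first turns the square norm on the product space into
    a space-time integral, so that Jensen's inequality can be applied at each (s, y)
    separately.\<close>
  define K where "K z = (\<integral>\<^sup>+ \<omega>. ennreal ((?\<Phi> (\<omega>, z))\<^sup>2) \<partial>M)" for z
  have [measurable]: "K \<in> borel_measurable borel"
    unfolding K_def by measurable
  have low: "ennreal (A powr (1 + \<gamma>)) * (ennreal ((G (t - s) (x - y))\<^sup>2) * indicator B y) \<le> K (s, y)"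
    if s: "s \<in> {r<..<r'}" for s y
  proof (cases "y \<in> B")
    case yB: True
    have st: "s \<in> {0<..<t}" "0 \<le> s" using s r by auto
    have "ennreal (A powr (1 + \<gamma>)) \<le> (\<integral>\<^sup>+ \<omega>. ennreal ((\<bar>u s y \<omega>\<bar> powr (1 + \<gamma>))\<^sup>2) \<partial>M)"
      using F[OF s yB] unfolding F_def
      by (intro second_moment_powr mild_solution_measurable[OF mild st(2)] \<gamma> A)
    then have "ennreal ((G (t - s) (x - y))\<^sup>2) * ennreal (A powr (1 + \<gamma>)) \<le>
        ennreal ((G (t - s) (x - y))\<^sup>2) * (\<integral>\<^sup>+ \<omega>. ennreal ((\<bar>u s y \<omega>\<bar> powr (1 + \<gamma>))\<^sup>2) \<partial>M)"
      by (rule mult_left_mono) simp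
    also have "\<dots> = (\<integral>\<^sup>+ \<omega>. ennreal ((G (t - s) (x - y))\<^sup>2) * ennreal ((\<bar>u s y \<omega>\<bar> powr (1 + \<gamma>))\<^sup>2) \<partial>M)"
      using mild_solution_measurable[OF mild st(2), of y] by (intro nn_integral_cmult[symmetric]) measurable
    also have "\<dots> \<le> K (s, y)"
      unfolding K_def
    proof (rule nn_integral_mono)
      fix \<omega>
      have "(\<bar>u s y \<omega>\<bar> powr (1 + \<gamma>))\<^sup>2 \<le> (\<sigma> (u s y \<omega>))\<^sup>2"
        using \<sigma> by (rule power_mono) simp
      then have "(G (t - s) (x - y))\<^sup>2 * (\<bar>u s y \<omega>\<bar> powr (1 + \<gamma>))\<^sup>2 \<le> (?\<Phi> (\<omega>, s, y))\<^sup>2"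
        using st by (simp add: mild_integrand_def power_mult_distrib mult_left_mono)
      then show "ennreal ((G (t - s) (x - y))\<^sup>2) * ennreal ((\<bar>u s y \<omega>\<bar> powr (1 + \<gamma>))\<^sup>2) \<le> ennreal ((?\<Phi> (\<omega>, s, y))\<^sup>2)"
        by (simp add: ennreal_mult[symmetric] ennreal_leI)
    qed
    finally show ?thesis using yB by (simp add: mult.commute)
  qed simp
  have "ennreal (A powr (1 + \<gamma>) * k * (r' - r)) = (\<integral>\<^sup>+ s. ennreal (A powr (1 + \<gamma>) * k) * indicator {r<..<r'} s \<partial>lborel)"
    using r k0 by (subst nn_integral_cmult_indicator) (auto simp: ennreal_mult)
  also have "\<dots> \<le> (\<integral>\<^sup>+ s. (\<integral>\<^sup>+ y. K (s, y) \<partial>lborel) \<partial>lborel)"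
  proof (rule nn_integral_mono)
    fix s :: real
    show "ennreal (A powr (1 + \<gamma>) * k) * indicator {r<..<r'} s \<le> (\<integral>\<^sup>+ y. K (s, y) \<partial>lborel)"
    proof (cases "s \<in> {r<..<r'}")
      case s: True
      then have st: "0 < t - s" using r by auto
      note [measurable] = G_measurable[OF st] B
      have "ennreal (A powr (1 + \<gamma>) * k) = ennreal (A powr (1 + \<gamma>)) * ennreal k"
        using k0 by (intro ennreal_mult) auto
      also have "\<dots> \<le> ennreal (A powr (1 + \<gamma>)) * (\<integral>\<^sup>+ y. ennreal ((G (t - s) (x - y))\<^sup>2) * indicator B y \<partial>lborel)"
        by (rule mult_left_mono[OF k[OF s]]) simp
      also have "\<dots> = (\<integral>\<^sup>+ y. ennreal (A powr (1 + \<gamma>)) * (ennreal ((G (t - s) (x - y))\<^sup>2) * indicator B y) \<partial>lborel)"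
        by (rule nn_integral_cmult[symmetric]) measurable
      also have "\<dots> \<le> (\<integral>\<^sup>+ y. K (s, y) \<partial>lborel)"
        by (rule nn_integral_mono) (rule low[OF s])
      finally show ?thesis using s by simp
    qed simp
  qed
  also have "\<dots> = (\<integral>\<^sup>+ z. K z \<partial>lborel)"
    unfolding lborel_prod[symmetric] by (rule lborel.nn_integral_fst) (simp add: lborel_prod)
  also have "\<dots> = (\<integral>\<^sup>+ z. ennreal ((?\<Phi> z)\<^sup>2) \<partial>(M \<Otimes>\<^sub>M lborel))"
    unfolding K_def by (rule P.nn_integral_snd) measurable
  also have "\<dots> \<le> 4 * F t x"
    unfolding F_def using mild_solution_moments(3)[OF mild t] True by (simp add: F_def)
  finally show ?thesis .
qed (simp add: less_top[symmetric] ennreal_mult_top)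

lemma F_initial_lower_bound:
  assumes c: "0 \<le> c" and t: "0 < t" and G: "AE w in lborel. norm w \<le> 2 \<longrightarrow> c \<le> G t w"
    and u0: "u0 \<in> borel_measurable borel" "bounded (range u0)" "\<And>x. 0 \<le> u0 x" and x: "x \<in> ball 0 1"
  shows "ennreal ((c * (LINT y:ball 0 1|lborel. u0 y))\<^sup>2) \<le> F t x"
proof -
  note [measurable] = u0(1) G_measurable[OF t] borel_open[OF open_ball]
  obtain b where b: "\<And>y. \<bar>u0 y\<bar> \<le> b"
    using u0(2) by (auto simp: bounded_iff)
  have Gi: "integrable lborel (\<lambda>y. G t (x - y))"
  proof -
    have "integrable (distr lborel borel (\<lambda>z. x - z)) (G t)"
      by (simp add: lborel_distr_reflect G_integrable[OF t])
    then show ?thesis by (subst (asm) integrable_distr_eq) auto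
  qed
  have i: "integrable lborel (\<lambda>y. G t (x - y) * u0 y)"
  proof (rule Bochner_Integration.integrable_bound)
    show "integrable lborel (\<lambda>y. G t (x - y) * b)" using Gi by simp
    show "AE y in lborel. norm (G t (x - y) * u0 y) \<le> norm (G t (x - y) * b)"
      by (intro AE_I2) (simp add: abs_mult mult_left_mono order_trans[OF b abs_ge_self])
  qed measurable
  have bi: "integrable lborel (\<lambda>y. indicator (ball 0 1) y * u0 y)"
  proof (rule Bochner_Integration.integrable_bound)
    show "integrable lborel (\<lambda>y::'a. b * indicator (ball 0 1) y)"
      using emeasure_bounded_finite[OF bounded_ball] by (intro integrable_mult_right integrable_real_indicator) auto
    show "AE y in lborel. norm (indicator (ball 0 1) y * u0 y) \<le> norm (b * indicator (ball 0 1) y)"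
      using b by (intro AE_I2) (auto split: split_indicator intro!: order_trans[OF _ abs_ge_self])
    have "(\<lambda>y. indicator (ball 0 1) y * u0 y) \<in> borel_measurable borel"
      by measurable
    then show "(\<lambda>y. indicator (ball 0 1) y * u0 y) \<in> borel_measurable lborel"
      by simp
  qed
  have "c * (LINT y:ball 0 1|lborel. u0 y) = (LINT y|lborel. c * (indicator (ball 0 1) y * u0 y))"
    by (simp add: set_lebesgue_integral_def)
  also have "\<dots> \<le> (LINT y|lborel. G t (x - y) * u0 y)"
  proof (rule integral_mono_AE[OF integrable_mult_right[OF bi] i])
    show "AE y in lborel. c * (indicator (ball 0 1) y * u0 y) \<le> G t (x - y) * u0 y"
      using AE_lborel_reflect[OF G, of x]
    proof eventually_elim
      case (elim y)
      show ?case
      proof (cases "y \<in> ball 0 1")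
        case True
        then have "norm (x - y) \<le> 2" using x norm_triangle_ineq4[of x y] by simp
        then show ?thesis using elim True u0(3) by (simp add: mult_right_mono)
      qed (simp add: G_nonneg t u0(3))
    qed
  qed
  finally have "(c * (LINT y:ball 0 1|lborel. u0 y))\<^sup>2 \<le> (LINT y|lborel. G t (x - y) * u0 y)\<^sup>2"
    using c u0(3) by (intro power_mono) (auto simp: set_lebesgue_integral_def)
  then show ?thesis
    unfolding F_def using mild_solution_moments(1)[OF mild t, of x] by (meson ennreal_leI order_trans)
qed

lemma F_infinite_everywhere:
  assumes inf: "\<And>t x. t \<in> {3/2..2} \<Longrightarrow> x \<in> ball 0 (1/2) \<Longrightarrow> F t x = \<infinity>" and t: "2 \<le> t"
  shows "F t x = \<infinity>"
proof -
  \<comment> \<open>Source times s in (3/2, 7/4) lie in the region where F is infinite and keep t -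
    s above 1/4 for every t \<ge> 2, so \<open>G\<close> is evaluated away from time 0.\<close>
  have a: "0 < t - 7/4" "0 < norm x + 1" using t by (auto intro: add_nonneg_pos)
  obtain c where c: "0 < c" "\<And>s. s \<in> {t - 7/4..t - 3/2} \<Longrightarrow> AE w in lborel. norm w \<le> norm x + 1 \<longrightarrow> c \<le> G s w"
    using G_lower_bound[OF a, of "t - 3/2"] by blast
  define v where "v = measure lborel (ball (0::'a) (1/2))"
  have v: "0 < v" unfolding v_def by (rule content_ball_pos) simp
  have k: "ennreal (c\<^sup>2 * v) \<le> (\<integral>\<^sup>+ y. ennreal ((G (t - s) (x - y))\<^sup>2) * indicator (ball 0 (1/2)) y \<partial>lborel)"
    if s: "s \<in> {3/2<..<7/4}" for s
  proof -
    have "ennreal (c\<^sup>2 * v) = ennreal (c\<^sup>2) * emeasure lborel (ball (0::'a) (1/2))"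
      using emeasure_bounded_finite[OF bounded_ball, of "0::'a" "1/2"] c v
      by (simp add: v_def ennreal_mult emeasure_eq_ennreal_measure)
    also have "\<dots> = (\<integral>\<^sup>+ y. ennreal (c\<^sup>2) * indicator (ball (0::'a) (1/2)) y \<partial>lborel)"
      by (rule nn_integral_cmult_indicator[symmetric]) simp
    also have "\<dots> \<le> (\<integral>\<^sup>+ y. ennreal ((G (t - s) (x - y))\<^sup>2) * indicator (ball 0 (1/2)) y \<partial>lborel)"
    proof (rule nn_integral_mono_AE)
      have "t - s \<in> {t - 7/4..t - 3/2}" using s by auto
      from AE_lborel_reflect[OF c(2)[OF this], of x]
      show "AE y in lborel. ennreal (c\<^sup>2) * indicator (ball (0::'a) (1/2)) y \<le> ennreal ((G (t - s) (x - y))\<^sup>2) * indicator (ball 0 (1/2)) y"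
      proof eventually_elim
        case (elim y)
        show ?case
        proof (cases "y \<in> ball 0 (1/2)")
          case True
          then have "norm (x - y) \<le> norm x + 1" using norm_triangle_ineq4[of x y] by simp
          then show ?thesis using elim True c by (simp add: ennreal_leI power_mono)
        qed simp
      qed
    qed
    finally show ?thesis .
  qed
  have le: "ennreal (A powr (1 + \<gamma>) * (c\<^sup>2 * v) * (7/4 - 3/2)) \<le> 4 * F t x" if "0 < A" for A
    by (rule F_integral_lower_bound[where B="ball 0 (1/2)"])
      (use t that inf k c v in auto)
  show ?thesis
  proof (rule ccontr)
    assume "F t x \<noteq> \<infinity>"
    then have "4 * F t x < \<infinity>" by (simp add: ennreal_mult_less_top less_top)
    then obtain y where y: "0 \<le> y" "4 * F t x = ennreal y"
      by (cases "4 * F t x") auto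
    define k' where "k' = c\<^sup>2 * v * (7/4 - 3/2)"
    have k': "0 < k'" using c v by (simp add: k'_def)
    \<comment> \<open>The constant A, arbitrary because F is infinite on the source region, is
      chosen with A^(1 + \<gamma>) * k' = y + 1, which exceeds the supposed finite value y.\<close>
    have "ennreal ((((y + 1) / k') powr (1 / (1 + \<gamma>))) powr (1 + \<gamma>) * (c\<^sup>2 * v) * (7/4 - 3/2)) \<le> ennreal y"
      using le[of "((y + 1) / k') powr (1 / (1 + \<gamma>))"] y k' by simp
    moreover have "(((y + 1) / k') powr (1 / (1 + \<gamma>))) powr (1 + \<gamma>) = (y + 1) / k'"
      using y k' \<gamma> by (simp add: powr_powr)
    ultimately have "(y + 1) / k' * k' \<le> y"
      using y by (simp add: k'_def mult.assoc)
    then show False using k' by simp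
  qed
qed

text \<open>
  On \<open>[1 + \<tau> (1 - \<theta> ^ n) / (1 - \<theta>), 2]\<close> times the ball of radius \<open>1/2 + (1/2) ^ (n + 1)\<close> the second moment
  is at least \<open>a \<Lambda> ^ n\<close>: passing from n to n + 1 costs a time step \<open>\<tau> \<theta> ^ n\<close> and a margin \<open>(1/2) ^ (n + 2)\<close>
  in space, within which G carries half of its mass, and the power \<open>1 + \<gamma>\<close> beats these losses
  as soon as \<open>a\<close> is large.
\<close>

lemma F_blowup:
  assumes init: "\<And>t x. t \<in> {1..2} \<Longrightarrow> x \<in> ball 0 1 \<Longrightarrow> ennreal (threshold \<gamma>) \<le> F t x"
    and t: "t \<in> {3/2..2}" and x: "x \<in> ball 0 (1/2)"
  shows "F t x = \<infinity>"
proof -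
  define a where "a = threshold \<gamma>"
  \<comment> \<open>Solves \<Lambda>^\<gamma> * \<theta> = 1: at step n the gain \<Lambda>^(n
    \<gamma>) from the superlinear power cancels the factor \<theta>^n of the time step, so the same
    factor remains at every step.\<close>
  define \<Lambda> where "\<Lambda> = \<theta> powr (- 1 / \<gamma>)"
  have a: "0 < a" "a powr \<gamma> * (1 / (4 * v)) * \<tau> = 4 * \<Lambda>"
  proof -
    have \<Lambda>0: "0 < \<Lambda>" using \<theta>_bounds by (simp add: \<Lambda>_def)
    have a_eq: "a = (16 * v * \<Lambda> / \<tau>) powr (1 / \<gamma>)"
      by (simp add: a_def threshold_def \<Lambda>_def)
    have pos: "0 < 16 * v * \<Lambda> / \<tau>" using \<Lambda>0 v_pos \<tau>_bounds by simp
    show "0 < a" unfolding a_eq using v_pos \<tau>_bounds \<Lambda>0 by simp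
    have "a powr \<gamma> = 16 * v * \<Lambda> / \<tau>"
      unfolding a_eq using v_pos \<tau>_bounds \<Lambda>0 \<gamma> by (simp add: powr_powr)
    then show "a powr \<gamma> * (1 / (4 * v)) * \<tau> = 4 * \<Lambda>"
      using v_pos \<tau>_bounds by simp
  qed
  have \<Lambda>: "0 < \<Lambda>" "\<Lambda> powr \<gamma> = 1 / \<theta>"
    using \<theta>_bounds \<gamma> by (simp_all add: \<Lambda>_def powr_powr powr_neg_one)
  have \<Lambda>1: "1 < \<Lambda>"
  proof (rule ccontr)
    assume "\<not> 1 < \<Lambda>"
    then have "\<Lambda> powr \<gamma> \<le> 1" using \<Lambda>(1) \<gamma> by (intro powr_le1) auto
    then show False using \<Lambda>(2) \<theta>_bounds by (simp add: field_simps)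
  qed
  \<comment> \<open>Closed form of 1 plus the first n time steps; the geometric series stays below
    3/2.\<close>
  define T where "T n = 1 + \<tau> * (1 - \<theta> ^ n) / (1 - \<theta>)" for n
  have T_Suc: "T (Suc n) = T n + \<tau> * \<theta> ^ n" for n
    using \<theta>_bounds by (simp add: T_def field_simps)
  have T1: "1 \<le> T n" for n
    using \<theta>_bounds \<tau>_bounds by (simp add: T_def power_le_one)
  have T2: "T n \<le> 3 / 2" for n
  proof -
    have "\<tau> * (1 - \<theta> ^ n) \<le> (1 - \<theta>) / 2 * 1"
      using \<tau>_bounds \<theta>_bounds by (intro mult_mono) (auto simp: power_le_one)
    then show ?thesis using \<theta>_bounds by (simp add: T_def field_simps)
  qed
  define R where "R n = 1 / 2 + (1 / 2 :: real) ^ (n + 1)" for n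
  have main: "ennreal (a * \<Lambda> ^ n) \<le> F t x" if "t \<in> {T n..2}" "x \<in> ball 0 (R n)" for n t x
    using that
  proof (induction n arbitrary: t x)
    case 0
    then show ?case using init[of t x] by (simp add: T_def R_def a_def)
  next
    case (Suc n)
    \<comment> \<open>Exactly \<open>R n\<close> minus \<open>R (Suc n)\<close>: a displacement
      shorter than this from the smaller ball stays in the larger one.\<close>
    let ?r = "(1 / 2 :: real) ^ (n + 2)"
    have step: "0 < \<tau> * \<theta> ^ n" using \<tau>_bounds \<theta>_bounds by simp
    have pos: "0 < a * \<Lambda> ^ n" using a \<Lambda> by simp
    have "ennreal ((a * \<Lambda> ^ n) powr (1 + \<gamma>) * (1 / (4 * v)) * (t - (t - \<tau> * \<theta> ^ n))) \<le> 4 * F t x"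
    proof (rule F_integral_lower_bound[where B="ball 0 (R n)"])
      show "0 \<le> t - \<tau> * \<theta> ^ n"
        using Suc.prems(1) T1[of n] by (simp add: T_Suc)
      show "t - \<tau> * \<theta> ^ n < t" using step by simp
      show "ennreal (a * \<Lambda> ^ n) \<le> F s y" if "s \<in> {t - \<tau> * \<theta> ^ n<..<t}" "y \<in> ball 0 (R n)" for s y
        using that Suc.prems(1) by (intro Suc.IH) (auto simp: T_Suc)
      show "ennreal (1 / (4 * v)) \<le> (\<integral>\<^sup>+ y. ennreal ((G (t - s) (x - y))\<^sup>2) * indicator (ball 0 (R n)) y \<partial>lborel)"
        if s: "s \<in> {t - \<tau> * \<theta> ^ n<..<t}" for s
      proof -
        have ts: "0 < t - s" "t - s \<le> \<tau> * \<theta> ^ n" using s by auto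
        note [measurable] = G_measurable[OF ts(1)] borel_open[OF open_ball]
        \<comment> \<open>The margin is 1/4 * (1/2)^n, whose power \<kappa> is (1/4)^\<kappa> *
          \<theta>^n; thus the n-th time step fits the concentration bound for the n-th
          margin.\<close>
        have "\<tau> * \<theta> ^ n \<le> (\<delta> * (1/4) powr \<kappa>) * \<theta> ^ n"
          using \<theta>_bounds \<tau>_bounds by (intro mult_right_mono) auto
        also have "\<dots> = \<delta> * ((1/4) powr \<kappa> * ((1/2) ^ n) powr \<kappa>)"
          by (simp add: \<theta>_def powr_nat_power)
        also have "(1/4) powr \<kappa> * ((1/2) ^ n) powr \<kappa> = ?r powr \<kappa>"
          by (subst powr_mult[symmetric]) (simp_all add: power2_eq_square)
        finally have "t - s \<le> \<delta> * ?r powr \<kappa>" using ts(2) by (rule order_trans[rotated])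
        moreover have "?r \<le> 1" by (rule power_le_one) auto
        ultimately have "ennreal (1 / (4 * v)) \<le> (\<integral>\<^sup>+ w. ennreal ((G (t - s) w)\<^sup>2) * indicator (ball 0 ?r) w \<partial>lborel)"
          using ts(1) by (intro G_square_concentrated) simp_all
        also have "\<dots> = (\<integral>\<^sup>+ y. ennreal ((G (t - s) (x - y))\<^sup>2) * indicator (ball 0 ?r) (x - y) \<partial>lborel)"
          by (rule nn_integral_lborel_reflect[symmetric]) measurable
        also have "\<dots> \<le> (\<integral>\<^sup>+ y. ennreal ((G (t - s) (x - y))\<^sup>2) * indicator (ball 0 (R n)) y \<partial>lborel)"
        proof (intro nn_integral_mono mult_left_mono)
          fix y
          have "y \<in> ball 0 (R n)" if "x - y \<in> ball 0 ?r"
          proof -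
            have "norm y \<le> norm x + norm (x - y)" using norm_triangle_ineq4[of x "x - y"] by simp
            also have "\<dots> < R (Suc n) + ?r" using that Suc.prems(2) by simp
            also have "\<dots> = R n" by (simp add: R_def)
            finally show ?thesis by simp
          qed
          then show "(indicator (ball 0 ?r) (x - y) :: ennreal) \<le> indicator (ball 0 (R n)) y"
            by (auto split: split_indicator)
        qed simp
        finally show ?thesis .
      qed
    qed (use pos v_pos in auto)
    also have "(a * \<Lambda> ^ n) powr (1 + \<gamma>) * (1 / (4 * v)) * (t - (t - \<tau> * \<theta> ^ n)) = 4 * (a * \<Lambda> ^ Suc n)"
    proof -
      have "(\<Lambda> ^ n) powr \<gamma> * \<theta> ^ n = 1"
        using \<Lambda> \<theta>_bounds by (simp add: powr_nat_power power_mult_distrib[symmetric])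
      moreover have "(a * \<Lambda> ^ n) powr (1 + \<gamma>) = a * \<Lambda> ^ n * (a powr \<gamma> * (\<Lambda> ^ n) powr \<gamma>)"
        using a \<Lambda> by (simp add: powr_add powr_mult)
      ultimately have "(a * \<Lambda> ^ n) powr (1 + \<gamma>) * (1 / (4 * v)) * (t - (t - \<tau> * \<theta> ^ n)) =
          a * \<Lambda> ^ n * (a powr \<gamma> * (1 / (4 * v)) * \<tau>)"
        by (simp add: mult_ac)
      also have "\<dots> = a * \<Lambda> ^ n * (4 * \<Lambda>)" by (simp only: a(2))
      finally show ?thesis by (simp add: mult_ac)
    qed
    also have "ennreal (4 * (a * \<Lambda> ^ Suc n)) = 4 * ennreal (a * \<Lambda> ^ Suc n)"
      by (simp add: ennreal_mult')
    finally show ?case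
      by (subst (asm) ennreal_mult_le_mult_iff) auto
  qed
  have "x \<in> ball 0 (R n)" for n
  proof -
    have "1 / 2 < R n" by (simp add: R_def)
    then show ?thesis using x by simp
  qed
  then have le: "ennreal (a * \<Lambda> ^ n) \<le> F t x" for n
    using t T2[of n] by (intro main) auto
  show ?thesis
  proof (rule ccontr)
    assume "F t x \<noteq> \<infinity>"
    then obtain y where y: "0 \<le> y" "F t x = ennreal y"
      by (cases "F t x") auto
    obtain n where "y / a < \<Lambda> ^ n"
      using real_arch_pow[OF \<Lambda>1] by blast
    moreover have "a * \<Lambda> ^ n \<le> y"
      using le[of n] y by simp
    ultimately show False
      using a by (simp add: field_simps)
  qed
qed

end

theorem theorem1p9:
  fixes \<nu> \<alpha> \<beta> \<gamma> :: real
    and \<sigma> :: "real \<Rightarrow> real"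
    and p :: "real \<Rightarrow> 'a::euclidean_space \<Rightarrow> real"
    and N :: "'v measure"
    and D :: "real \<Rightarrow> 'v \<Rightarrow> real"
    and f :: "real \<Rightarrow> real \<Rightarrow> real"
  assumes "0 < \<nu>"
    and "0 < \<beta>" and "\<beta> < 1"
    and "0 < \<alpha>" and "\<alpha> < 2"
    and "real DIM('a) < min 2 (1 / \<beta>) * \<alpha>"
    and "locally_lipschitz \<sigma>"
    and "0 < \<gamma>"
    and "\<forall>z. \<bar>z\<bar> powr (1 + \<gamma>) \<le> \<sigma> z"
    and "stable_transition_density \<nu> \<alpha> p"
    and "stable_subordinator N \<beta> D"
    and "first_passage_density N D f"
  shows "\<exists>t0\<ge>0. \<exists>K>0. \<forall>u0 :: 'a \<Rightarrow> real.
    u0 \<in> borel_measurable borel \<longrightarrow> bounded (range u0) \<longrightarrow> (\<forall>x. 0 \<le> u0 x) \<longrightarrow>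
    (LINT x:ball 0 1|lborel. u0 x) > 0 \<longrightarrow>
    (\<forall>(M :: 'w measure) W u.
       space_time_white_noise M W \<longrightarrow>
       mild_solution M W (kernel_G p f) \<sigma> u0 u \<longrightarrow>
       (LINT x:ball 0 1|lborel. u0 x) \<ge> K \<longrightarrow>
       (\<forall>t\<ge>t0. \<forall>x. second_moment M (u t x) = \<infinity>))"
proof -
  interpret T: time_changed_stable \<nu> \<alpha> p N \<beta> D f
    using assms(1-5,10-12) by (intro time_changed_stable.intro stable_density.intro subordinator.intro)
  obtain \<delta> \<kappa> where \<delta>: "0 < \<delta>" "0 < \<kappa>"
    "\<And>t r. 0 < r \<Longrightarrow> 0 < t \<Longrightarrow> t \<le> \<delta> * r powr \<kappa> \<Longrightarrow>
      ennreal (1 / 2) \<le> (\<integral>\<^sup>+ x. ennreal (T.G t x) * indicator (ball 0 r) x \<partial>lborel)"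
  proof (rule T.G_concentrated)
    fix c k assume "0 < c" "0 < k" and "\<And>t r. 0 < r \<Longrightarrow> 0 < t \<Longrightarrow> t \<le> c * r powr k \<Longrightarrow>
      ennreal (1 / 2) \<le> (\<integral>\<^sup>+ x. ennreal (T.G t x) * indicator (ball 0 r) x \<partial>lborel)"
    then show thesis by (rule that)
  qed
  interpret B: blowup_kernel "kernel_G p f" \<delta> \<kappa>
    unfolding T.G_def[symmetric]
  proof
    show "\<exists>c>0. \<forall>t\<in>{a..b}. AE x in lborel. norm x \<le> R \<longrightarrow> c \<le> T.G t x" if "0 < a" "0 < R" for a b R
      by (rule T.G_lower_bound[OF that, of b]) blast
  qed (fact T.G_measurable T.G_nonneg T.G_integrable \<delta>)+
  have "\<exists>c>0. \<forall>t\<in>{1..2}. AE x in lborel. norm x \<le> 2 \<longrightarrow> c \<le> kernel_G p f t x"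
    by (rule B.G_lower_bound) simp_all
  then obtain c where c: "0 < c" "\<forall>t\<in>{1..2}. AE x in lborel. norm x \<le> 2 \<longrightarrow> c \<le> kernel_G p f t x"
    by (elim exE conjE)
  \<comment> \<open>Chosen so that (c * K)^2 is the threshold. Only the kernel and \<gamma> enter,
    and the choice is made before u0, the noise and the solution are introduced.\<close>
  define K where "K = sqrt (B.threshold \<gamma>) / c"
  have thr: "0 < B.threshold \<gamma>" by (rule B.threshold_pos)
  show ?thesis
  proof (rule exI[of _ 2], rule conjI, simp, rule exI[of _ K], intro conjI allI impI)
    show "0 < K" using thr c by (simp add: K_def)
    fix u0 :: "'a \<Rightarrow> real" and M :: "'w measure" and W u and t :: real and x :: 'a
    assume u0: "u0 \<in> borel_measurable borel" "bounded (range u0)" "\<forall>x. 0 \<le> u0 x"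
      and noise: "space_time_white_noise M W" and mild: "mild_solution M W (kernel_G p f) \<sigma> u0 u"
      and K: "K \<le> (LINT x:ball 0 1|lborel. u0 x)" and t: "2 \<le> t"
    interpret E: noise_equation M W "kernel_G p f" \<delta> \<kappa> \<sigma> u0 u \<gamma>
    proof (intro noise_equation.intro noise_equation_axioms.intro white_noise.intro)
      show "blowup_kernel (kernel_G p f) \<delta> \<kappa>" by (rule B.blowup_kernel_axioms)
      show "\<bar>z\<bar> powr (1 + \<gamma>) \<le> \<sigma> z" for z using assms(9) by blast
    qed fact+
    have "ennreal (B.threshold \<gamma>) \<le> E.F s y" if s: "s \<in> {1..2}" and y: "y \<in> ball 0 1" for s y
    proof -
      have "sqrt (B.threshold \<gamma>) \<le> c * (LINT x:ball 0 1|lborel. u0 x)"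
        using K c by (simp add: K_def field_simps)
      then have "(sqrt (B.threshold \<gamma>))\<^sup>2 \<le> (c * (LINT x:ball 0 1|lborel. u0 x))\<^sup>2"
        using thr by (intro power_mono) auto
      then have "ennreal (B.threshold \<gamma>) \<le> ennreal ((c * (LINT x:ball 0 1|lborel. u0 x))\<^sup>2)"
        using thr by (intro ennreal_leI) simp
      also have "\<dots> \<le> E.F s y"
      proof (rule E.F_initial_lower_bound)
        show "AE w in lborel. norm w \<le> 2 \<longrightarrow> c \<le> kernel_G p f s w"
          using c(2) s by (rule bspec)
      qed (use c(1) u0 s y in auto)
      finally show ?thesis .
    qed
    then have "E.F s y = \<infinity>" if "s \<in> {3/2..2}" "y \<in> ball 0 (1/2)" for s y
      using that by (rule E.F_blowup)
    then show "second_moment M (u t x) = \<infinity>"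
      using E.F_infinite_everywhere[OF _ t, of x] unfolding E.F_def by blast
  qed
qed

end
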